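(* Let $\phi:\mathbb D\to\mathbb D$ be an inner function of positive hyperbolic step. Then there exist a non-constant Blaschke product $B$ and a unimodular constant $\tau$ such that $B\circ\phi=\tau B$.
   Context: $\mathbb D$ is the open unit disk. For $n\in\mathbb N_0$, $\phi^{[n]}$ denotes the $n$-th iterate of $\phi$. The pseudo-hyperbolic distance is $\rho(z_1,z_2)=\left|\frac{z_2-z_1}{1-\overline{z_2}z_1}\right|$. A holomorphic self-map $\phi$ of $\mathbb D$ is of positive hyperbolic step if $\lim_{n\to\infty}\rho(\phi^{[n]}(z_0),\phi^{[n+1]}(z_0))>0$ for some $z_0\in\mathbb D$. *)

theory Defs
  imports "HOL-Analysis.Analysis"
begin

abbreviation unit_disc :: "complex set" where
  "unit_disc \<equiv> ball 0 1"

definition pseudo_hyp :: "complex \<Rightarrow> complex \<Rightarrow> real" where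
  "pseudo_hyp z1 z2 = norm ((z2 - z1) / (1 - cnj z2 * z1))"

definition inner_function :: "(complex \<Rightarrow> complex) \<Rightarrow> bool" where
  "inner_function f \<longleftrightarrow>
     f holomorphic_on unit_disc \<and> f ` unit_disc \<subseteq> unit_disc \<and>
     (AE \<theta> in lborel. \<theta> \<in> {0..2*pi} \<longrightarrow>
        (\<exists>w. norm w = 1 \<and> ((\<lambda>r::real. f (of_real r * cis \<theta>)) \<longlongrightarrow> w) (at_left 1)))"

text \<open>Positive hyperbolic step (the limit exists by Schwarz--Pick; we require it
  to exist and be positive for some starting point).\<close>
definition positive_hyperbolic_step :: "(complex \<Rightarrow> complex) \<Rightarrow> bool" where
  "positive_hyperbolic_step f \<longleftrightarrow>
     (\<exists>z0 \<in> unit_disc. \<exists>L > 0.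
        (\<lambda>n. pseudo_hyp ((f ^^ n) z0) ((f ^^ Suc n) z0)) \<longlonglongrightarrow> L)"

definition blaschke_factor :: "complex \<Rightarrow> complex \<Rightarrow> complex" where
  "blaschke_factor a z =
     (if a = 0 then z else (of_real (norm a) / a) * (a - z) / (1 - cnj a * z))"

definition blaschke_product :: "(complex \<Rightarrow> complex) \<Rightarrow> bool" where
  "blaschke_product B \<longleftrightarrow>
     (\<exists>c a I. norm c = 1 \<and> (\<forall>i\<in>I. a i \<in> unit_disc) \<and>
        summable (\<lambda>i. if i \<in> I then 1 - norm (a i) else 0) \<and>
        (\<forall>z\<in>unit_disc.
           (\<lambda>i. if i \<in> I then blaschke_factor (a i) z else 1) has_prod (B z / c)))"

end

theory Submission
  imports Defs "HOL-Complex_Analysis.Complex_Analysis" "HOL-Probability.Probability"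
begin

text \<open>
  Write \<open>T\<^sub>a\<close> for the involutive disc automorphism exchanging \<open>0\<close> and \<open>a\<close>, and put \<open>x\<^sub>n = \<phi>\<^sup>n(0)\<close>,
  \<open>q\<^sub>n = T\<^bsub>x\<^sub>n\<^esub> \<circ> \<phi>\<^sup>n\<close> and \<open>\<psi>\<^sub>n = T\<^bsub>x\<^sub>n\<^esub> \<circ> \<phi> \<circ> T\<^bsub>x\<^sub>n\<^esub>\<close>, so that \<open>\<psi>\<^sub>n \<circ> q\<^sub>n = q\<^sub>n \<circ> \<phi>\<close>. Along a subsequence
  \<open>q\<^sub>n \<rightarrow> g\<close> and \<open>\<psi>\<^sub>n \<rightarrow> A\<close>, hence \<open>g \<circ> \<phi> = A \<circ> g\<close>. Positivity of the hyperbolic step gives equality in the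
  Schwarz--Pick lemma for \<open>A\<close>, which is therefore an automorphism. If \<open>A\<close> has a fixed point in the disc, then by
  Hurwitz so has \<open>\<phi>\<close>; the positive step then forces \<open>\<phi>\<close> to be an elliptic automorphism and a single Blaschke
  factor is an eigenfunction. Otherwise \<open>1 - |A\<^sup>n(0)|\<close> is summable over all integers \<open>n\<close>.

  Iterates of \<open>\<phi>\<close> are inner, and \<open>g = E\<^sub>n \<circ> q\<^sub>n\<close> with \<open>E\<^sub>n = A\<^sup>-\<^sup>n \<circ> g \<circ> T\<^bsub>x\<^sub>n\<^esub>\<close> converging to the identity, so
  \<open>g\<close> is inner as well. For a point \<open>a\<close>, the product over the orbit \<open>A\<^sup>n(a)\<close> of Blaschke factors composed with \<open>g\<close>
  is multiplied by a unimodular constant under composition with \<open>\<phi>\<close>. Averaging its logarithm over \<open>a\<close> in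
  a segment, as in Frostman's theorem, shows that for almost every \<open>a\<close> it has no singular factor.
\<close>

section \<open>Schur functions and Moebius involutions\<close>

text \<open>Boundary values are given only for \<open>\<phi>\<close>, whereas g is a locally uniform
  limit, and such limits of inner functions need not be inner. Innerness is therefore carried as
  \<open>inner_mean\<close>, a condition on circles inside the disc; the radial limits of
  \<open>\<phi>\<close> enter only when \<open>\<phi>\<close> is composed from outside with such a
  function. The rescaling by x_n is chosen because |psi_n(0)| is then the pseudo-hyperbolic step at
  x_n, so that the step survives in the limit A. Hyperbolic and parabolic A need no separation: the
  defects 1 - |A^n(0)|^2 are at most a constant times n^-2 in both cases. Averaged over a, the sum
  of the Green potentials along the orbit costs a constant times the total defect of the functions
  A^n o g, and this tends to 0 at the circle because it is dominated by the summable defects at the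
  origin. The infinite product is never formed. A normal limit of its finite symmetric parts is
  taken, which already satisfies the functional equation, and a separate criterion recognises it as
  a Blaschke product.\<close>

definition mob :: "complex \<Rightarrow> complex \<Rightarrow> complex" where
  "mob a z = (a - z) / (1 - cnj a * z)"

text \<open>The non-strict bound makes the class closed under locally uniform limits.
  \<open>disc_map\<close> is the class that can be composed; by the maximum principle a Schur
  function fails to be one only if it is a unimodular constant.\<close>

definition schur :: "(complex \<Rightarrow> complex) \<Rightarrow> bool" where
  "schur f \<longleftrightarrow> f holomorphic_on unit_disc \<and> (\<forall>z. norm z < 1 \<longrightarrow> norm (f z) \<le> 1)"

definition disc_map :: "(complex \<Rightarrow> complex) \<Rightarrow> bool" where
  "disc_map f \<longleftrightarrow> f holomorphic_on unit_disc \<and> (\<forall>z. norm z < 1 \<longrightarrow> norm (f z) < 1)"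

lemma disc_map_imp_schur: "disc_map f \<Longrightarrow> schur f"
  unfolding disc_map_def schur_def by (auto intro: less_imp_le)

lemma disc_mapD: "disc_map f \<Longrightarrow> norm z < 1 \<Longrightarrow> norm (f z) < 1"
  unfolding disc_map_def by auto

lemma schurD: "schur f \<Longrightarrow> norm z < 1 \<Longrightarrow> norm (f z) \<le> 1"
  unfolding schur_def by auto

lemma disc_map_id: "disc_map (\<lambda>z. z)"
  unfolding disc_map_def by (auto intro: holomorphic_intros)

lemma schur_compose:
  assumes "schur f" "disc_map g"
  shows "schur (\<lambda>z. f (g z))"
proof -
  have "f \<circ> g holomorphic_on unit_disc"
    by (rule holomorphic_on_compose_gen[where t=unit_disc])
       (use assms in \<open>auto simp: schur_def disc_map_def\<close>)
  then show ?thesis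
    using assms by (auto simp: schur_def disc_map_def o_def)
qed

lemma disc_map_compose:
  assumes "disc_map f" "disc_map g"
  shows "disc_map (\<lambda>z. f (g z))"
  using schur_compose[OF disc_map_imp_schur[OF assms(1)] assms(2)] assms
  by (auto simp: schur_def disc_map_def)

lemma disc_map_funpow: "disc_map f \<Longrightarrow> disc_map (f ^^ n)"
  by (induction n) (auto simp: o_def id_def intro: disc_map_id disc_map_compose)

lemma schur_prod: "(\<And>i. i \<in> S \<Longrightarrow> schur (f i)) \<Longrightarrow> schur (\<lambda>z. \<Prod>i\<in>S. f i z)"
  by (auto simp: schur_def prod_norm[symmetric] intro!: holomorphic_intros prod_le_1)

section \<open>Pseudo-hyperbolic geometry of the disc automorphisms\<close>

lemma mob_denom:
  assumes "norm a < 1" "norm z \<le> 1"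
  shows "1 - cnj a * z \<noteq> 0"
proof
  assume "1 - cnj a * z = 0"
  then have "norm (cnj a * z) = 1" by (metis eq_iff_diff_eq_0 norm_one)
  then have "norm a * norm z = 1" by (simp add: norm_mult)
  moreover have "norm a * norm z \<le> norm a * 1" using assms by (intro mult_left_mono) auto
  ultimately show False using assms by auto
qed

lemma mob_denom':
  assumes "norm a < 1" "norm z \<le> 1"
  shows "1 - norm a \<le> norm (1 - cnj a * z)"
proof -
  have "norm (cnj a * z) \<le> norm a" using assms by (simp add: norm_mult mult_left_le)
  then show ?thesis using norm_triangle_ineq2[of 1 "cnj a * z"] by simp
qed

lemma one_minus_norm_mob:
  assumes "norm a < 1" "norm z \<le> 1"
  shows "1 - (norm (mob a z))\<^sup>2 = (1 - (norm a)\<^sup>2) * (1 - (norm z)\<^sup>2) / (norm (1 - cnj a * z))\<^sup>2"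
proof -
  have nz: "(norm (1 - cnj a * z))\<^sup>2 \<noteq> 0" using mob_denom[OF assms] by simp
  have "complex_of_real ((norm (1 - cnj a * z))\<^sup>2 - (norm (a - z))\<^sup>2) =
        complex_of_real ((1 - (norm a)\<^sup>2) * (1 - (norm z)\<^sup>2))"
    unfolding of_real_diff of_real_mult of_real_1 complex_norm_square
    by (simp add: algebra_simps)
  then have "(norm (1 - cnj a * z))\<^sup>2 - (norm (a - z))\<^sup>2 = (1 - (norm a)\<^sup>2) * (1 - (norm z)\<^sup>2)"
    using of_real_eq_iff by blast
  then show ?thesis using nz
    by (simp add: mob_def norm_divide power_divide field_simps)
qed

lemma norm_mob_less:
  assumes "norm a < 1" "norm z < 1"
  shows "norm (mob a z) < 1"
proof -
  have "(norm a)\<^sup>2 < 1" "(norm z)\<^sup>2 < 1" using assms by (simp_all add: abs_square_less_1)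
  then have "0 < (1 - (norm a)\<^sup>2) * (1 - (norm z)\<^sup>2) / (norm (1 - cnj a * z))\<^sup>2"
    using mob_denom[of a z] assms by (intro divide_pos_pos mult_pos_pos) auto
  then have "(norm (mob a z))\<^sup>2 < 1" using one_minus_norm_mob[of a z] assms by simp
  then show ?thesis by (simp add: abs_square_less_1)
qed

text \<open>The defect 1 - |z|^2 grows by at most a constant factor under a fixed automorphism, so
  every estimate in terms of the defect survives such a change of coordinates.\<close>

lemma one_minus_norm_mob_le:
  assumes "norm a < 1" "norm z \<le> 1"
  shows "1 - (norm (mob a z))\<^sup>2 \<le> (1 - (norm z)\<^sup>2) / (1 - norm a)\<^sup>2"
proof -
  have z: "0 \<le> 1 - (norm z)\<^sup>2" using assms by (simp add: abs_square_le_1)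
  have "(1 - (norm a)\<^sup>2) * (1 - (norm z)\<^sup>2) \<le> 1 - (norm z)\<^sup>2"
    using z by (intro mult_left_le_one_le) (use assms in \<open>auto simp: abs_square_le_1\<close>)
  moreover have "(1 - norm a)\<^sup>2 \<le> (norm (1 - cnj a * z))\<^sup>2"
    using mob_denom'[OF assms] assms by (intro power_mono) auto
  ultimately show ?thesis unfolding one_minus_norm_mob[OF assms]
    using z assms by (intro frac_le) auto
qed

lemma mob_0 [simp]: "mob a 0 = a" by (simp add: mob_def)
lemma mob_self [simp]: "mob a a = 0" by (simp add: mob_def)

lemma mob_eq_0_iff: "norm a < 1 \<Longrightarrow> norm z < 1 \<Longrightarrow> mob a z = 0 \<longleftrightarrow> z = a"
  using mob_denom[of a z] by (auto simp: mob_def)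

lemma mob_mob:
  assumes "norm a < 1" "norm z < 1"
  shows "mob a (mob a z) = z"
proof -
  have 1: "1 - cnj a * z \<noteq> 0" using assms mob_denom by auto
  have 2: "1 - cnj a * a \<noteq> 0" using assms mob_denom by auto
  have n: "a - mob a z = z * (1 - cnj a * a) / (1 - cnj a * z)"
    unfolding mob_def using 1 by (simp add: divide_simps) (simp add: algebra_simps)
  have d: "1 - cnj a * mob a z = (1 - cnj a * a) / (1 - cnj a * z)"
    unfolding mob_def using 1 by (simp add: divide_simps) (simp add: algebra_simps)
  show ?thesis unfolding mob_def[of a "mob a z"] n d using 1 2 by simp
qed

lemma norm_mob_commute: "norm (mob a z) = norm (mob z a)"
proof -
  have "norm (1 - cnj a * z) = norm (cnj (1 - cnj a * z))" by (simp only: complex_mod_cnj)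
  also have "\<dots> = norm (1 - cnj z * a)" by (simp add: mult.commute)
  finally show ?thesis by (simp add: mob_def norm_divide norm_minus_commute)
qed

lemma pseudo_hyp_eq_mob: "pseudo_hyp z w = norm (mob w z)"
  by (simp add: pseudo_hyp_def mob_def)

lemma disc_map_mob:
  assumes a: "norm a < 1"
  shows "disc_map (mob a)"
  unfolding disc_map_def
proof (intro conjI allI impI norm_mob_less a)
  show "mob a holomorphic_on unit_disc"
    unfolding mob_def[abs_def] using mob_denom[OF a] by (intro holomorphic_intros) auto
qed

lemma tendsto_mob:
  assumes "(f \<longlongrightarrow> a) F" "(g \<longlongrightarrow> z) F" "norm a < 1" "norm z < 1"
  shows "((\<lambda>n. mob (f n) (g n)) \<longlongrightarrow> mob a z) F"
  unfolding mob_def using assms mob_denom[of a z] by (auto intro!: tendsto_intros)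

text \<open>Moving a and f a to the origin turns this into the Schwarz lemma for \<open>h\<close>.
  The second part upgrades equality at one point to a formula on the whole disc.\<close>

lemma schwarz_pick:
  assumes f: "disc_map f" and a: "norm a < 1" and z: "norm z < 1"
  shows "norm (mob (f a) (f z)) \<le> norm (mob a z)"
    and "z \<noteq> a \<Longrightarrow> norm (mob (f a) (f z)) = norm (mob a z) \<Longrightarrow>
          \<exists>l. norm l = 1 \<and> (\<forall>z. norm z < 1 \<longrightarrow> mob (f a) (f z) = l * mob a z)"
proof -
  define h where "h = (\<lambda>z. mob (f a) (f (mob a z)))"
  have h: "disc_map h" unfolding h_def
    by (rule disc_map_compose[OF disc_map_mob[OF disc_mapD[OF f a]] disc_map_compose[OF f disc_map_mob[OF a]]])
  have h0: "h 0 = 0" by (simp add: h_def)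
  note S = Schwarz_Lemma[of h, OF _ h0]
  have hz: "h (mob a z) = mob (f a) (f z)" if "norm z < 1" for z
    using that a by (simp add: h_def mob_mob)
  show "norm (mob (f a) (f z)) \<le> norm (mob a z)"
    using S(1)[of "mob a z"] h norm_mob_less[OF a z] hz[OF z] by (auto simp: disc_map_def)
  assume ne: "z \<noteq> a" and eq: "norm (mob (f a) (f z)) = norm (mob a z)"
  have "mob a z \<noteq> 0" using ne a z by (simp add: mob_eq_0_iff)
  then have ex: "\<exists>x. norm x < 1 \<and> x \<noteq> 0 \<and> norm (h x) = norm x"
    using norm_mob_less[OF a z] hz[OF z] eq by metis
  have "\<exists>\<alpha>. (\<forall>z. norm z < 1 \<longrightarrow> h z = \<alpha> * z) \<and> norm \<alpha> = 1"
    by (rule S(3)[of 0]) (use h ex in \<open>simp_all add: disc_map_def\<close>)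
  then obtain l where l: "norm l = 1" "\<And>z. norm z < 1 \<Longrightarrow> h z = l * z" by blast
  have "mob (f a) (f z) = l * mob a z" if "norm z < 1" for z
    using l(2)[OF norm_mob_less[OF a that]] hz[OF that] by simp
  then show "\<exists>l. norm l = 1 \<and> (\<forall>z. norm z < 1 \<longrightarrow> mob (f a) (f z) = l * mob a z)"
    using l(1) by blast
qed

lemma norm_mob_mob:
  assumes "norm c < 1" "norm a < 1" "norm z < 1"
  shows "norm (mob (mob c a) (mob c z)) = norm (mob a z)"
  using schwarz_pick(1)[OF disc_map_mob[OF assms(1)] assms(2,3)]
        schwarz_pick(1)[OF disc_map_mob[OF assms(1)] norm_mob_less[OF assms(1,2)] norm_mob_less[OF assms(1,3)]]
        assms by (simp add: mob_mob)

section \<open>Schur functions: maximum principle, division by zeros, normal families\<close>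

lemma schur_constant:
  assumes f: "schur f" and z: "norm z < 1" "norm (f z) = 1" and w: "norm w < 1"
  shows "f w = f z"
proof -
  have "f constant_on unit_disc"
    by (rule maximum_modulus_principle[where U=unit_disc and \<xi>=z])
       (use f z in \<open>auto simp: schur_def\<close>)
  then show ?thesis using z w by (auto simp: constant_on_def)
qed

lemma schur_imp_disc_map:
  assumes f: "schur f" and z: "norm z < 1" "norm (f z) < 1"
  shows "disc_map f"
  unfolding disc_map_def
proof (intro conjI allI impI)
  show "f holomorphic_on unit_disc" using f by (simp add: schur_def)
  fix w :: complex assume w: "norm w < 1"
  show "norm (f w) < 1"
    using schurD[OF f w] schur_constant[OF f w _ z(1)] z by fastforce
qed

text \<open>Off the origin the Schwarz lemma bounds the quotient; at the origin its value is the
  derivative of f, which the same lemma bounds.\<close>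

lemma schur_divide_zero:
  assumes f: "schur f" and f0: "f 0 = 0"
  obtains h where "schur h" "\<And>z. norm z < 1 \<Longrightarrow> f z = z * h z"
proof -
  have d: "disc_map f" using schur_imp_disc_map[OF f, of 0] f0 by simp
  then have hf: "f holomorphic_on unit_disc" by (simp add: disc_map_def)
  obtain h where h: "h holomorphic_on unit_disc" "\<And>z. norm z < 1 \<Longrightarrow> f z = z * h z" "deriv f 0 = h 0"
    using Schwarz3[OF hf f0] by auto
  have "norm (h z) \<le> 1" if z: "norm z < 1" for z
  proof (cases "z = 0")
    case True
    then show ?thesis using Schwarz_Lemma(2)[OF hf f0 disc_mapD[OF d], of z] h z by simp
  next
    case False
    have "norm (f z) \<le> norm z" using Schwarz_Lemma(1)[OF hf f0 disc_mapD[OF d], of z] z by simp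
    then show ?thesis using h(2)[OF z] False by (simp add: norm_mult)
  qed
  then show ?thesis using h that by (auto simp: schur_def)
qed

lemma schur_divide_mob:
  assumes f: "schur f" and a: "norm a < 1" and fa: "f a = 0"
  obtains h where "schur h" "\<And>z. norm z < 1 \<Longrightarrow> f z = mob a z * h z"
proof -
  obtain k where k: "schur k" "\<And>z. norm z < 1 \<Longrightarrow> f (mob a z) = z * k z"
    using schur_divide_zero[OF schur_compose[OF f disc_map_mob[OF a]]] fa by auto
  show ?thesis
  proof (rule that[of "\<lambda>z. k (mob a z)"])
    show "schur (\<lambda>z. k (mob a z))" by (rule schur_compose[OF k(1) disc_map_mob[OF a]])
    show "f z = mob a z * k (mob a z)" if "norm z < 1" for z
      using k(2)[of "mob a z"] that a by (simp add: norm_mob_less mob_mob)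
  qed
qed

lemma schur_limit:
  assumes "\<And>n. schur (f n)" "g holomorphic_on unit_disc"
    and "\<And>z. norm z < 1 \<Longrightarrow> (\<lambda>n. f n z) \<longlonglongrightarrow> g z"
  shows "schur g"
  unfolding schur_def
proof (intro conjI allI impI)
  fix z :: complex assume z: "norm z < 1"
  show "norm (g z) \<le> 1"
    by (rule LIMSEQ_le_const2[OF tendsto_norm[OF assms(3)[OF z]]])
       (use schurD[OF assms(1) z] in auto)
qed fact

lemma schur_Montel:
  assumes f: "\<And>n::nat. schur (f n)"
  shows "\<exists>g r. schur g \<and> strict_mono (r :: nat \<Rightarrow> nat) \<and>
    (\<forall>z. norm z < 1 \<longrightarrow> (\<lambda>n. f (r n) z) \<longlonglongrightarrow> g z) \<and>
    (\<forall>K. compact K \<and> K \<subseteq> unit_disc \<longrightarrow> uniform_limit K (\<lambda>n. f (r n)) g sequentially)"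
proof -
  obtain g r where gr: "g holomorphic_on unit_disc" "strict_mono (r :: nat \<Rightarrow> nat)"
    "\<And>z. z \<in> unit_disc \<Longrightarrow> (\<lambda>n. f (r n) z) \<longlonglongrightarrow> g z"
    "\<And>K. compact K \<Longrightarrow> K \<subseteq> unit_disc \<Longrightarrow> uniform_limit K (f \<circ> r) g sequentially"
  proof (rule Montel[where S=unit_disc and \<H>="{h. schur h}" and \<F>=f])
    show "\<exists>B. \<forall>h\<in>{h. schur h}. \<forall>z\<in>K. norm (h z) \<le> B" if "compact K" "K \<subseteq> unit_disc" for K
      using that by (intro exI[of _ 1]) (auto simp: schur_def subset_iff)
  qed (use f in \<open>auto simp: schur_def\<close>)
  have pt: "(\<lambda>n. f (r n) z) \<longlonglongrightarrow> g z" if "norm z < 1" for z using gr(3) that by simp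
  have "schur g" by (rule schur_limit[where f="\<lambda>n. f (r n)"]) (use f gr(1) pt in auto)
  then show ?thesis using gr(2,4) pt unfolding o_def by blast
qed

text \<open>A normal limit attains modulus 1 at the interior point 0 and is therefore constant. This
  is how surplus factors are turned into unimodular constants.\<close>

lemma schur_Montel_unimodular:
  assumes f: "\<And>n::nat. schur (f n)" and f0: "(\<lambda>n. norm (f n 0)) \<longlonglongrightarrow> 1"
  shows "\<exists>c r. norm c = 1 \<and> strict_mono (r :: nat \<Rightarrow> nat) \<and>
    (\<forall>z. norm z < 1 \<longrightarrow> (\<lambda>n. f (r n) z) \<longlonglongrightarrow> c)"
proof -
  obtain g r where gr: "schur g" "strict_mono (r :: nat \<Rightarrow> nat)"
    and lim: "\<forall>z. norm z < 1 \<longrightarrow> (\<lambda>n. f (r n) z) \<longlonglongrightarrow> g z"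
    using schur_Montel[of f] f by blast
  have "(\<lambda>n. norm (f (r n) 0)) \<longlonglongrightarrow> norm (g 0)" using lim by (intro tendsto_norm) auto
  moreover have "(\<lambda>n. norm (f (r n) 0)) \<longlonglongrightarrow> 1" using LIMSEQ_subseq_LIMSEQ[OF f0 gr(2)] by (simp add: o_def)
  ultimately have 1: "norm (g 0) = 1" using LIMSEQ_unique by blast
  then have "g z = g 0" if "norm z < 1" for z using schur_constant[OF gr(1), of 0 z] that by simp
  then have "\<forall>z. norm z < 1 \<longrightarrow> (\<lambda>n. f (r n) z) \<longlonglongrightarrow> g 0" using lim by metis
  then show ?thesis using 1 gr(2) by blast
qed

text \<open>Semiconjugacies are passed to the limit with a varying argument as well as a varying
  function, for which pointwise convergence would not do.\<close>

lemma tendsto_uniform_compose: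
  assumes ul: "\<And>K. compact K \<Longrightarrow> K \<subseteq> unit_disc \<Longrightarrow> uniform_limit K f g sequentially"
    and g: "g holomorphic_on unit_disc" and x: "x \<longlonglongrightarrow> y" and y: "norm y < 1"
  shows "(\<lambda>n. f n (x n)) \<longlonglongrightarrow> g (y::complex)"
proof -
  obtain s where s: "norm y < s" "s < 1" using dense y by blast
  have ev: "eventually (\<lambda>n. x n \<in> cball 0 s) sequentially"
    using order_tendstoD(2)[OF tendsto_norm[OF x] s(1)] by eventually_elim auto
  have "cball 0 s \<subseteq> unit_disc" using s by auto
  then have u: "uniform_limit (cball 0 s) f g sequentially" by (intro ul) auto
  have "continuous_on (cball 0 s) g"
    using holomorphic_on_imp_continuous_on[OF g] \<open>cball 0 s \<subseteq> unit_disc\<close> continuous_on_subset by blast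
  then have g': "(\<lambda>n. g (x n)) \<longlonglongrightarrow> g y"
    by (rule continuous_on_tendsto_compose[OF _ x _ ev]) (use s in simp)
  have "(\<lambda>n. dist (f n (x n)) (g (x n))) \<longlonglongrightarrow> 0"
  proof (rule tendstoI)
    fix e :: real assume "e > 0"
    from uniform_limitD[OF u this] ev
    show "eventually (\<lambda>n. dist (dist (f n (x n)) (g (x n))) 0 < e) sequentially"
      by eventually_elim auto
  qed
  then show ?thesis
    by (intro Lim_transform[OF g']) (simp add: dist_norm tendsto_norm_zero_iff)
qed

section \<open>Circle means and the Poisson kernel\<close>

text \<open>Normalised to total mass 1, so that circle means are plain integrals and bounded
  measurable functions are integrable.\<close>

definition circ :: "real measure" where
  "circ = uniform_measure lborel {0..2*pi}"

lemma sets_circ [measurable_cong]: "sets circ = sets borel"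
  by (simp add: circ_def)

lemma space_circ [simp]: "space circ = UNIV"
  by (simp add: circ_def)

interpretation circ: prob_space circ
  unfolding circ_def by (rule prob_space_uniform_measure) auto

lemma AE_circI: "(AE t in lborel. t \<in> {0..2*pi} \<longrightarrow> P t) \<Longrightarrow> AE t in circ. P t"
  unfolding circ_def by (rule AE_uniform_measureI) auto

lemma continuous_on_circle:
  fixes f :: "complex \<Rightarrow> 'a::topological_space"
  assumes "continuous_on (sphere 0 r) f" "0 \<le> r"
  shows "continuous_on UNIV (\<lambda>t. f (of_real r * cis t))"
proof -
  have "continuous_on UNIV (\<lambda>t. of_real r * cis t)" by (intro continuous_intros)
  then show ?thesis
    by (rule continuous_on_compose2[OF assms(1)]) (use assms(2) in \<open>auto simp: norm_mult\<close>)
qed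

lemma measurable_circle:
  fixes f :: "complex \<Rightarrow> 'a::topological_space"
  assumes "continuous_on (sphere 0 r) f" "0 \<le> r"
  shows "(\<lambda>t. f (of_real r * cis t)) \<in> borel_measurable circ"
  using borel_measurable_continuous_onI[OF continuous_on_circle[OF assms]]
  by (simp add: measurable_cong_sets[OF sets_circ refl])

lemma integrable_circle:
  fixes f :: "complex \<Rightarrow> 'a::{banach, second_countable_topology}"
  assumes f: "continuous_on (sphere 0 r) f" and r: "0 \<le> r"
  shows "integrable circ (\<lambda>t. f (of_real r * cis t))"
proof -
  have "bounded (f ` sphere 0 r)"
    by (intro compact_imp_bounded compact_continuous_image f) auto
  then obtain B where B': "\<forall>z\<in>sphere 0 r. norm (f z) \<le> B"
    by (auto simp: bounded_iff)
  then have B: "norm (f z) \<le> B" if "norm z = r" for z using that by simp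
  show ?thesis
    by (rule circ.integrable_const_bound[where B=B])
       (use B r in \<open>auto simp: norm_mult intro!: measurable_circle f\<close>)
qed

lemma integral_circ:
  fixes f :: "real \<Rightarrow> complex"
  assumes f: "continuous_on UNIV f" and i: "(f has_integral I) {0..2*pi}"
  shows "(LINT t|circ. f t) = I / (2*pi)"
proof -
  have fm: "f \<in> borel_measurable borel" by (rule borel_measurable_continuous_onI[OF f])
  have sf: "set_integrable lborel {0..2*pi} f"
    using borel_integrable_atLeastAtMost'[of 0 "2*pi" f] continuous_on_subset[OF f] by simp
  have eq: "circ = density lborel (\<lambda>t. ennreal (indicator {0..2*pi} t / (2*pi)))"
    unfolding circ_def uniform_measure_def
    using divide_ennreal[of 1 "2*pi"]
    by (intro density_cong) (auto simp: indicator_def intro!: AE_I2)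
  have "(LINT t|circ. f t) = (LINT t|lborel. (indicator {0..2*pi} t / (2*pi)) *\<^sub>R f t)"
    unfolding eq by (rule integral_density) (use fm in auto)
  also have "\<dots> = (LINT t|lborel. (1 / (2*pi)) *\<^sub>R (indicator {0..2*pi} t *\<^sub>R f t))"
    by (intro Bochner_Integration.integral_cong) auto
  also have "\<dots> = (1 / (2*pi)) *\<^sub>R (LINT t:{0..2*pi}|lborel. f t)"
    unfolding set_lebesgue_integral_def by (rule integral_scaleR_right)
  also have "(LINT t:{0..2*pi}|lborel. f t) = I"
    using set_borel_integral_eq_integral(2)[OF sf] i by (simp add: integral_unique)
  finally show ?thesis by (simp add: scaleR_conv_of_real)
qed

lemma circle_cauchy:
  assumes f: "f holomorphic_on cball 0 r" and w: "norm w < r"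
  shows "(LINT t|circ. f (of_real r * cis t) * (of_real r * cis t) / (of_real r * cis t - w)) = f w"
proof -
  have r: "r > 0" using w norm_ge_zero[of w] by linarith
  have "((\<lambda>u. f u / (u - w)) has_contour_integral (2 * of_real pi * \<i> * f w)) (circlepath 0 r)"
    by (rule Cauchy_integral_circlepath_simple) (use f w in auto)
  then have "((\<lambda>t. f (of_real r * cis t) / (of_real r * cis t - w) * of_real r * \<i> * cis t) has_integral (2 * of_real pi * \<i> * f w)) {0..2*pi}"
    unfolding circlepath_def by (subst (asm) has_contour_integral_part_circlepath_iff) auto
  from has_integral_mult_right[OF this, of "-\<i>"]
  have "((\<lambda>t. f (of_real r * cis t) * (of_real r * cis t) / (of_real r * cis t - w)) has_integral (2 * of_real pi * f w)) {0..2*pi}"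
    by (simp add: field_simps)
  moreover have "continuous_on UNIV (\<lambda>t. f (of_real r * cis t) * (of_real r * cis t) / (of_real r * cis t - w))"
  proof (rule continuous_on_circle)
    have "continuous_on (sphere 0 r) f"
      using holomorphic_on_imp_continuous_on[OF f] by (rule continuous_on_subset) auto
    then show "continuous_on (sphere 0 r) (\<lambda>z. f z * z / (z - w))"
      using w by (intro continuous_intros) auto
  qed (use r in auto)
  ultimately show ?thesis by (subst integral_circ) auto
qed

lemma circle_mean:
  assumes f: "f holomorphic_on cball 0 r" and r: "0 < r"
  shows "(LINT t|circ. f (of_real r * cis t)) = f 0"
proof -
  have "(LINT t|circ. f (of_real r * cis t)) = (LINT t|circ. f (of_real r * cis t) * (of_real r * cis t) / (of_real r * cis t - 0))"
    using r by (intro Bochner_Integration.integral_cong) auto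
  then show ?thesis using circle_cauchy[OF f, of 0] r by simp
qed

lemma circle_mean_disc:
  "f holomorphic_on unit_disc \<Longrightarrow> 0 < r \<Longrightarrow> r < 1 \<Longrightarrow> (LINT t|circ. f (of_real r * cis t)) = f 0"
  by (rule circle_mean) (auto elim!: holomorphic_on_subset)

text \<open>The Poisson kernel of the circle through z about 0. Its radius is |z|, so the same
  function serves all circles and is continuous in the radius.\<close>

definition poisson :: "complex \<Rightarrow> complex \<Rightarrow> real" where
  "poisson w z = Re ((z + w) / (z - w))"

lemma poisson_eq:
  assumes "z \<noteq> w"
  shows "poisson w z = ((norm z)\<^sup>2 - (norm w)\<^sup>2) / (norm (z - w))\<^sup>2"
proof -
  have "poisson w z = Re ((z + w) * cnj (z - w)) / (norm (z - w))\<^sup>2"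
    unfolding poisson_def by (subst complex_div_cnj) (simp del: complex_cnj_diff flip: of_real_power)
  also have "Re ((z + w) * cnj (z - w)) = (norm z)\<^sup>2 - (norm w)\<^sup>2"
    unfolding cmod_power2 by (simp add: algebra_simps power2_eq_square)
  finally show ?thesis .
qed

lemma poisson_nonneg: "norm w < norm z \<Longrightarrow> 0 \<le> poisson w z"
  by (subst poisson_eq) (auto intro!: divide_nonneg_nonneg power_mono)

lemma poisson_le:
  assumes "norm w < s" "s \<le> norm z" "norm z \<le> 1"
  shows "poisson w z \<le> 1 / (s - norm w)\<^sup>2"
proof -
  have "s - norm w \<le> norm (z - w)" using norm_triangle_ineq2[of z w] assms by linarith
  then have "(s - norm w)\<^sup>2 \<le> (norm (z - w))\<^sup>2" using assms by (intro power_mono) auto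
  moreover have "(norm z)\<^sup>2 - (norm w)\<^sup>2 \<le> 1"
    using assms by (intro diff_le_eq[THEN iffD2] add_increasing2) (auto simp: abs_square_le_1)
  ultimately show ?thesis using assms
    by (subst poisson_eq) (auto intro!: frac_le)
qed

lemma continuous_on_poisson: "norm w < r \<Longrightarrow> continuous_on (sphere 0 r) (poisson w)"
  unfolding poisson_def by (intro continuous_intros) auto

text \<open>On |z| = r the kernel is the Cauchy kernel z / (z - w) plus the conjugate of w / (z -
  w). Since cnj z = r^2 / z there, the second term is holomorphic on the closed disc and vanishes at
  0, so it contributes nothing to the mean.\<close>

lemma poisson_formula:
  assumes f: "f holomorphic_on cball 0 r" and w: "norm w < r"
  shows "(LINT t|circ. of_real (poisson w (of_real r * cis t)) * f (of_real r * cis t)) = f w"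
proof -
  let ?z = "\<lambda>t. of_real r * cis t"
  have r: "r > 0" using w norm_ge_zero[of w] by linarith
  have cf: "continuous_on (sphere 0 r) f"
    using holomorphic_on_imp_continuous_on[OF f] by (rule continuous_on_subset) auto
  have nz: "of_real (r\<^sup>2) - cnj w * z \<noteq> 0" if "norm z \<le> r" for z
  proof
    assume "of_real (r\<^sup>2) - cnj w * z = 0"
    then have "norm (cnj w * z) = r\<^sup>2" by (metis eq_iff_diff_eq_0 norm_of_real abs_power2)
    then have "norm w * norm z = r * r" by (simp add: norm_mult power2_eq_square)
    moreover have "norm w * norm z \<le> norm w * r" using that by (intro mult_left_mono) auto
    moreover have "norm w * r < r * r" using w r by (intro mult_strict_right_mono)
    ultimately show False by simp
  qed
  have eq: "of_real (poisson w z) * f z = f z * z / (z - w) + f z * (cnj w * z) / (of_real (r\<^sup>2) - cnj w * z)"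
    if z: "norm z = r" for z
  proof -
    have zw: "z - w \<noteq> 0" using z w by auto
    have "complex_of_real (poisson w z) = ((z + w) / (z - w) + cnj ((z + w) / (z - w))) / 2"
      unfolding poisson_def complex_add_cnj by simp
    also have "\<dots> = z / (z - w) + cnj (w / (z - w))"
    proof -
      define x where "x = w / (z - w)"
      have "(z + w) / (z - w) = 2 * x + 1" "z / (z - w) = x + 1"
        unfolding x_def using zw by (simp_all add: divide_simps)
      then show ?thesis unfolding x_def[symmetric] by (simp add: add_divide_distrib)
    qed
    also have "cnj (w / (z - w)) = (cnj w * z) / (of_real (r\<^sup>2) - cnj w * z)"
    proof -
      have z0: "z \<noteq> 0" using z r by auto
      have "of_real (r\<^sup>2) = z * cnj z" using z by (simp add: complex_norm_square[symmetric])
      then have "of_real (r\<^sup>2) - cnj w * z = (cnj z - cnj w) * z" by (simp add: algebra_simps)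
      then show ?thesis using z0 by simp
    qed
    finally show ?thesis by (simp add: algebra_simps)
  qed
  have "(LINT t|circ. of_real (poisson w (?z t)) * f (?z t)) =
      (LINT t|circ. f (?z t) * ?z t / (?z t - w) + f (?z t) * (cnj w * ?z t) / (of_real (r\<^sup>2) - cnj w * ?z t))"
    using eq r by (intro Bochner_Integration.integral_cong) (auto simp: norm_mult)
  also have "\<dots> = (LINT t|circ. f (?z t) * ?z t / (?z t - w)) + (LINT t|circ. f (?z t) * (cnj w * ?z t) / (of_real (r\<^sup>2) - cnj w * ?z t))"
  proof (rule Bochner_Integration.integral_add)
    show "integrable circ (\<lambda>t. f (?z t) * ?z t / (?z t - w))"
      using r w by (intro integrable_circle[of r "\<lambda>z. f z * z / (z - w)"] continuous_intros cf) auto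
    show "integrable circ (\<lambda>t. f (?z t) * (cnj w * ?z t) / (of_real (r\<^sup>2) - cnj w * ?z t))"
      using r nz by (intro integrable_circle[of r "\<lambda>z. f z * (cnj w * z) / (of_real (r\<^sup>2) - cnj w * z)"] continuous_intros cf) auto
  qed
  also have "(LINT t|circ. f (?z t) * ?z t / (?z t - w)) = f w" by (rule circle_cauchy[OF f w])
  also have "(LINT t|circ. f (?z t) * (cnj w * ?z t) / (of_real (r\<^sup>2) - cnj w * ?z t)) =
       f 0 * (cnj w * 0) / (of_real (r\<^sup>2) - cnj w * 0)"
    by (rule circle_mean[of "\<lambda>z. f z * (cnj w * z) / (of_real (r\<^sup>2) - cnj w * z)"])
       (use nz r in \<open>auto intro!: holomorphic_intros f\<close>)
  finally show ?thesis by simp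
qed

lemma circ_integral_le:
  fixes f g :: "complex \<Rightarrow> real"
  assumes "continuous_on (sphere 0 r) f" "continuous_on (sphere 0 r) g" "0 \<le> r"
    "\<And>z. norm z = r \<Longrightarrow> f z \<le> g z"
  shows "(LINT t|circ. f (of_real r * cis t)) \<le> (LINT t|circ. g (of_real r * cis t))"
  by (intro integral_mono integrable_circle assms) (use assms in \<open>auto simp: norm_mult\<close>)

section \<open>Inner functions in the sense of means\<close>

text \<open>By Fatou's theorem and dominated convergence this is equivalent to unimodular boundary
  values almost everywhere, but it mentions none. The quadratic defect is used because automorphisms
  distort it by a bounded factor.\<close>

definition inner_mean :: "(complex \<Rightarrow> complex) \<Rightarrow> bool" where
  "inner_mean f \<longleftrightarrow> disc_map f \<and>
     ((\<lambda>r. LINT t|circ. 1 - (norm (f (of_real r * cis t)))\<^sup>2) \<longlongrightarrow> 0) (at_left 1)"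

lemma continuous_on_sphere_disc:
  "f holomorphic_on unit_disc \<Longrightarrow> r < 1 \<Longrightarrow> continuous_on (sphere 0 r) f"
  by (rule continuous_on_subset[OF holomorphic_on_imp_continuous_on]) auto

lemma eventually_at_left_1:
  fixes s :: real
  assumes "s < 1"
  shows "eventually (\<lambda>r. s < r \<and> r < 1) (at_left 1)"
  using eventually_at_left_real[OF assms] by eventually_elim auto

lemma norm_circle: "0 \<le> r \<Longrightarrow> norm (of_real r * cis t) = r"
  by (simp add: norm_mult)

lemma schur_defect_nonneg:
  assumes "schur f" "norm z < 1"
  shows "0 \<le> 1 - (norm (f z))\<^sup>2"
  using schurD[OF assms] by (simp add: abs_square_le_1)

lemma integral_defect_nonneg:
  assumes "schur f" "0 \<le> r" "r < 1"
  shows "0 \<le> (LINT t|circ. 1 - (norm (f (of_real r * cis t)))\<^sup>2)"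
  using assms by (intro Bochner_Integration.integral_nonneg schur_defect_nonneg) (auto simp: norm_circle)

lemma inner_meanI:
  assumes f: "disc_map f"
    and ev: "\<And>e. 0 < e \<Longrightarrow> eventually (\<lambda>r. (LINT t|circ. 1 - (norm (f (of_real r * cis t)))\<^sup>2) \<le> e) (at_left 1)"
  shows "inner_mean f"
  unfolding inner_mean_def
proof (intro conjI f tendstoI)
  fix e :: real assume "e > 0"
  then have "eventually (\<lambda>r. (LINT t|circ. 1 - (norm (f (of_real r * cis t)))\<^sup>2) \<le> e/2) (at_left 1)"
    by (intro ev) simp
  with eventually_at_left_1[of 0, OF zero_less_one]
  show "eventually (\<lambda>r. dist (LINT t|circ. 1 - (norm (f (of_real r * cis t)))\<^sup>2) 0 < e) (at_left 1)"
  proof eventually_elim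
    case (elim r)
    then show ?case
      using integral_defect_nonneg[OF disc_map_imp_schur[OF f], of r] \<open>e > 0\<close> by (simp add: dist_norm)
  qed
qed

lemma inner_meanD:
  assumes "inner_mean f" "0 < e"
  shows "eventually (\<lambda>r. (LINT t|circ. 1 - (norm (f (of_real r * cis t)))\<^sup>2) < e) (at_left 1)"
  using assms by (auto simp: inner_mean_def intro: order_tendstoD)

text \<open>Since 1 - x^2 <= 2 (1 - x), lower bounds for the mean of the modulus suffice; these come
  out of the triangle inequality for integrals.\<close>

lemma inner_mean_from_abs:
  assumes f: "disc_map f"
    and ev: "\<And>e. 0 < e \<Longrightarrow> eventually (\<lambda>r. 1 - e \<le> (LINT t|circ. norm (f (of_real r * cis t)))) (at_left 1)"
  shows "inner_mean f"
proof (rule inner_meanI[OF f])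
  have hf: "f holomorphic_on unit_disc" using f by (simp add: disc_map_def)
  fix e :: real assume e: "e > 0"
  then have "eventually (\<lambda>r. 1 - e / 2 \<le> (LINT t|circ. norm (f (of_real r * cis t)))) (at_left 1)"
    by (intro ev) simp
  with eventually_at_left_1[of 0, OF zero_less_one]
  show "eventually (\<lambda>r. (LINT t|circ. 1 - (norm (f (of_real r * cis t)))\<^sup>2) \<le> e) (at_left 1)"
  proof eventually_elim
    fix r :: real assume r: "0 < r \<and> r < 1" and b: "1 - e / 2 \<le> (LINT t|circ. norm (f (of_real r * cis t)))"
    have i: "integrable circ (\<lambda>t. norm (f (of_real r * cis t)))"
      using r by (intro integrable_circle[of r "\<lambda>z. norm (f z)"] continuous_intros continuous_on_sphere_disc[OF hf]) auto
    have "(LINT t|circ. 1 - (norm (f (of_real r * cis t)))\<^sup>2) \<le> (LINT t|circ. 2 - 2 * norm (f (of_real r * cis t)))"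
    proof (rule circ_integral_le[where f="\<lambda>z. 1 - (norm (f z))\<^sup>2" and g="\<lambda>z. 2 - 2 * norm (f z)"])
      fix z :: complex
      have "0 \<le> (1 - norm (f z))\<^sup>2" by simp
      then show "1 - (norm (f z))\<^sup>2 \<le> 2 - 2 * norm (f z)" by (simp add: power2_eq_square algebra_simps)
    qed (use r continuous_on_sphere_disc[OF hf] in \<open>auto intro!: continuous_intros\<close>)
    also have "\<dots> = 2 - 2 * (LINT t|circ. norm (f (of_real r * cis t)))"
      using i circ.prob_space by simp
    finally show "(LINT t|circ. 1 - (norm (f (of_real r * cis t)))\<^sup>2) \<le> e" using b by simp
  qed
qed

lemma inner_mean_id: "inner_mean (\<lambda>z. z)"
proof (rule inner_meanI[OF disc_map_id])
  fix e :: real assume e: "e > 0"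
  have "((\<lambda>r::real. 1 - r\<^sup>2) \<longlongrightarrow> 1 - 1\<^sup>2) (at_left 1)" by (intro tendsto_intros)
  then have "eventually (\<lambda>r::real. 1 - r\<^sup>2 < e) (at_left 1)" using e by (auto dest: order_tendstoD)
  then show "eventually (\<lambda>r. (LINT t|circ. 1 - (norm (of_real r * cis t))\<^sup>2) \<le> e) (at_left 1)"
    by eventually_elim (simp add: norm_mult power_mult_distrib circ.prob_space[simplified])
qed

lemma inner_mean_mob:
  assumes f: "inner_mean f" and c: "norm c < 1"
  shows "inner_mean (\<lambda>z. mob c (f z))"
proof (rule inner_meanI)
  have df: "disc_map f" using f by (simp add: inner_mean_def)
  then have hf: "f holomorphic_on unit_disc" by (simp add: disc_map_def)
  show dm: "disc_map (\<lambda>z. mob c (f z))" by (rule disc_map_compose[OF disc_map_mob[OF c] df])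
  then have hm: "(\<lambda>z. mob c (f z)) holomorphic_on unit_disc" by (simp add: disc_map_def)
  fix e :: real assume e: "e > 0"
  define K where "K = (1 - norm c)\<^sup>2"
  have K: "K > 0" using c by (simp add: K_def)
  have "eventually (\<lambda>r. (LINT t|circ. 1 - (norm (f (of_real r * cis t)))\<^sup>2) < e * K) (at_left 1)"
    using K e by (intro inner_meanD[OF f]) simp
  with eventually_at_left_1[of 0, OF zero_less_one]
  show "eventually (\<lambda>r. (LINT t|circ. 1 - (norm (mob c (f (of_real r * cis t))))\<^sup>2) \<le> e) (at_left 1)"
  proof eventually_elim
    fix r :: real assume r: "0 < r \<and> r < 1" and b: "(LINT t|circ. 1 - (norm (f (of_real r * cis t)))\<^sup>2) < e * K"
    have "(LINT t|circ. 1 - (norm (mob c (f (of_real r * cis t))))\<^sup>2) \<le> (LINT t|circ. (1 - (norm (f (of_real r * cis t)))\<^sup>2) / K)"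
      by (rule circ_integral_le[where f="\<lambda>z. 1 - (norm (mob c (f z)))\<^sup>2" and g="\<lambda>z. (1 - (norm (f z))\<^sup>2) / K"])
         (use r K one_minus_norm_mob_le[OF c] disc_mapD[OF df] continuous_on_sphere_disc[OF hm] continuous_on_sphere_disc[OF hf]
          in \<open>auto simp: K_def less_imp_le intro!: continuous_intros\<close>)
    also have "\<dots> = (LINT t|circ. 1 - (norm (f (of_real r * cis t)))\<^sup>2) / K" by simp
    also have "\<dots> \<le> e" using b K by (simp add: field_simps)
    finally show "(LINT t|circ. 1 - (norm (mob c (f (of_real r * cis t))))\<^sup>2) \<le> e" .
  qed
qed

text \<open>On the unit circle cnj z = 1 / z, so F times a conjugate polynomial has the boundary
  values of a harmonic function. Inside the disc the error is of the order of the defect; after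
  composition with q its mean is therefore small, while the harmonic part has a known mean.\<close>

lemma schur_cnj_poly:
  assumes F: "schur F"
  shows "\<exists>G1 G2 K. G1 holomorphic_on unit_disc \<and> G2 holomorphic_on unit_disc \<and> 1 \<le> K \<and>
    (\<forall>z. norm z < 1 \<longrightarrow> norm (G1 z) \<le> K \<and> norm (G2 z) \<le> K \<and>
        norm (F z * cnj (poly p z) - (G1 z + cnj (G2 z))) \<le> K * (1 - (norm z)\<^sup>2))"
proof (induction p)
  case 0
  show ?case
    by (intro exI[of _ "\<lambda>z. 0"] exI[of _ "1::real"])
       (auto simp: abs_square_le_1 less_imp_le)
next
  case (pCons a p)
  then obtain G1 G2 K where G: "G1 holomorphic_on unit_disc" "G2 holomorphic_on unit_disc" "1 \<le> K"
    "\<And>z. norm z < 1 \<Longrightarrow> norm (G1 z) \<le> K" "\<And>z. norm z < 1 \<Longrightarrow> norm (G2 z) \<le> K"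
    "\<And>z. norm z < 1 \<Longrightarrow> norm (F z * cnj (poly p z) - (G1 z + cnj (G2 z))) \<le> K * (1 - (norm z)\<^sup>2)"
    by blast
  have "schur (\<lambda>z. (G1 z - G1 0) / (2 * of_real K))"
    unfolding schur_def
  proof (intro conjI allI impI)
    show "(\<lambda>z. (G1 z - G1 0) / (2 * of_real K)) holomorphic_on unit_disc"
      using G by (intro holomorphic_intros) auto
    fix z :: complex assume z: "norm z < 1"
    have "norm (G1 z - G1 0) \<le> K + K"
      using norm_triangle_ineq4[of "G1 z" "G1 0"] G(4)[OF z] G(4)[of 0] by simp
    then show "norm ((G1 z - G1 0) / (2 * of_real K)) \<le> 1"
      using G(3) by (simp add: norm_divide norm_mult)
  qed
  then obtain h where h: "schur h" "\<And>z. norm z < 1 \<Longrightarrow> (G1 z - G1 0) / (2 * of_real K) = z * h z"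
    using schur_divide_zero[of "\<lambda>z. (G1 z - G1 0) / (2 * of_real K)"] by auto
  define H where "H = (\<lambda>z. 2 * of_real K * h z)"
  have Hh: "H holomorphic_on unit_disc" using h(1) unfolding H_def schur_def by (intro holomorphic_intros) auto
  have HG: "G1 z = G1 0 + z * H z" if "norm z < 1" for z
    using h(2)[OF that] G(3) unfolding H_def by (simp add: field_simps)
  have Hb: "norm (H z) \<le> 2 * K" if "norm z < 1" for z
    using schurD[OF h(1) that] G(3) by (simp add: H_def norm_mult mult_left_le)
  have hF: "F holomorphic_on unit_disc" using F by (simp add: schur_def)
  \<comment> \<open>The new coefficient contributes \<open>cnj a * F z\<close>. The old harmonic
    part is multiplied by cnj z: harmless on \<open>cnj (G2 z)\<close>, while on G1 the constant
    term becomes antiholomorphic and the rest loses one factor z, leaving H. The constant |a| + 4K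
    covers the three bounds |a| + 2K, 2K and 3K.\<close>
  show ?case
  proof (rule exI[of _ "\<lambda>z. cnj a * F z + H z"], rule exI[of _ "\<lambda>z. z * G2 z + cnj (G1 0) * z"],
      rule exI[of _ "norm a + 4 * K"], intro conjI allI impI)
    show "(\<lambda>z. cnj a * F z + H z) holomorphic_on unit_disc" by (intro holomorphic_intros hF Hh)
    show "(\<lambda>z. z * G2 z + cnj (G1 0) * z) holomorphic_on unit_disc" by (intro holomorphic_intros G)
    show "1 \<le> norm a + 4 * K" using G(3) norm_ge_zero[of a] by linarith
    fix z :: complex assume z: "norm z < 1"
    have "norm (cnj a * F z) \<le> norm a" using schurD[OF F z] by (simp add: norm_mult mult_left_le)
    then show "norm (cnj a * F z + H z) \<le> norm a + 4 * K"
      using norm_triangle_ineq[of "cnj a * F z" "H z"] Hb[OF z] G(3) by linarith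
    have "norm (z * G2 z) \<le> K" "norm (cnj (G1 0) * z) \<le> K"
      using G(4)[of 0] G(5)[OF z] G(3) z
      by (auto simp: norm_mult intro: order_trans[OF mult_left_le_one_le] order_trans[OF mult_left_le])
    then show "norm (z * G2 z + cnj (G1 0) * z) \<le> norm a + 4 * K"
      using norm_triangle_ineq[of "z * G2 z" "cnj (G1 0) * z"] G(3) norm_ge_zero[of a] by linarith
    define E where "E = F z * cnj (poly p z) - (G1 z + cnj (G2 z))"
    have d: "0 \<le> 1 - (norm z)\<^sup>2" using z by (simp add: abs_square_le_1)
    \<comment> \<open>Replacing |z|^2 H by H is the only new error, and it carries the factor 1 -
      |z|^2.\<close>
    have "cnj z * G1 z = cnj (cnj (G1 0) * z) + of_real ((norm z)\<^sup>2) * H z"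
      unfolding HG[OF z] by (simp add: algebra_simps complex_norm_square del: of_real_power)
    then have "F z * cnj (poly (pCons a p) z) - (cnj a * F z + H z + cnj (z * G2 z + cnj (G1 0) * z))
        = cnj z * E - of_real (1 - (norm z)\<^sup>2) * H z"
      unfolding E_def by (simp add: algebra_simps del: of_real_power)
    also have "norm \<dots> \<le> norm (cnj z * E) + norm (of_real (1 - (norm z)\<^sup>2) * H z)"
      by (rule norm_triangle_ineq4)
    also have "norm (cnj z * E) \<le> K * (1 - (norm z)\<^sup>2)"
      using G(6)[OF z] z unfolding E_def[symmetric] by (simp add: norm_mult) (meson mult_left_le_one_le norm_ge_zero order_trans less_imp_le)
    also have "norm (of_real (1 - (norm z)\<^sup>2) * H z) \<le> (1 - (norm z)\<^sup>2) * (2 * K)"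
      unfolding norm_mult using d Hb[OF z] by (intro mult_mono) (auto simp del: of_real_diff of_real_power)
    finally have "norm (F z * cnj (poly (pCons a p) z) - (cnj a * F z + H z + cnj (z * G2 z + cnj (G1 0) * z)))
       \<le> (3 * K) * (1 - (norm z)\<^sup>2)" by (simp add: algebra_simps)
    also have "\<dots> \<le> (norm a + 4 * K) * (1 - (norm z)\<^sup>2)"
      using d G(3) norm_ge_zero[of a] by (intro mult_right_mono) linarith+
    finally show "norm (F z * cnj (poly (pCons a p) z) - (cnj a * F z + H z + cnj (z * G2 z + cnj (G1 0) * z)))
       \<le> (norm a + 4 * K) * (1 - (norm z)\<^sup>2)" .
  qed
qed

text \<open>The dilation extends beyond the closed disc, so its Taylor sections converge uniformly
  there. Convergence at a radius strictly between s and 1 supplies the absolute summability.\<close>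

lemma dilation_poly_approx:
  assumes f: "f holomorphic_on unit_disc" and s: "0 < s" "s < 1" and e: "0 < e"
  shows "\<exists>p. \<forall>z. norm z \<le> 1 \<longrightarrow> norm (f (of_real s * z) - poly p z) \<le> e"
proof -
  define a where "a n = (deriv ^^ n) f 0 / fact n" for n
  have ser: "(\<lambda>n. a n * w ^ n) sums f w" if "norm w < 1" for w
    using holomorphic_power_series[OF f, of w] that by (simp add: a_def)
  obtain x where x: "s < x" "x < 1" using dense s(2) by blast
  have "summable (\<lambda>n. a n * of_real x ^ n)"
    using ser[of "of_real x"] x s by (auto simp: sums_iff)
  then have sum: "summable (\<lambda>n. norm (a n * of_real s ^ n))"
    by (rule powser_insidea) (use x s in auto)
  obtain N where N: "norm (\<Sum>i. norm (a (i + N) * of_real s ^ (i + N))) < e"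
    using suminf_exist_split[OF e sum] by auto
  define p where "p = (\<Sum>n<N. monom (a n * of_real s ^ n) n)"
  have "norm (f (of_real s * z) - poly p z) \<le> e" if z: "norm z \<le> 1" for z
  proof -
    have "norm (of_real s * z) < 1" using z s le_less_trans[OF mult_left_le[of "norm z" s], of 1] by (simp add: norm_mult)
    from ser[OF this] have S: "(\<lambda>n. a n * of_real s ^ n * z ^ n) sums f (of_real s * z)"
      by (simp add: power_mult_distrib mult.assoc)
    have "poly p z = (\<Sum>n<N. a n * of_real s ^ n * z ^ n)"
      by (simp add: p_def poly_sum poly_monom)
    then have T: "(\<lambda>n. a (n + N) * of_real s ^ (n + N) * z ^ (n + N)) sums (f (of_real s * z) - poly p z)"
      using sums_split_initial_segment[OF S, of N] by simp
    have b: "norm (a (n + N) * of_real s ^ (n + N) * z ^ (n + N)) \<le> norm (a (n + N) * of_real s ^ (n + N))" for n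
      using z by (simp add: norm_mult norm_power mult_left_le power_le_one)
    have "norm (\<Sum>n. a (n + N) * of_real s ^ (n + N) * z ^ (n + N)) \<le> (\<Sum>n. norm (a (n + N) * of_real s ^ (n + N)))"
      by (rule norm_suminf_le[OF b]) (use summable_ignore_initial_segment[OF sum, of N] in simp)
    then show ?thesis using N T by (simp add: sums_iff)
  qed
  then show ?thesis by blast
qed

lemma inner_function_disc_map: "inner_function f \<Longrightarrow> disc_map f"
  unfolding inner_function_def disc_map_def by (auto simp: image_subset_iff)

text \<open>The boundary values of \<open>q\<close> carry the mean of the circle to harmonic measure seen from
  \<open>q 0\<close>. Testing against the conjugate of a polynomial close to a dilation of \<open>f\<close> makes this precise
  without boundary values of \<open>q\<close>.\<close>
lemma inner_function_compose:
  assumes phi: "inner_function f" and q: "inner_mean q"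
  shows "inner_mean (\<lambda>z. f (q z))"
proof -
  have df: "disc_map f" by (rule inner_function_disc_map[OF phi])
  then have hf: "f holomorphic_on unit_disc" and sf: "schur f"
    by (auto simp: disc_map_def intro: disc_map_imp_schur)
  have dq: "disc_map q" using q by (simp add: inner_mean_def)
  then have hq: "q holomorphic_on unit_disc" by (simp add: disc_map_def)
  define w where "w = q 0"
  have w: "norm w < 1" unfolding w_def by (rule disc_mapD[OF dq]) simp
  \<comment> \<open>Radii tending to 1 and starting at the midpoint R0 between |w| and 1, so that
    the Poisson kernels at w are bounded by one constant M on all these circles.\<close>
  define R where "R k = 1 - (1 - norm w) / (real k + 2)" for k :: nat
  define R0 where "R0 = (1 + norm w) / 2"
  have R0: "norm w < R0" "R0 < 1" "0 < R0" using w norm_ge_zero[of w] by (auto simp: R0_def simp del: norm_ge_zero)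
  have R1: "R k < 1" for k using w by (simp add: R_def)
  have R2: "R0 \<le> R k" for k
  proof -
    have "(1 - norm w) / (real k + 2) \<le> (1 - norm w) / 2" using w by (intro divide_left_mono) auto
    then show ?thesis unfolding R_def R0_def by (simp add: field_simps)
  qed
  have Rpos: "0 < R k" for k using R0 R2[of k] by linarith
  have Rw: "norm w < R k" for k using R0 R2[of k] by linarith
  have Rlim: "R \<longlonglongrightarrow> 1"
  proof -
    have "(\<lambda>k. 1 - (1 - norm w) * inverse (real (Suc (Suc k)))) \<longlonglongrightarrow> 1 - (1 - norm w) * 0"
      by (intro tendsto_intros LIMSEQ_Suc[OF LIMSEQ_inverse_real_of_nat])
    then show ?thesis by (simp add: R_def[abs_def] field_simps)
  qed
  have Rleft: "filterlim R (at_left 1) sequentially"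
    unfolding filterlim_at using Rlim R1 by (auto simp: less_imp_neq)
  \<comment> \<open>A limit along a sequence is measurable; where it does not exist the value is
    arbitrary, which concerns a null set only.\<close>
  define fs where "fs t = lim (\<lambda>k. f (of_real (R k) * cis t))" for t
  have meas_f [measurable]: "(\<lambda>t. f (of_real (R k) * cis t)) \<in> borel_measurable circ" for k
    by (intro measurable_circle continuous_on_sphere_disc hf R1 less_imp_le Rpos)
  have meas_fs [measurable]: "fs \<in> borel_measurable circ"
    unfolding fs_def by measurable
  have AEfs: "AE t in circ. (\<lambda>k. f (of_real (R k) * cis t)) \<longlonglongrightarrow> fs t \<and> norm (fs t) = 1"
  proof -
    have "AE t in circ. \<exists>w. norm w = 1 \<and> ((\<lambda>r::real. f (of_real r * cis t)) \<longlongrightarrow> w) (at_left 1)"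
      using phi unfolding inner_function_def by (intro AE_circI) auto
    then show ?thesis
    proof (rule AE_mp, intro AE_I2 impI)
      fix t assume "\<exists>w. norm w = 1 \<and> ((\<lambda>r::real. f (of_real r * cis t)) \<longlongrightarrow> w) (at_left 1)"
      then obtain v where v: "norm v = 1" "((\<lambda>r::real. f (of_real r * cis t)) \<longlongrightarrow> v) (at_left 1)" by blast
      have "(\<lambda>k. f (of_real (R k) * cis t)) \<longlonglongrightarrow> v" by (rule filterlim_compose[OF v(2) Rleft])
      moreover from this have "fs t = v" unfolding fs_def by (rule limI)
      ultimately show "(\<lambda>k. f (of_real (R k) * cis t)) \<longlonglongrightarrow> fs t \<and> norm (fs t) = 1" using v(1) by simp
    qed
  qed
  define P where "P t = poisson w (cis t)" for t
  define M where "M = 1 / (R0 - norm w)\<^sup>2"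
  have meas_P [measurable]: "P \<in> borel_measurable circ"
    using measurable_circle[of 1 "poisson w"] continuous_on_poisson[OF w] by (simp add: P_def[abs_def])
  have P0: "0 \<le> P t" for t unfolding P_def by (rule poisson_nonneg) (use w in simp)
  have PM: "P t \<le> M" for t unfolding P_def M_def by (rule poisson_le) (use R0 in auto)
  have PRM: "poisson w (of_real (R k) * cis t) \<le> M" "0 \<le> poisson w (of_real (R k) * cis t)" for k t
    unfolding M_def using R0 R2[of k] R1[of k] Rw[of k] Rpos[of k]
    by (auto intro!: poisson_le poisson_nonneg simp: norm_mult)
  have intP: "integrable circ P"
    by (rule circ.integrable_const_bound[where B=M]) (use P0 PM in auto)
  have P1: "(LINT t|circ. P t) = 1"
  proof -
    have "(LINT t|circ. complex_of_real (P t)) = 1"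
      using poisson_formula[of "\<lambda>z. 1" 1 w] w by (simp add: P_def)
    then have "complex_of_real (LINT t|circ. P t) = 1" by (simp only: integral_complex_of_real)
    then show ?thesis using of_real_eq_1_iff by blast
  qed
  have fR1: "norm (f (of_real (R k) * cis t)) \<le> 1" for k t
    using R1[of k] Rpos[of k] by (intro schurD[OF sf]) (simp add: norm_mult)

  \<comment> \<open>Budget: L lies within 2e of 1, the mean of
    \<open>f (q z) * cnj (poly p (q z))\<close> within e of L, and the bound 1 + e on the polynomial
    accounts for the last e.\<close>
  have main: "eventually (\<lambda>r. 1 - 4 * e \<le> (LINT t|circ. norm (f (q (of_real r * cis t))))) (at_left 1)"
    if e: "0 < e" for e
  proof -
    have "(\<lambda>k. LINT t|circ. P t * norm (fs t - f (of_real (R k) * cis t))) \<longlonglongrightarrow> (LINT t|circ. 0)"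
    proof (rule integral_dominated_convergence[where w="\<lambda>_. M * 2"])
      show "(\<lambda>t. P t * norm (fs t - f (of_real (R k) * cis t))) \<in> borel_measurable circ" for k
        by measurable
      show "AE t in circ. (\<lambda>k. P t * norm (fs t - f (of_real (R k) * cis t))) \<longlonglongrightarrow> 0"
      proof (rule AE_mp[OF AEfs], intro AE_I2 impI)
        fix t assume "(\<lambda>k. f (of_real (R k) * cis t)) \<longlonglongrightarrow> fs t \<and> norm (fs t) = 1"
        then have "(\<lambda>k. P t * norm (fs t - f (of_real (R k) * cis t))) \<longlonglongrightarrow> P t * norm (fs t - fs t)"
          by (intro tendsto_intros) auto
        then show "(\<lambda>k. P t * norm (fs t - f (of_real (R k) * cis t))) \<longlonglongrightarrow> 0" by simp
      qed
      show "AE t in circ. norm (P t * norm (fs t - f (of_real (R k) * cis t))) \<le> M * 2" for k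
      proof (rule AE_mp[OF AEfs], intro AE_I2 impI)
        fix t assume a: "(\<lambda>k. f (of_real (R k) * cis t)) \<longlonglongrightarrow> fs t \<and> norm (fs t) = 1"
        have "norm (fs t - f (of_real (R k) * cis t)) \<le> 2"
          using norm_triangle_ineq4[of "fs t" "f (of_real (R k) * cis t)"] a fR1[of k t] by linarith
        then show "norm (P t * norm (fs t - f (of_real (R k) * cis t))) \<le> M * 2"
          using P0[of t] PM[of t] by (simp add: abs_mult mult_mono)
      qed
    qed simp_all
    then have "eventually (\<lambda>k. (LINT t|circ. P t * norm (fs t - f (of_real (R k) * cis t))) < e) sequentially"
      using e by (auto dest: order_tendstoD(2))
    then obtain k where k: "(LINT t|circ. P t * norm (fs t - f (of_real (R k) * cis t))) < e"
      by (auto simp: eventually_sequentially)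
    \<comment> \<open>The polynomial approximates the dilation uniformly, and the dilation
      approximates the boundary function in the mean weighted by P; together
      \<open>fs t * cnj (poly p (cis t))\<close> is close to 1 in that mean.\<close>
    obtain p where p: "\<And>z. norm z \<le> 1 \<Longrightarrow> norm (f (of_real (R k) * z) - poly p z) \<le> e"
      using dilation_poly_approx[OF hf Rpos[of k] R1[of k] e] by blast
    have pb: "norm (poly p z) \<le> 1 + e" if z: "norm z \<le> 1" for z
    proof -
      have "norm (of_real (R k) * z) < 1"
        using z R1[of k] Rpos[of k] le_less_trans[OF mult_left_le[of "norm z" "R k"], of 1] by (simp add: norm_mult)
      then have "norm (f (of_real (R k) * z)) \<le> 1" by (rule schurD[OF sf])
      then show ?thesis using p[OF z] norm_triangle_sub[of "poly p z" "f (of_real (R k) * z)"]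
        by (simp add: norm_minus_commute)
    qed
    have contp: "continuous_on S (poly p)" for S by (intro continuous_intros)
    obtain G1 G2 K where G: "G1 holomorphic_on unit_disc" "G2 holomorphic_on unit_disc" "1 \<le> K"
      and GE: "\<And>z. norm z < 1 \<Longrightarrow> norm (f z * cnj (poly p z) - (G1 z + cnj (G2 z))) \<le> K * (1 - (norm z)\<^sup>2)"
      using schur_cnj_poly[OF sf, of p] by blast
    define L where "L = G1 w + cnj (G2 w)"
    define I where "I j = (LINT t|circ. of_real (poisson w (of_real (R j) * cis t)) *
         (f (of_real (R j) * cis t) * cnj (poly p (of_real (R j) * cis t))))" for j
    have cont: "continuous_on (sphere 0 r) f" "continuous_on (sphere 0 r) G1" "continuous_on (sphere 0 r) G2" if "r < 1" for r
      using that continuous_on_sphere_disc hf G by auto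
    \<comment> \<open>The Poisson formula reproduces the harmonic part exactly, and the kernel has
      mean 1, so only the pointwise error of \<open>schur_cnj_poly\<close> remains.\<close>
    have I_bound: "norm (I j - L) \<le> K * (1 - (R j)\<^sup>2)" for j
    proof -
      let ?z = "\<lambda>t. of_real (R j) * cis t"
      note cp = continuous_on_poisson[OF Rw[of j]]
      have i1: "integrable circ (\<lambda>t. of_real (poisson w (?z t)) * (f (?z t) * cnj (poly p (?z t))))"
        using Rpos[of j] R1[of j]
        by (intro integrable_circle[of "R j" "\<lambda>z. of_real (poisson w z) * (f z * cnj (poly p z))"] continuous_intros cont cp) auto
      have i2: "integrable circ (\<lambda>t. of_real (poisson w (?z t)) * G1 (?z t))"
        using Rpos[of j] R1[of j]
        by (intro integrable_circle[of "R j" "\<lambda>z. of_real (poisson w z) * G1 z"] continuous_intros cont cp) auto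
      have i3: "integrable circ (\<lambda>t. cnj (of_real (poisson w (?z t)) * G2 (?z t)))"
        using Rpos[of j] R1[of j]
        by (intro integrable_circle[of "R j" "\<lambda>z. cnj (of_real (poisson w z) * G2 z)"] continuous_intros cont cp) auto
      have i4: "integrable circ (\<lambda>t. poisson w (?z t))"
        using Rpos[of j] by (intro integrable_circle[of "R j" "poisson w"] cp) auto
      have h: "G holomorphic_on cball 0 (R j)" if "G holomorphic_on unit_disc" for G
        using that R1[of j] by (auto elim!: holomorphic_on_subset)
      have L: "L = (LINT t|circ. of_real (poisson w (?z t)) * G1 (?z t)) + (LINT t|circ. cnj (of_real (poisson w (?z t)) * G2 (?z t)))"
        unfolding L_def Bochner_Integration.integral_cnj
        using poisson_formula[OF h[OF G(1)] Rw] poisson_formula[OF h[OF G(2)] Rw] by simp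
      have pone: "(LINT t|circ. poisson w (?z t)) = 1"
      proof -
        have "(LINT t|circ. complex_of_real (poisson w (?z t))) = 1"
          using poisson_formula[of "\<lambda>z. 1" "R j" w] Rw by simp
        then have "complex_of_real (LINT t|circ. poisson w (?z t)) = 1" by (simp only: integral_complex_of_real)
        then show ?thesis using of_real_eq_1_iff by blast
      qed
      have eq: "I j - L = (LINT t|circ. of_real (poisson w (?z t)) * (f (?z t) * cnj (poly p (?z t)))
           - (of_real (poisson w (?z t)) * G1 (?z t) + cnj (of_real (poisson w (?z t)) * G2 (?z t))))"
        unfolding L I_def using i1 i2 i3 by (simp del: complex_cnj_mult Bochner_Integration.integral_cnj)
      have "norm (I j - L) \<le> (LINT t|circ. K * (1 - (R j)\<^sup>2) * poisson w (?z t))"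
        unfolding eq
      proof (rule Bochner_Integration.integral_norm_bound_integral)
        show "integrable circ (\<lambda>t. K * (1 - (R j)\<^sup>2) * poisson w (?z t))" using i4 by simp
        fix t
        have nz: "norm (?z t) = R j" using Rpos[of j] by (simp add: norm_mult)
        have "of_real (poisson w (?z t)) * (f (?z t) * cnj (poly p (?z t))) -
            (of_real (poisson w (?z t)) * G1 (?z t) + cnj (of_real (poisson w (?z t)) * G2 (?z t)))
          = of_real (poisson w (?z t)) * (f (?z t) * cnj (poly p (?z t)) - (G1 (?z t) + cnj (G2 (?z t))))"
          by (simp add: algebra_simps)
        moreover have "norm \<dots> \<le> poisson w (?z t) * (K * (1 - (R j)\<^sup>2))"
          unfolding norm_mult using GE[of "?z t"] R1[of j] nz PRM[of j t] by (simp add: mult_left_mono)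
        ultimately show "norm (of_real (poisson w (?z t)) * (f (?z t) * cnj (poly p (?z t))) -
            (of_real (poisson w (?z t)) * G1 (?z t) + cnj (of_real (poisson w (?z t)) * G2 (?z t))))
           \<le> K * (1 - (R j)\<^sup>2) * poisson w (?z t)" by (simp add: mult.commute)
      qed (rule Bochner_Integration.integrable_diff[OF i1 Bochner_Integration.integrable_add[OF i2 i3]])
      also have "\<dots> = K * (1 - (R j)\<^sup>2)" by (simp add: pone)
      finally show ?thesis .
    qed
    have IL: "I \<longlonglongrightarrow> L"
    proof -
      have "(\<lambda>j. K * (1 - (R j)\<^sup>2)) \<longlonglongrightarrow> K * (1 - 1\<^sup>2)" by (intro tendsto_intros Rlim)
      then have "(\<lambda>j. K * (1 - (R j)\<^sup>2)) \<longlonglongrightarrow> 0" by simp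
      then have "(\<lambda>j. I j - L) \<longlonglongrightarrow> 0" by (rule Lim_null_comparison[rotated]) (use I_bound in auto)
      then show ?thesis by (simp add: LIM_zero_iff)
    qed
    have "I \<longlonglongrightarrow> (LINT t|circ. of_real (P t) * (fs t * cnj (poly p (cis t))))"
      unfolding I_def
    proof (rule integral_dominated_convergence[where w="\<lambda>_. M * (1 + e)"])
      show "(\<lambda>t. of_real (P t) * (fs t * cnj (poly p (cis t)))) \<in> borel_measurable circ"
        using measurable_circle[of 1 "\<lambda>z. cnj (poly p z)"] by (auto intro!: borel_measurable_times continuous_intros contp)
      show "(\<lambda>t. of_real (poisson w (of_real (R j) * cis t)) *
         (f (of_real (R j) * cis t) * cnj (poly p (of_real (R j) * cis t)))) \<in> borel_measurable circ" for j
        using Rpos[of j] R1[of j] continuous_on_poisson[OF Rw[of j]]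
        by (intro measurable_circle[of "R j" "\<lambda>z. of_real (poisson w z) * (f z * cnj (poly p z))"] continuous_intros cont) auto
      show "AE t in circ. (\<lambda>j. of_real (poisson w (of_real (R j) * cis t)) *
         (f (of_real (R j) * cis t) * cnj (poly p (of_real (R j) * cis t)))) \<longlonglongrightarrow> of_real (P t) * (fs t * cnj (poly p (cis t)))"
      proof (rule AE_mp[OF AEfs], intro AE_I2 impI)
        fix t assume a: "(\<lambda>k. f (of_real (R k) * cis t)) \<longlonglongrightarrow> fs t \<and> norm (fs t) = 1"
        have R': "(\<lambda>j. of_real (R j) * cis t) \<longlonglongrightarrow> of_real 1 * cis t" by (intro tendsto_intros Rlim)
        have "cis t \<noteq> w" using w by (metis norm_cis less_irrefl)
        then have "(\<lambda>j. poisson w (of_real (R j) * cis t)) \<longlonglongrightarrow> P t"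
          unfolding P_def poisson_def using R' by (auto intro!: tendsto_intros)
        moreover have "(\<lambda>j. poly p (of_real (R j) * cis t)) \<longlonglongrightarrow> poly p (cis t)"
          using R' by (auto intro!: tendsto_intros)
        ultimately show "(\<lambda>j. of_real (poisson w (of_real (R j) * cis t)) *
         (f (of_real (R j) * cis t) * cnj (poly p (of_real (R j) * cis t)))) \<longlonglongrightarrow> of_real (P t) * (fs t * cnj (poly p (cis t)))"
          using a by (intro tendsto_mult tendsto_of_real tendsto_cnj) auto
      qed
      show "AE t in circ. norm (of_real (poisson w (of_real (R j) * cis t)) *
         (f (of_real (R j) * cis t) * cnj (poly p (of_real (R j) * cis t)))) \<le> M * (1 + e)" for j
      proof (intro AE_I2)
        fix t
        have "norm (f (of_real (R j) * cis t)) * norm (poly p (of_real (R j) * cis t)) \<le> 1 * (1 + e)"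
          using fR1[of j t] pb[of "of_real (R j) * cis t"] R1[of j] Rpos[of j]
          by (intro mult_mono) (auto simp: norm_mult)
        then show "norm (of_real (poisson w (of_real (R j) * cis t)) *
         (f (of_real (R j) * cis t) * cnj (poly p (of_real (R j) * cis t)))) \<le> M * (1 + e)"
          unfolding norm_mult using PRM[of j t] by (simp add: mult_mono)
      qed
    qed simp
    \<comment> \<open>Two evaluations of the limit of I: the harmonic value at w, and the boundary
      integral against the Poisson kernel.\<close>
    then have L: "L = (LINT t|circ. of_real (P t) * (fs t * cnj (poly p (cis t))))"
      using IL LIMSEQ_unique by blast
    have meas_p [measurable]: "(\<lambda>t. poly p (cis t)) \<in> borel_measurable circ"
      using measurable_circle[of 1 "poly p"] by (auto intro!: contp)
    have meas_cp [measurable]: "(\<lambda>t. cnj (poly p (cis t))) \<in> borel_measurable circ"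
      using measurable_circle[of 1 "\<lambda>z. cnj (poly p z)"] by (auto intro!: continuous_intros contp)
    have L1: "norm (L - 1) \<le> 2 * e"
    proof -
      have i1: "integrable circ (\<lambda>t. of_real (P t) * (fs t * cnj (poly p (cis t))))"
      proof (rule circ.integrable_const_bound[where B="M * (1 + e)"])
        show "AE t in circ. norm (of_real (P t) * (fs t * cnj (poly p (cis t)))) \<le> M * (1 + e)"
        proof (rule AE_mp[OF AEfs], intro AE_I2 impI)
          fix t assume a: "(\<lambda>k. f (of_real (R k) * cis t)) \<longlonglongrightarrow> fs t \<and> norm (fs t) = 1"
          then show "norm (of_real (P t) * (fs t * cnj (poly p (cis t)))) \<le> M * (1 + e)"
            using P0[of t] PM[of t] pb[of "cis t"] by (simp add: norm_mult mult_mono)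
        qed
        show "(\<lambda>t. of_real (P t) * (fs t * cnj (poly p (cis t)))) \<in> borel_measurable circ"
          using meas_P meas_fs meas_cp by (intro borel_measurable_times) (simp_all add: borel_measurable_of_real)
      qed
      have "L - 1 = (LINT t|circ. of_real (P t) * (fs t * cnj (poly p (cis t)))) - (LINT t|circ. of_real (P t))"
        unfolding L integral_complex_of_real P1 by simp
      then have eq: "L - 1 = (LINT t|circ. of_real (P t) * (fs t * cnj (poly p (cis t))) - of_real (P t))"
        using i1 intP by simp
      have "norm (L - 1) \<le> (LINT t|circ. norm (of_real (P t) * (fs t * cnj (poly p (cis t))) - of_real (P t)))"
        unfolding eq by simp
      also have "\<dots> \<le> (LINT t|circ. P t * norm (fs t - f (of_real (R k) * cis t)) + P t * e)"
      proof (rule integral_mono_AE)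
        show "integrable circ (\<lambda>t. norm (of_real (P t) * (fs t * cnj (poly p (cis t))) - of_real (P t)))"
          using i1 intP by auto
        show "integrable circ (\<lambda>t. P t * norm (fs t - f (of_real (R k) * cis t)) + P t * e)"
        proof (rule circ.integrable_const_bound[where B="M * 2 + M * e"])
          show "AE t in circ. norm (P t * norm (fs t - f (of_real (R k) * cis t)) + P t * e) \<le> M * 2 + M * e"
          proof (rule AE_mp[OF AEfs], intro AE_I2 impI)
            fix t assume a: "(\<lambda>k. f (of_real (R k) * cis t)) \<longlonglongrightarrow> fs t \<and> norm (fs t) = 1"
            have "norm (fs t - f (of_real (R k) * cis t)) \<le> 2"
              using norm_triangle_ineq4[of "fs t" "f (of_real (R k) * cis t)"] a fR1[of k t] by linarith
            then have "P t * norm (fs t - f (of_real (R k) * cis t)) \<le> M * 2" "P t * e \<le> M * e"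
              using P0[of t] PM[of t] e by (auto intro!: mult_mono)
            then show "norm (P t * norm (fs t - f (of_real (R k) * cis t)) + P t * e) \<le> M * 2 + M * e"
              using P0[of t] e by (auto intro!: add_mono mult_right_mono)
          qed
        qed measurable
        show "AE t in circ. norm (of_real (P t) * (fs t * cnj (poly p (cis t))) - of_real (P t))
            \<le> P t * norm (fs t - f (of_real (R k) * cis t)) + P t * e"
        proof (rule AE_mp[OF AEfs], intro AE_I2 impI)
          fix t assume a: "(\<lambda>k. f (of_real (R k) * cis t)) \<longlonglongrightarrow> fs t \<and> norm (fs t) = 1"
          \<comment> \<open>This is where unimodular boundary values are used: 1 is written as fs
            times its conjugate, so the difference becomes an approximation error.\<close>
          have "fs t * cnj (fs t) = 1" using a by (simp add: complex_norm_square[symmetric])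
          then have "of_real (P t) * (fs t * cnj (poly p (cis t))) - of_real (P t) =
             of_real (P t) * (fs t * cnj (poly p (cis t) - fs t))" by (simp add: algebra_simps)
          then have "norm (of_real (P t) * (fs t * cnj (poly p (cis t))) - of_real (P t)) = P t * norm (poly p (cis t) - fs t)"
            using a P0[of t] by (simp add: norm_mult del: complex_cnj_diff)
          also have "norm (poly p (cis t) - fs t) \<le> norm (fs t - f (of_real (R k) * cis t)) + e"
            using norm_triangle_ineq[of "fs t - f (of_real (R k) * cis t)" "f (of_real (R k) * cis t) - poly p (cis t)"]
              p[of "cis t"] by (simp add: norm_minus_commute)
          finally show "norm (of_real (P t) * (fs t * cnj (poly p (cis t))) - of_real (P t))
            \<le> P t * norm (fs t - f (of_real (R k) * cis t)) + P t * e"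
            using P0[of t] by (simp add: distrib_left mult_left_mono)
        qed
      qed
      also have "\<dots> = (LINT t|circ. P t * norm (fs t - f (of_real (R k) * cis t))) + (LINT t|circ. P t * e)"
      proof (rule Bochner_Integration.integral_add)
        show "integrable circ (\<lambda>t. P t * norm (fs t - f (of_real (R k) * cis t)))"
        proof (rule circ.integrable_const_bound[where B="M * 2"])
          show "AE t in circ. norm (P t * norm (fs t - f (of_real (R k) * cis t))) \<le> M * 2"
          proof (rule AE_mp[OF AEfs], intro AE_I2 impI)
            fix t assume a: "(\<lambda>k. f (of_real (R k) * cis t)) \<longlonglongrightarrow> fs t \<and> norm (fs t) = 1"
            have "norm (fs t - f (of_real (R k) * cis t)) \<le> 2"
              using norm_triangle_ineq4[of "fs t" "f (of_real (R k) * cis t)"] a fR1[of k t] by linarith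
            then show "norm (P t * norm (fs t - f (of_real (R k) * cis t))) \<le> M * 2"
              using P0[of t] PM[of t] by (simp add: abs_mult mult_mono)
          qed
        qed measurable
        show "integrable circ (\<lambda>t. P t * e)" using intP by simp
      qed
      also have "\<dots> \<le> e + e" using k P1 by simp
      finally show ?thesis by simp
    qed
    have "eventually (\<lambda>r. (LINT t|circ. 1 - (norm (q (of_real r * cis t)))\<^sup>2) < e / K) (at_left 1)"
      using e G(3) by (intro inner_meanD[OF q]) simp
    with eventually_at_left_1[of 0, OF zero_less_one]
    show ?thesis
    proof eventually_elim
      fix r :: real assume r: "0 < r \<and> r < 1" and b: "(LINT t|circ. 1 - (norm (q (of_real r * cis t)))\<^sup>2) < e / K"
      let ?q = "\<lambda>t. q (of_real r * cis t)"
      have hc: "(\<lambda>z. g (q z)) holomorphic_on unit_disc" if "g holomorphic_on unit_disc" for g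
        using holomorphic_on_compose_gen[OF hq that] disc_mapD[OF dq] by (auto simp: o_def image_subset_iff)
      note c = continuous_on_sphere_disc[OF hc]
      have q1: "norm (?q t) < 1" for t using r by (intro disc_mapD[OF dq]) (simp add: norm_mult)
      have i1: "integrable circ (\<lambda>t. f (?q t) * cnj (poly p (?q t)))"
        using r by (intro integrable_circle[of r "\<lambda>z. f (q z) * cnj (poly p (q z))"] continuous_intros
           c[OF hf] continuous_on_sphere_disc[OF hq]) auto
      have i2: "integrable circ (\<lambda>t. G1 (?q t))"
        using r by (intro integrable_circle[of r "\<lambda>z. G1 (q z)"] c G) auto
      have i3: "integrable circ (\<lambda>t. cnj (G2 (?q t)))"
        using r by (intro integrable_circle[of r "\<lambda>z. cnj (G2 (q z))"] continuous_intros c G) auto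
      have i4: "integrable circ (\<lambda>t. 1 - (norm (?q t))\<^sup>2)"
        using r by (intro integrable_circle[of r "\<lambda>z. 1 - (norm (q z))\<^sup>2"] continuous_intros continuous_on_sphere_disc[OF hq]) auto
      have i5: "integrable circ (\<lambda>t. norm (f (?q t)))"
        using r by (intro integrable_circle[of r "\<lambda>z. norm (f (q z))"] continuous_intros c[OF hf]) auto
      \<comment> \<open>The same L now appears as a mean over the circle of radius r, because G1 and
        G2 composed with q have the mean value property and q 0 = w.\<close>
      have L: "L = (LINT t|circ. G1 (?q t)) + (LINT t|circ. cnj (G2 (?q t)))"
        using circle_mean_disc[OF hc[OF G(1)], of r] circle_mean_disc[OF hc[OF G(2)], of r] r by (simp add: L_def w_def)
      have eq: "(LINT t|circ. f (?q t) * cnj (poly p (?q t))) - L =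
          (LINT t|circ. f (?q t) * cnj (poly p (?q t)) - (G1 (?q t) + cnj (G2 (?q t))))"
        unfolding L using i1 i2 i3 by simp
      have "norm ((LINT t|circ. f (?q t) * cnj (poly p (?q t))) - L) \<le> (LINT t|circ. K * (1 - (norm (?q t))\<^sup>2))"
        unfolding eq by (rule Bochner_Integration.integral_norm_bound_integral) (use i1 i2 i3 i4 GE q1 in auto)
      also have "\<dots> = K * (LINT t|circ. 1 - (norm (?q t))\<^sup>2)" by (rule integral_mult_right_zero)
      also have "\<dots> < e" using b G(3) by (simp only: pos_less_divide_eq mult.commute)
      finally have "norm L - e \<le> norm (LINT t|circ. f (?q t) * cnj (poly p (?q t)))"
        by (smt (verit) norm_triangle_ineq2 norm_minus_commute)
      also have "\<dots> \<le> (LINT t|circ. norm (f (?q t)) * (1 + e))"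
        by (rule Bochner_Integration.integral_norm_bound_integral)
           (use i1 i5 pb q1 in \<open>auto simp: norm_mult less_imp_le intro!: mult_left_mono\<close>)
      also have "\<dots> = (LINT t|circ. norm (f (?q t))) * (1 + e)" by simp
      finally have "norm L - e \<le> (LINT t|circ. norm (f (?q t))) * (1 + e)" .
      moreover have "1 - 2 * e \<le> norm L" using L1 norm_triangle_ineq2[of 1 L] by (simp add: norm_minus_commute)
      moreover have "(1 - 4 * e) * (1 + e) \<le> 1 - 3 * e" using e by (simp add: algebra_simps)
      ultimately have "(1 - 4 * e) * (1 + e) \<le> (LINT t|circ. norm (f (?q t))) * (1 + e)" by linarith
      then show "1 - 4 * e \<le> (LINT t|circ. norm (f (?q t)))" using e by simp
    qed
  qed
  have dfq: "disc_map (\<lambda>z. f (q z))" by (rule disc_map_compose[OF df dq])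
  show ?thesis
  proof (rule inner_mean_from_abs[OF dfq])
    fix e :: real assume "0 < e"
    then show "eventually (\<lambda>r. 1 - e \<le> (LINT t|circ. norm (f (q (of_real r * cis t))))) (at_left 1)"
      using main[of "e / 4"] by simp
  qed
qed

section \<open>A criterion for Blaschke products\<close>

text \<open>Values in \<open>ennreal\<close> allow sums and integrals to be exchanged freely and
  give zeros the value infinity. Above 1 the coercion cuts off at 0, so additivity holds for moduli
  of Schur functions, the case needed.\<close>

definition neglog :: "real \<Rightarrow> ennreal" where
  "neglog x = (if x \<le> 0 then \<infinity> else ennreal (- ln x))"

lemma neglog_measurable [measurable]: "neglog \<in> borel_measurable borel"
  unfolding neglog_def[abs_def] by measurable

lemma neglog_antimono: "x \<le> y \<Longrightarrow> neglog y \<le> neglog x"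
  by (auto simp: neglog_def intro!: ennreal_leI)

lemma neglog_less_top: "neglog x < \<infinity> \<Longrightarrow> 0 < x"
  by (auto simp: neglog_def split: if_splits)

lemma neglog_mult:
  assumes "0 \<le> x" "x \<le> 1" "0 \<le> y" "y \<le> 1"
  shows "neglog (x * y) = neglog x + neglog y"
proof (cases "x = 0 \<or> y = 0")
  case True
  then show ?thesis by (auto simp: neglog_def)
next
  case False
  then have "0 < x" "0 < y" using assms by auto
  then show ?thesis using assms
    by (simp add: neglog_def ln_mult mult_le_0_iff not_le ennreal_plus[symmetric] del: ennreal_plus)
qed

lemma blaschke_factor_eq_mob: "a \<noteq> 0 \<Longrightarrow> blaschke_factor a z = (of_real (norm a) / a) * mob a z"
  by (simp add: blaschke_factor_def mob_def)

lemma norm_blaschke_factor: "a \<noteq> 0 \<Longrightarrow> norm (blaschke_factor a z) = norm (mob a z)"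
  by (simp add: blaschke_factor_eq_mob norm_mult norm_divide)

text \<open>The normalisation |a| / a makes the numerator of the difference divisible by 1 - |a|.
  Bounding the denominator below through z instead of a keeps that factor, so the Blaschke condition
  gives absolute convergence at each z.\<close>

lemma blaschke_factor_minus_1:
  assumes a: "a \<noteq> 0" "norm a < 1" and z: "norm z < 1"
  shows "norm (blaschke_factor a z - 1) \<le> (1 - norm a) * (2 / (1 - norm z))"
proof -
  have d: "1 - cnj a * z \<noteq> 0" using mob_denom a z by auto
  have "norm (1 - cnj a * z) = norm (cnj (1 - cnj a * z))" by (simp only: complex_mod_cnj)
  also have "\<dots> = norm (1 - cnj z * a)" by (simp add: mult.commute)
  finally have d': "1 - norm z \<le> norm (1 - cnj a * z)" using mob_denom'[of z a] a z by simp
  have "blaschke_factor a z - 1 = - ((1 - of_real (norm a)) * (a + of_real (norm a) * z)) / (a * (1 - cnj a * z))"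
  proof -
    have "a * cnj a = (of_real (norm a))\<^sup>2" by (simp add: complex_norm_square[symmetric])
    then have "a * (1 - cnj a * z) = a - (of_real (norm a))\<^sup>2 * z"
      by (simp only: right_diff_distrib mult.assoc[symmetric] mult_1_right)
    then have "of_real (norm a) * (a - z) - a * (1 - cnj a * z) = - ((1 - of_real (norm a)) * (a + of_real (norm a) * z))"
      by (simp only: power2_eq_square) (simp add: algebra_simps)
    moreover have "blaschke_factor a z - 1 = (of_real (norm a) * (a - z) - a * (1 - cnj a * z)) / (a * (1 - cnj a * z))"
      using a d by (simp add: blaschke_factor_def diff_divide_distrib)
    ultimately show ?thesis by simp
  qed
  then have "norm (blaschke_factor a z - 1) = norm (1 - complex_of_real (norm a)) * norm (a + of_real (norm a) * z) / (norm a * norm (1 - cnj a * z))"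
    by (simp add: norm_mult norm_divide)
  also have "norm (1 - complex_of_real (norm a)) = 1 - norm a"
    using a norm_of_real[of "1 - norm a", where ?'a=complex] by simp
  also have "(1 - norm a) * norm (a + of_real (norm a) * z) / (norm a * norm (1 - cnj a * z))
      \<le> (1 - norm a) * (2 * norm a) / (norm a * (1 - norm z))"
  proof (rule frac_le)
    have "norm (of_real (norm a) * z) \<le> norm a" using z by (simp add: norm_mult mult_left_le)
    then have "norm (a + of_real (norm a) * z) \<le> 2 * norm a"
      using norm_triangle_ineq[of a "of_real (norm a) * z"] by linarith
    then show "(1 - norm a) * norm (a + of_real (norm a) * z) \<le> (1 - norm a) * (2 * norm a)"
      using a by (intro mult_left_mono) auto
    show "norm a * (1 - norm z) \<le> norm a * norm (1 - cnj a * z)" using d' by (intro mult_left_mono) auto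
  qed (use a z in auto)
  also have "\<dots> = norm a * ((1 - norm a) * 2) / (norm a * (1 - norm z))" by (simp add: mult_ac)
  also have "\<dots> = (1 - norm a) * (2 / (1 - norm z))" using a by simp
  finally show ?thesis .
qed

text \<open>Within the closed disc through a known zero the zero set is compact; all other zeros
  have larger modulus anyway.\<close>

lemma exists_min_zero:
  assumes f: "continuous_on unit_disc (f :: complex \<Rightarrow> complex)" and z: "norm z < 1" "f z = 0"
  shows "\<exists>a. norm a < 1 \<and> f a = 0 \<and> (\<forall>w. norm w < 1 \<longrightarrow> f w = 0 \<longrightarrow> norm a \<le> norm w)"
proof -
  define Z where "Z = {w \<in> cball 0 (norm z). f w = 0}"
  have "continuous_on (cball 0 (norm z)) f" using f z by (auto elim!: continuous_on_subset)
  then have "closed Z" unfolding Z_def by (intro continuous_closed_preimage_constant) auto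
  moreover have "bounded Z" by (rule bounded_subset[OF bounded_cball[of 0 "norm z"]]) (auto simp: Z_def)
  ultimately have "compact Z" by (simp add: compact_eq_bounded_closed)
  moreover have zZ: "z \<in> Z" using z by (auto simp: Z_def)
  ultimately obtain a where a: "a \<in> Z" "\<And>w. w \<in> Z \<Longrightarrow> norm a \<le> norm w"
    using continuous_attains_inf[of Z norm] by (auto intro: continuous_intros)
  show ?thesis
  proof (intro exI[of _ a] conjI allI impI)
    show "norm a < 1" "f a = 0" using a(1) z by (auto simp: Z_def)
    fix w assume "norm w < 1" "f w = 0"
    then show "norm a \<le> norm w" using a(2)[of w] a(2)[OF zZ] by (cases "norm w \<le> norm z") (auto simp: Z_def)
  qed
qed

text \<open>Zeros are divided out in order of increasing modulus, so that every compact subset of the disc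
  is cleared after finitely many steps and multiplicities need not be tracked.\<close>
lemma greedy_blaschke_division:
  assumes f: "schur f" and f0: "f 0 \<noteq> 0"
  shows "\<exists>S a I. S 0 = f \<and> (\<forall>n::nat. schur (S n) \<and> S n 0 \<noteq> 0) \<and>
    (\<forall>n\<in>I. norm (a n) < 1 \<and> a n \<noteq> 0 \<and>
       (\<forall>w. norm w < 1 \<longrightarrow> S n w = 0 \<longrightarrow> norm (a n) \<le> norm w) \<and>
       (\<forall>z. norm z < 1 \<longrightarrow> S n z = blaschke_factor (a n) z * S (Suc n) z)) \<and>
    (\<forall>n. n \<notin> I \<longrightarrow> (\<forall>z. norm z < 1 \<longrightarrow> S n z \<noteq> 0) \<and> S (Suc n) = S n)"
proof -
  define Q where "Q S S' a \<longleftrightarrow> norm a < 1 \<and> a \<noteq> (0::complex) \<and>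
       (\<forall>w. norm w < 1 \<longrightarrow> S w = 0 \<longrightarrow> norm a \<le> norm w) \<and>
       (\<forall>z. norm z < 1 \<longrightarrow> S z = blaschke_factor a z * S' z)" for S S' :: "complex \<Rightarrow> complex" and a
  \<comment> \<open>The clause for n = 0 pins the starting function, which dependent choice alone
    would leave free. Once no zero is left the sequence stands still.\<close>
  have "\<exists>S. \<forall>n. (schur (S n) \<and> S n 0 \<noteq> 0 \<and> (n = (0::nat) \<longrightarrow> S n = f)) \<and>
      (if \<exists>z. norm z < 1 \<and> S n z = 0 then \<exists>a. Q (S n) (S (Suc n)) a else S (Suc n) = S n)"
  proof (rule dependent_nat_choice)
    show "\<exists>x. schur x \<and> x 0 \<noteq> 0 \<and> (0 = (0::nat) \<longrightarrow> x = f)" using f f0 by auto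
    fix S and n :: nat assume S: "schur S \<and> S 0 \<noteq> 0 \<and> (n = 0 \<longrightarrow> S = f)"
    show "\<exists>S'. (schur S' \<and> S' 0 \<noteq> 0 \<and> (Suc n = 0 \<longrightarrow> S' = f)) \<and>
       (if \<exists>z. norm z < 1 \<and> S z = 0 then \<exists>a. Q S S' a else S' = S)"
    proof (cases "\<exists>z. norm z < 1 \<and> S z = 0")
      case False
      then show ?thesis using S by auto
    next
      case True
      then obtain z where "norm z < 1" "S z = 0" by blast
      moreover have "continuous_on unit_disc S"
        using S by (auto simp: schur_def intro: holomorphic_on_imp_continuous_on)
      ultimately obtain a where a: "norm a < 1" "S a = 0" "\<forall>w. norm w < 1 \<longrightarrow> S w = 0 \<longrightarrow> norm a \<le> norm w"
        using exists_min_zero by blast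
      have a0: "a \<noteq> 0" using a(2) S by auto
      obtain h where h: "schur h" "\<And>z. norm z < 1 \<Longrightarrow> S z = mob a z * h z"
        using schur_divide_mob[of S a] S a by auto
      define S' where "S' = (\<lambda>z. (a / of_real (norm a)) * h z)"
      have SS': "S z = blaschke_factor a z * S' z" if "norm z < 1" for z
        using h(2)[OF that] a0 by (simp add: S'_def blaschke_factor_eq_mob)
      have "schur S'" using h(1) a0 unfolding schur_def S'_def
        by (auto intro!: holomorphic_intros simp: norm_mult norm_divide)
      moreover have "S' 0 \<noteq> 0" using SS'[of 0] S by auto
      moreover have "Q S S' a" unfolding Q_def using a a0 SS' by blast
      ultimately show ?thesis using True by auto
    qed
  qed
  then obtain S where S: "\<forall>n. (schur (S n) \<and> S n 0 \<noteq> 0 \<and> (n = (0::nat) \<longrightarrow> S n = f)) \<and>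
      (if \<exists>z. norm z < 1 \<and> S n z = 0 then \<exists>a. Q (S n) (S (Suc n)) a else S (Suc n) = S n)" by (elim exE)
  define I where "I = {n. \<exists>z. norm z < 1 \<and> S n z = 0}"
  define a where "a n = (SOME a. Q (S n) (S (Suc n)) a)" for n
  have a: "Q (S n) (S (Suc n)) (a n)" if "n \<in> I" for n
  proof -
    have "\<exists>a. Q (S n) (S (Suc n)) a" using spec[OF S, of n] that by (simp add: I_def)
    then show ?thesis unfolding a_def by (rule someI_ex)
  qed
  have nI: "(\<forall>z. norm z < 1 \<longrightarrow> S n z \<noteq> 0) \<and> S (Suc n) = S n" if "n \<notin> I" for n
  proof -
    have no: "\<not> (\<exists>z. norm z < 1 \<and> S n z = 0)" using that by (simp add: I_def)
    then have "S (Suc n) = S n" using spec[OF S, of n] by (simp only: if_False simp_thms)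
    with no show ?thesis by blast
  qed
  have 1: "\<forall>n. schur (S n) \<and> S n 0 \<noteq> 0" using S by blast
  have 2: "S 0 = f" using spec[OF S, of 0] by blast
  have 3: "\<forall>n. n \<notin> I \<longrightarrow> (\<forall>z. norm z < 1 \<longrightarrow> S n z \<noteq> 0) \<and> S (Suc n) = S n" using nI by blast
  show ?thesis
    by (rule exI[of _ S], rule exI[of _ a], rule exI[of _ I])
       (use 1 2 3 a in \<open>unfold Q_def, intro conjI ballI; blast\<close>)
qed

text \<open>Without zeros S = exp g, so -ln |S| is minus the real part of a holomorphic function and
  has the mean value property: Jensen's formula without its zero terms.\<close>

lemma zero_free_jensen:
  assumes S: "S holomorphic_on ball 0 R" and nz: "\<And>z. norm z < R \<Longrightarrow> S z \<noteq> 0"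
    and r: "0 < r" "r < R" and R: "\<And>z. norm z < R \<Longrightarrow> norm (S z) \<le> 1"
  shows "ennreal (- ln (norm (S 0))) = (\<integral>\<^sup>+t. neglog (norm (S (of_real r * cis t))) \<partial>circ)"
proof -
  obtain g where g: "g holomorphic_on ball 0 R" "\<And>z. z \<in> ball 0 R \<Longrightarrow> S z = exp (g z)"
    using contractible_imp_holomorphic_log[OF S convex_imp_contractible[OF convex_ball]] nz by auto
  have gr: "g holomorphic_on cball 0 r" using g(1) r by (auto elim!: holomorphic_on_subset)
  have ln: "ln (norm (S z)) = Re (g z)" if "norm z < R" for z using g(2)[of z] that by simp
  have neg: "0 \<le> - Re (g z)" if "norm z < R" for z
    using ln[OF that] R[OF that] nz[OF that] by (metis ln_le_zero_iff neg_0_le_iff_le zero_less_norm_iff)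
  have i: "integrable circ (\<lambda>t. g (of_real r * cis t))"
    using gr r by (intro integrable_circle) (auto intro: continuous_on_subset[OF holomorphic_on_imp_continuous_on])
  have nr: "norm (of_real r * cis t) < R" for t using r by (simp add: norm_mult)
  have "(\<integral>\<^sup>+t. neglog (norm (S (of_real r * cis t))) \<partial>circ) = (\<integral>\<^sup>+t. ennreal (- Re (g (of_real r * cis t))) \<partial>circ)"
    using nz[OF nr] ln[OF nr] by (intro nn_integral_cong) (auto simp: neglog_def not_le)
  also have "\<dots> = ennreal (LINT t|circ. - Re (g (of_real r * cis t)))"
    by (rule nn_integral_eq_integral) (use i neg[OF nr] in auto)
  also have "(LINT t|circ. - Re (g (of_real r * cis t))) = - Re (g 0)"
    using i circle_mean[OF gr r(1)] by simp
  also have "- Re (g 0) = - ln (norm (S 0))" using ln[of 0] r by simp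
  finally show ?thesis by simp
qed

text \<open>Write f as a partial product times S n. Since |f| <= |S n|, the logarithmic mean of S n
  is no larger than that of f, and once S n is free of zeros near the chosen circle Jensen's formula
  makes -ln |S n 0| small. The remainders thus converge along a subsequence to a unimodular
  constant: f has no singular factor.\<close>

lemma blaschke_criterion:
  assumes f: "schur f" and f0: "f 0 \<noteq> 0"
    and small: "\<And>e. 0 < e \<Longrightarrow> \<exists>r. 0 < r \<and> r < 1 \<and> (\<integral>\<^sup>+t. neglog (norm (f (of_real r * cis t))) \<partial>circ) < ennreal e"
  shows "blaschke_product f"
proof -
  obtain S a I where S0: "S 0 = f" and SS: "\<forall>n::nat. schur (S n) \<and> S n 0 \<noteq> 0"
    and aa: "\<forall>n\<in>I. norm (a n) < 1 \<and> a n \<noteq> 0 \<and>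
       (\<forall>w. norm w < 1 \<longrightarrow> S n w = 0 \<longrightarrow> norm (a n) \<le> norm w) \<and>
       (\<forall>z. norm z < 1 \<longrightarrow> S n z = blaschke_factor (a n) z * S (Suc n) z)"
    and nn: "\<forall>n. n \<notin> I \<longrightarrow> (\<forall>z. norm z < 1 \<longrightarrow> S n z \<noteq> 0) \<and> S (Suc n) = S n"
    using greedy_blaschke_division[OF f f0] by (elim exE conjE)
  have S: "schur (S n)" "S n 0 \<noteq> 0" for n using SS by auto
  have a: "norm (a n) < 1" "a n \<noteq> 0" if "n \<in> I" for n using aa that by auto
  have amin: "norm (a n) \<le> norm w" if "n \<in> I" "norm w < 1" "S n w = 0" for n w
    using bspec[OF aa that(1)] that(2,3) by simp
  have step: "S n z = blaschke_factor (a n) z * S (Suc n) z" if "n \<in> I" "norm z < 1" for n z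
    using bspec[OF aa that(1)] that(2) by simp
  have nI: "norm z < 1 \<Longrightarrow> S n z \<noteq> 0" "S (Suc n) = S n" if "n \<notin> I" for n z using nn that by auto
  define b where "b z i = (if i \<in> I then blaschke_factor (a i) z else 1)" for z i
  have fac: "f z = (\<Prod>i<n. b z i) * S n z" if z: "norm z < 1" for n z
  proof (induction n)
    case 0 show ?case by (simp add: S0)
  next
    case (Suc n)
    have "S n z = b z n * S (Suc n) z" using step[OF _ z, of n] nI(2)[of n] by (auto simp: b_def)
    then show ?case using Suc by (simp add: mult.assoc)
  qed
  have bn: "norm (b z i) \<le> 1" if z: "norm z < 1" for z i
    using norm_mob_less[OF a(1) z] a by (auto simp: b_def norm_blaschke_factor less_imp_le)
  have prodn: "norm (\<Prod>i<n. b z i) \<le> 1" if z: "norm z < 1" for z n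
    unfolding prod_norm[symmetric] by (rule prod_le_1) (use bn[OF z] in auto)
  define x where "x i = (if i \<in> I then 1 - norm (a i) else 0)" for i
  have x0: "0 \<le> x i" for i using a by (auto simp: x_def less_imp_le)
  have bx: "norm (b 0 i) = 1 - x i" for i using a by (auto simp: x_def b_def norm_blaschke_factor)
  \<comment> \<open>The Blaschke condition: |f 0| is at most the product of the numbers 1 - x i,
    hence at most exp of minus their partial sum.\<close>
  have sumx: "summable x"
  proof (rule summableI_nonneg_bounded[where x="- ln (norm (f 0))"])
    fix n
    have "norm (f 0) = (\<Prod>i<n. norm (b 0 i)) * norm (S n 0)"
      using fac[of 0 n] by (simp add: norm_mult prod_norm)
    also have "\<dots> \<le> (\<Prod>i<n. norm (b 0 i))" using schurD[OF S(1), of 0 n] by (simp add: mult_left_le prod_nonneg)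
    also have "\<dots> \<le> (\<Prod>i<n. exp (- x i))"
    proof (rule prod_mono, rule conjI)
      show "norm (b 0 i) \<le> exp (- x i)" for i using bx[of i] exp_ge_add_one_self[of "- x i"] by simp
    qed simp
    also have "\<dots> = exp (- sum x {..<n})" by (simp add: exp_sum[symmetric] sum_negf)
    finally have "ln (norm (f 0)) \<le> ln (exp (- sum x {..<n}))" using f0 by (subst ln_le_cancel_iff) auto
    then show "sum x {..<n} \<le> - ln (norm (f 0))" by simp
  qed (rule x0)
  have hp: "b z has_prod prodinf (b z)" if z: "norm z < 1" for z
  proof -
    have "summable (\<lambda>i. norm (b z i - 1))"
    proof (rule summable_comparison_test')
      show "summable (\<lambda>i. x i * (2 / (1 - norm z)))" by (rule summable_mult2[OF sumx])
      show "norm (norm (b z i - 1)) \<le> x i * (2 / (1 - norm z))" for i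
        using blaschke_factor_minus_1[OF a(2,1) z] by (auto simp: b_def x_def)
    qed
    then show ?thesis
      by (intro convergent_prod_has_prod abs_convergent_prod_imp_convergent_prod summable_imp_abs_convergent_prod)
  qed
  \<comment> \<open>A zero of S n below radius R forces the minimal zero a n below R, hence x n > 1
    - R, which summability allows only finitely often.\<close>
  have zf: "\<exists>N. \<forall>n\<ge>N. \<forall>z. norm z < R \<longrightarrow> S n z \<noteq> 0" if R: "R < 1" for R
  proof -
    have "eventually (\<lambda>n. x n < 1 - R) sequentially"
      using R order_tendstoD(2)[OF summable_LIMSEQ_zero[OF sumx], of "1 - R"] by simp
    then obtain N where N: "\<And>n. n \<ge> N \<Longrightarrow> x n < 1 - R" by (auto simp: eventually_sequentially)
    have "S n z \<noteq> 0" if "n \<ge> N" "norm z < R" for n z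
    proof (cases "n \<in> I")
      case True
      then have "R < norm (a n)" using N[OF that(1)] by (simp add: x_def)
      then show ?thesis using amin[OF True, of z] that R by force
    next
      case False
      then show ?thesis using nI(1) that R by auto
    qed
    then show ?thesis by blast
  qed
  have lim1: "(\<lambda>n. norm (S n 0)) \<longlonglongrightarrow> 1"
  proof (rule LIMSEQ_I)
    fix d :: real assume d: "d > 0"
    \<comment> \<open>Chosen so that -ln |S n 0| < e yields |S n 0| > 1 - d; the minimum keeps the
      logarithm's argument positive.\<close>
    define e where "e = - ln (1 - min d (1/2))"
    have e: "e > 0" using d by (simp add: e_def)
    obtain r where r: "0 < r" "r < 1" "(\<integral>\<^sup>+t. neglog (norm (f (of_real r * cis t))) \<partial>circ) < ennreal e"
      using small[OF e] by blast
    obtain R where R: "r < R" "R < 1" using dense r by blast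
    obtain N where N: "\<And>n z. n \<ge> N \<Longrightarrow> norm z < R \<Longrightarrow> S n z \<noteq> 0" using zf[OF R(2)] by blast
    have "norm (norm (S n 0) - 1) < d" if n: "n \<ge> N" for n
    proof -
      have "ennreal (- ln (norm (S n 0))) = (\<integral>\<^sup>+t. neglog (norm (S n (of_real r * cis t))) \<partial>circ)"
        using S(1)[of n] R r N[OF n]
        by (intro zero_free_jensen[of _ R]) (auto simp: schur_def elim!: holomorphic_on_subset)
      also have "\<dots> \<le> (\<integral>\<^sup>+t. neglog (norm (f (of_real r * cis t))) \<partial>circ)"
      proof (intro nn_integral_mono neglog_antimono)
        fix t
        have z: "norm (of_real r * cis t) < 1" using r by (simp add: norm_mult)
        show "norm (f (of_real r * cis t)) \<le> norm (S n (of_real r * cis t))"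
          unfolding fac[OF z, of n] norm_mult[of "prod _ _"] using prodn[OF z, of n] by (intro mult_left_le_one_le) auto
      qed
      also note r(3)
      finally have "- ln (norm (S n 0)) < e" using ennreal_leI[of e "- ln (norm (S n 0))"] by (meson not_le)
      then have "ln (1 - min d (1/2)) < ln (norm (S n 0))" by (simp add: e_def)
      then have "1 - min d (1/2) < norm (S n 0)" using S(2)[of n] by (subst (asm) ln_less_cancel_iff) auto
      moreover have "norm (S n 0) \<le> 1" using schurD[OF S(1), of 0 n] by simp
      ultimately show ?thesis by auto
    qed
    then show "\<exists>N. \<forall>n\<ge>N. norm (norm (S n 0) - 1) < d" by blast
  qed
  obtain c r where c: "norm c = 1" and r: "strict_mono r" and lim: "\<And>z. norm z < 1 \<Longrightarrow> (\<lambda>n. S (r n) z) \<longlonglongrightarrow> c"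
    using schur_Montel_unimodular[OF S(1) lim1] by blast
  have eq: "f z = c * prodinf (b z)" if z: "norm z < 1" for z
  proof -
    have "(\<lambda>n. \<Prod>i<r n. b z i) \<longlonglongrightarrow> prodinf (b z)"
      using LIMSEQ_subseq_LIMSEQ[OF has_prod_imp_tendsto'[OF hp[OF z]] r] by (simp add: o_def)
    then have "(\<lambda>n. (\<Prod>i<r n. b z i) * S (r n) z) \<longlonglongrightarrow> prodinf (b z) * c"
      by (intro tendsto_mult lim z)
    then have "(\<lambda>n. f z) \<longlonglongrightarrow> prodinf (b z) * c" using fac[OF z] by simp
    then show ?thesis by (simp add: LIMSEQ_const_iff mult.commute)
  qed
  show ?thesis unfolding blaschke_product_def
  proof (rule exI[of _ c], rule exI[of _ a], rule exI[of _ I], intro conjI ballI c)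
    show "a i \<in> unit_disc" if "i \<in> I" for i using a(1)[OF that] by simp
    show "summable (\<lambda>i. if i \<in> I then 1 - norm (a i) else 0)" using sumx by (simp add: x_def[abs_def])
    fix z assume "z \<in> unit_disc"
    then have z: "norm z < 1" by simp
    have "c \<noteq> 0" using c by auto
    then have "f z / c = prodinf (b z)" using eq[OF z] by simp
    then show "(\<lambda>i. if i \<in> I then blaschke_factor (a i) z else 1) has_prod (f z / c)"
      using hp[OF z] by (simp add: b_def[abs_def])
  qed
qed

section \<open>Frostman averaging\<close>

text \<open>A real segment suffices for averaging, since the logarithmic singularity is integrable
  on a line; keeping it within radius 1/2 gives uniform control of \<open>mob a\<close>.\<close>

definition seg :: "real measure" where
  "seg = uniform_measure lborel {-1/2..1/2}"

lemma sets_seg [measurable_cong]: "sets seg = sets borel"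
  by (simp add: seg_def)

interpretation seg: prob_space seg
  unfolding seg_def by (rule prob_space_uniform_measure) auto

lemma nn_integral_seg:
  assumes "f \<in> borel_measurable borel"
  shows "(\<integral>\<^sup>+a. f a \<partial>seg) = (\<integral>\<^sup>+a. f a * indicator {-1/2..1/2} a \<partial>lborel)"
  unfolding seg_def using assms by (subst nn_integral_uniform_measure) (simp_all add: divide_ennreal_def)

text \<open>From -ln x = 2 ln (1 / sqrt x). The bound combines a factor vanishing at x = 1, to be
  compared with the defect, and a singularity at 0 weak enough to be integrated.\<close>

lemma neg_ln_le_inverse_sqrt:
  fixes x :: real
  assumes "0 < x" "x \<le> 1"
  shows "- ln x \<le> 2 * (1 - x) / sqrt x"
proof -
  have s: "0 < sqrt x" "sqrt x \<le> 1" using assms by auto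
  have "ln (1 / sqrt x) \<le> 1 / sqrt x - 1" using s by (intro ln_le_minus_one) simp
  then have "- ln x \<le> 2 * (1 / sqrt x - 1)"
    using assms by (simp add: ln_div ln_sqrt)
  also have "\<dots> = 2 * (1 - sqrt x) / sqrt x" using s by (simp add: field_simps)
  also have "\<dots> \<le> 2 * (1 - x) / sqrt x"
  proof -
    have "x \<le> sqrt x" using assms by (intro real_le_rsqrt) (simp add: power2_eq_square mult_left_le)
    then show ?thesis using s by (intro divide_right_mono) auto
  qed
  finally show ?thesis .
qed

text \<open>With |a| <= 1/2 the modulus of the Moebius value is at least |a - Re w| / 2 and its
  distance to 1 is at most 4 (1 - |w|^2). The constant is 16 = 2 * 4 * 2, the last 2 coming from
  sqrt s / 2 as a lower bound for the root.\<close>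

lemma neglog_mob_real_le:
  assumes a: "\<bar>a\<bar> \<le> 1/2" and w: "norm w < 1" and ne: "a \<noteq> Re w"
  shows "neglog (norm (mob (of_real a) w)) \<le> ennreal (16 * (1 - (norm w)\<^sup>2) * \<bar>a - Re w\<bar> powr (-1/2))"
proof -
  define \<rho> where "\<rho> = norm (mob (of_real a) w)"
  define s where "s = \<bar>a - Re w\<bar>"
  have s: "s > 0" using ne by (simp add: s_def)
  have na: "norm (complex_of_real a) < 1" "norm (complex_of_real a) \<le> 1/2" using a by auto
  have w2: "0 \<le> 1 - (norm w)\<^sup>2" using w by (simp add: abs_square_le_1)
  have "\<rho> < 1" unfolding \<rho>_def by (rule norm_mob_less[OF na(1) w])
  have "norm (1 - cnj (complex_of_real a) * w) \<le> norm (1::complex) + norm (cnj (complex_of_real a) * w)" by (rule norm_triangle_ineq4)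
  also have "norm (cnj (complex_of_real a) * w) \<le> 1" using na w by (simp add: norm_mult mult_le_one)
  finally have d: "norm (1 - cnj (complex_of_real a) * w) \<le> 2" by simp
  have "s \<le> norm (complex_of_real a - w)" using abs_Re_le_cmod[of "complex_of_real a - w"] by (simp add: s_def)
  then have "s / 2 \<le> norm (complex_of_real a - w) / norm (1 - cnj (complex_of_real a) * w)"
    using d mob_denom[OF na(1), of w] w by (intro frac_le) auto
  then have \<rho>s: "s / 2 \<le> \<rho>" by (simp add: \<rho>_def mob_def norm_divide)
  then have \<rho>0: "0 < \<rho>" using s by simp
  have "1 - \<rho>\<^sup>2 \<le> (1 - (norm w)\<^sup>2) / (1 - norm (complex_of_real a))\<^sup>2"
    unfolding \<rho>_def by (rule one_minus_norm_mob_le[OF na(1)]) (use w in simp)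
  also have "\<dots> \<le> (1 - (norm w)\<^sup>2) / (1/2)\<^sup>2"
    using na w2 by (intro divide_left_mono power_mono) auto
  finally have d1: "1 - \<rho>\<^sup>2 \<le> 4 * (1 - (norm w)\<^sup>2)" by (simp add: power2_eq_square)
  have "1 - \<rho> \<le> 1 - \<rho>\<^sup>2" using \<rho>0 \<open>\<rho> < 1\<close> by (simp add: power2_eq_square mult_left_le)
  then have "1 - \<rho> \<le> 4 * (1 - (norm w)\<^sup>2)" using d1 by (rule order_trans)
  then have "2 * (1 - \<rho>) \<le> 2 * (4 * (1 - (norm w)\<^sup>2))" by (rule mult_left_mono) simp
  moreover have "sqrt s / 2 \<le> sqrt \<rho>"
  proof -
    have "sqrt s / 2 = sqrt (s / 4)" by (simp add: real_sqrt_divide)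
    also have "\<dots> \<le> sqrt \<rho>" using \<rho>s s by simp
    finally show ?thesis .
  qed
  ultimately have "2 * (1 - \<rho>) / sqrt \<rho> \<le> (2 * (4 * (1 - (norm w)\<^sup>2))) / (sqrt s / 2)"
    using s w2 by (intro frac_le) auto
  also have "\<dots> = 16 * (1 - (norm w)\<^sup>2) * s powr (-1/2)"
  proof -
    have "s powr (-1/2) = inverse (s powr (1/2))" using powr_minus[of s "1/2"] by simp
    also have "\<dots> = inverse (sqrt s)" using s by (simp add: powr_half_sqrt)
    finally show ?thesis by (simp only: divide_inverse inverse_mult_distrib inverse_inverse_eq)
  qed
  finally have "- ln \<rho> \<le> 16 * (1 - (norm w)\<^sup>2) * s powr (-1/2)"
    using neg_ln_le_inverse_sqrt[of \<rho>] \<rho>0 \<open>\<rho> < 1\<close> by linarith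
  then show ?thesis using \<rho>0 unfolding \<rho>_def[symmetric] s_def[symmetric]
    by (simp add: neglog_def ennreal_leI)
qed

text \<open>The interval contains every translate of the segment by -Re w with |Re w| < 1, so one
  finite constant serves all w.\<close>

lemma nn_integral_inverse_sqrt:
  "(\<integral>\<^sup>+s. ennreal (\<bar>s\<bar> powr (-1/2)) * indicator {-2..2} s \<partial>lborel) < \<infinity>"
proof -
  define f :: "real \<Rightarrow> real" where "f = (\<lambda>s. if s \<in> {0..2} then s powr (-1/2) else 0)"
  have fm [measurable]: "f \<in> borel_measurable borel" unfolding f_def by measurable
  have "((\<lambda>s. s powr (-1/2)) has_integral (2 powr (-1/2+1) / (-1/2+1))) {0..2::real}"
    by (rule has_integral_powr_from_0) auto
  then have "(f has_integral (2 powr (-1/2+1) / (-1/2+1))) UNIV"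
    unfolding f_def by (subst has_integral_restrict_UNIV)
  then have fin: "(\<integral>\<^sup>+s. ennreal (f s) \<partial>lborel) < \<infinity>"
    by (subst nn_integral_has_integral_lborel) (auto simp: f_def)
  have neg: "(\<integral>\<^sup>+s. ennreal (f s) \<partial>lborel) = (\<integral>\<^sup>+s. ennreal (f (- s)) \<partial>lborel)"
    using nn_integral_real_affine[of "\<lambda>s. ennreal (f s)" "-1" 0] by simp
  have "(\<integral>\<^sup>+s. ennreal (\<bar>s\<bar> powr (-1/2)) * indicator {-2..2} s \<partial>lborel) \<le> (\<integral>\<^sup>+s. ennreal (f s) + ennreal (f (- s)) \<partial>lborel)"
    by (intro nn_integral_mono) (auto simp: f_def indicator_def abs_if)
  also have "\<dots> = (\<integral>\<^sup>+s. ennreal (f s) \<partial>lborel) + (\<integral>\<^sup>+s. ennreal (f (- s)) \<partial>lborel)"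
    by (rule nn_integral_add) measurable
  also have "\<dots> < \<infinity>" using fin neg by simp
  finally show ?thesis .
qed

lemma neglog_mob_measurable [measurable]:
  assumes [measurable]: "f \<in> borel_measurable M" "g \<in> borel_measurable M"
  shows "(\<lambda>x. neglog (norm (mob (complex_of_real (f x)) (g x)))) \<in> borel_measurable M"
  unfolding mob_def complex_cnj_complex_of_real by measurable

text \<open>The integrand is the Green function of the disc with pole a. Averaging removes the pole
  and leaves a potential that vanishes at the circle like the defect.\<close>

lemma segment_potential:
  "\<exists>C. \<forall>w. norm w < 1 \<longrightarrow>
     (\<integral>\<^sup>+a. neglog (norm (mob (of_real a) w)) \<partial>seg) \<le> ennreal (C * (1 - (norm w)\<^sup>2))"
proof -
  obtain c where c: "c \<ge> 0" "(\<integral>\<^sup>+s. ennreal (\<bar>s\<bar> powr (-1/2)) * indicator {-2..2} s \<partial>lborel) = ennreal c"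
    using nn_integral_inverse_sqrt by (auto simp: less_top_ennreal)
  show ?thesis
  proof (intro exI[of _ "16 * c"] allI impI)
    fix w :: complex assume w: "norm w < 1"
    have w2: "0 \<le> 1 - (norm w)\<^sup>2" using w by (simp add: abs_square_le_1)
    have rw: "\<bar>Re w\<bar> < 1" using w abs_Re_le_cmod[of w] by linarith
    let ?h = "\<lambda>a. ennreal (\<bar>a - Re w\<bar> powr (-1/2)) * indicator {-1/2..1/2} a"
    have "(\<integral>\<^sup>+a. neglog (norm (mob (of_real a) w)) \<partial>seg) = (\<integral>\<^sup>+a. neglog (norm (mob (of_real a) w)) * indicator {-1/2..1/2} a \<partial>lborel)"
      by (rule nn_integral_seg) measurable
    also have "\<dots> \<le> (\<integral>\<^sup>+a. ennreal (16 * (1 - (norm w)\<^sup>2)) * ?h a \<partial>lborel)"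
    proof (rule nn_integral_mono_AE, rule AE_mp[OF AE_lborel_singleton[of "Re w"]], intro AE_I2 impI)
      fix a :: real assume ne: "a \<noteq> Re w"
      show "neglog (norm (mob (of_real a) w)) * indicator {-1/2..1/2} a \<le> ennreal (16 * (1 - (norm w)\<^sup>2)) * ?h a"
      proof (cases "a \<in> {-1/2..1/2}")
        case True
        then have "\<bar>a\<bar> \<le> 1/2" by auto
        from neglog_mob_real_le[OF this w ne] show ?thesis
          using True w2 by (simp add: ennreal_mult[symmetric])
      qed simp
    qed
    also have "\<dots> = ennreal (16 * (1 - (norm w)\<^sup>2)) * (\<integral>\<^sup>+a. ?h a \<partial>lborel)"
      by (rule nn_integral_cmult) measurable
    also have "(\<integral>\<^sup>+a. ?h a \<partial>lborel) = (\<integral>\<^sup>+s. ?h (Re w + 1 * s) \<partial>lborel)"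
      by (subst nn_integral_real_affine[where c=1 and t="Re w"]) auto
    also have "\<dots> \<le> (\<integral>\<^sup>+s. ennreal (\<bar>s\<bar> powr (-1/2)) * indicator {-2..2} s \<partial>lborel)"
      using rw by (intro nn_integral_mono) (auto simp: indicator_def)
    also have "\<dots> = ennreal c" by (rule c)
    finally have "(\<integral>\<^sup>+a. neglog (norm (mob (of_real a) w)) \<partial>seg) \<le> ennreal (16 * (1 - (norm w)\<^sup>2)) * ennreal c"
      by (simp add: mult_left_mono)
    also have "\<dots> = ennreal (16 * c * (1 - (norm w)\<^sup>2))"
      using c w2 by (subst ennreal_mult[symmetric]) (auto simp: mult_ac)
    finally show "(\<integral>\<^sup>+a. neglog (norm (mob (of_real a) w)) \<partial>seg) \<le> ennreal (16 * c * (1 - (norm w)\<^sup>2))" .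
  qed
qed

text \<open>Expanding |f - f 0|^2 >= 0 and using the mean value property of f. It provides the
  radius-independent majorant for the sum of all defects.\<close>

lemma integral_defect_le:
  assumes f: "disc_map f" and r: "0 < r" "r < 1"
  shows "(LINT t|circ. 1 - (norm (f (of_real r * cis t)))\<^sup>2) \<le> 1 - (norm (f 0))\<^sup>2"
proof -
  have hf: "f holomorphic_on unit_disc" using f by (simp add: disc_map_def)
  note cf = continuous_on_sphere_disc[OF hf r(2)]
  have i: "integrable circ (\<lambda>t. f (of_real r * cis t))" using cf r by (intro integrable_circle) auto
  have "(LINT t|circ. 1 - (norm (f (of_real r * cis t)))\<^sup>2) \<le>
        (LINT t|circ. 1 + (norm (f 0))\<^sup>2 - 2 * Re (cnj (f 0) * f (of_real r * cis t)))"
  proof (rule circ_integral_le[where f="\<lambda>z. 1 - (norm (f z))\<^sup>2" and g="\<lambda>z. 1 + (norm (f 0))\<^sup>2 - 2 * Re (cnj (f 0) * f z)"])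
    fix z
    have "0 \<le> (norm (f z - f 0))\<^sup>2" by simp
    then show "1 - (norm (f z))\<^sup>2 \<le> 1 + (norm (f 0))\<^sup>2 - 2 * Re (cnj (f 0) * f z)"
      unfolding cmod_power2 by (simp add: power2_eq_square algebra_simps)
  qed (use r cf in \<open>auto intro!: continuous_intros\<close>)
  also have "\<dots> = 1 + (norm (f 0))\<^sup>2 - 2 * Re (cnj (f 0) * (LINT t|circ. f (of_real r * cis t)))"
    using i circ.prob_space by (simp del: Re_complex_of_real times_complex.simps)
  also have "(LINT t|circ. f (of_real r * cis t)) = f 0" by (rule circle_mean_disc[OF hf r])
  also have "1 + (norm (f 0))\<^sup>2 - 2 * Re (cnj (f 0) * f 0) = 1 - (norm (f 0))\<^sup>2"
    unfolding cmod_power2 by (simp add: power2_eq_square)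
  finally show ?thesis .
qed

text \<open>Integrating over a first bounds the average of F k by a constant times the total defect
  on the circle R k, which tends to 0. Fatou's lemma then gives liminf 0 for almost every a, and the
  same average at the origin shows that the potential there is finite for almost every a.\<close>

lemma frostman_selection:
  assumes W: "\<And>n::nat. inner_mean (W n)" and sum: "summable (\<lambda>n. 1 - (norm (W n 0))\<^sup>2)"
  shows "\<exists>a. norm a < 1 \<and> (\<Sum>n. neglog (norm (mob a (W n 0)))) < \<infinity> \<and>
    (\<forall>e>0. \<exists>r. 0 < r \<and> r < 1 \<and> (\<integral>\<^sup>+t. (\<Sum>n. neglog (norm (mob a (W n (of_real r * cis t))))) \<partial>circ) < ennreal e)"
proof -
  have dW: "disc_map (W n)" for n using W by (simp add: inner_mean_def)
  have hW: "W n holomorphic_on unit_disc" for n using dW[of n] by (simp add: disc_map_def)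
  obtain C where C': "\<And>w. norm w < 1 \<Longrightarrow> (\<integral>\<^sup>+a. neglog (norm (mob (of_real a) w)) \<partial>seg) \<le> ennreal (C * (1 - (norm w)\<^sup>2))"
    using segment_potential by blast
  \<comment> \<open>\<open>segment_potential\<close> promises no sign for its constant, while the
    sums in \<open>ennreal\<close> need nonnegative terms.\<close>
  define D where "D = max C 0"
  have D: "D \<ge> 0" by (simp add: D_def)
  have C: "(\<integral>\<^sup>+a. neglog (norm (mob (of_real a) w)) \<partial>seg) \<le> ennreal (D * (1 - (norm w)\<^sup>2))" if "norm w < 1" for w
  proof -
    have "C * (1 - (norm w)\<^sup>2) \<le> D * (1 - (norm w)\<^sup>2)"
      using that by (intro mult_right_mono) (auto simp: D_def abs_square_le_1)
    then show ?thesis using C'[OF that] by (meson ennreal_leI order_trans)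
  qed
  define R where "R k = 1 - inverse (real (Suc (Suc k)))" for k
  have R: "0 < R k" "R k < 1" for k
  proof -
    have "inverse (real (Suc (Suc k))) < 1" "inverse (real (Suc (Suc k))) > 0" by (auto simp: field_simps)
    then show "0 < R k" "R k < 1" by (auto simp: R_def)
  qed
  have "R \<longlonglongrightarrow> 1 - 0" unfolding R_def[abs_def]
    by (intro tendsto_diff tendsto_const LIMSEQ_Suc[OF LIMSEQ_inverse_real_of_nat])
  then have Rleft: "filterlim R (at_left 1) sequentially"
    unfolding filterlim_at using R by (auto simp: less_imp_neq)
  have mW [measurable]: "(\<lambda>t. W n (of_real (R k) * cis t)) \<in> borel_measurable circ" for n k
    using R[of k] by (intro measurable_circle continuous_on_sphere_disc[OF hW]) auto
  define F where "F k a = (\<integral>\<^sup>+t. (\<Sum>n. neglog (norm (mob (of_real a) (W n (of_real (R k) * cis t))))) \<partial>circ)" for k and a :: real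
  define d where "d n k = (LINT t|circ. 1 - (norm (W n (of_real (R k) * cis t)))\<^sup>2)" for n k
  have d0: "0 \<le> d n k" for n k unfolding d_def
    using R[of k] by (intro integral_defect_nonneg disc_map_imp_schur dW) auto
  have dle: "d n k \<le> 1 - (norm (W n 0))\<^sup>2" for n k unfolding d_def by (rule integral_defect_le[OF dW R])
  have dlim: "(\<lambda>k. d n k) \<longlonglongrightarrow> 0" for n
    using filterlim_compose[OF _ Rleft, of "\<lambda>r. LINT t|circ. 1 - (norm (W n (of_real r * cis t)))\<^sup>2" "nhds 0"] W[of n]
    by (simp add: inner_mean_def d_def)
  have sumd: "summable (\<lambda>n. d n k)" for k
    by (rule summable_comparison_test'[OF sum]) (use d0 dle in auto)
  \<comment> \<open>Each defect tends to 0 because W n is inner; Tannery's theorem with the defects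
    at the origin as majorant allows the exchange with the sum.\<close>
  have limd: "(\<lambda>k. \<Sum>n. d n k) \<longlonglongrightarrow> (\<Sum>n. 0)"
    by (rule tannerys_theorem[THEN conjunct2, THEN conjunct2, OF dlim _ sum])
       (use d0 dle in \<open>auto intro!: always_eventually\<close>)
  have mF [measurable]: "F k \<in> borel_measurable seg" for k
    unfolding F_def by measurable
  have Fle: "(\<integral>\<^sup>+a. F k a \<partial>seg) \<le> ennreal (D * (\<Sum>n. d n k))" for k
  proof -
    have zk: "norm (of_real (R k) * cis t) < 1" for t using R[of k] by (simp add: norm_mult)
    interpret P: pair_sigma_finite circ seg ..
    have "(\<integral>\<^sup>+a. F k a \<partial>seg) = (\<integral>\<^sup>+t. \<integral>\<^sup>+a. (\<Sum>n. neglog (norm (mob (of_real a) (W n (of_real (R k) * cis t))))) \<partial>seg \<partial>circ)"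
      unfolding F_def by (rule P.Fubini') measurable
    also have "\<dots> = (\<integral>\<^sup>+t. (\<Sum>n. \<integral>\<^sup>+a. neglog (norm (mob (of_real a) (W n (of_real (R k) * cis t)))) \<partial>seg) \<partial>circ)"
      by (intro nn_integral_cong nn_integral_suminf) measurable
    also have "\<dots> \<le> (\<integral>\<^sup>+t. (\<Sum>n. ennreal (D * (1 - (norm (W n (of_real (R k) * cis t)))\<^sup>2))) \<partial>circ)"
      by (intro nn_integral_mono suminf_le C disc_mapD[OF dW] zk) auto
    also have "\<dots> = (\<Sum>n. \<integral>\<^sup>+t. ennreal (D * (1 - (norm (W n (of_real (R k) * cis t)))\<^sup>2)) \<partial>circ)"
      by (rule nn_integral_suminf) measurable
    also have "\<dots> = (\<Sum>n. ennreal (D * d n k))"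
    proof (rule suminf_cong)
      fix n
      have "(\<integral>\<^sup>+t. ennreal (D * (1 - (norm (W n (of_real (R k) * cis t)))\<^sup>2)) \<partial>circ) = ennreal (LINT t|circ. D * (1 - (norm (W n (of_real (R k) * cis t)))\<^sup>2))"
      proof (rule nn_integral_eq_integral)
        show "integrable circ (\<lambda>t. D * (1 - (norm (W n (of_real (R k) * cis t)))\<^sup>2))"
          using R[of k] by (intro integrable_circle[of "R k" "\<lambda>z. D * (1 - (norm (W n z))\<^sup>2)"] continuous_intros continuous_on_sphere_disc[OF hW]) auto
        show "AE t in circ. 0 \<le> D * (1 - (norm (W n (of_real (R k) * cis t)))\<^sup>2)"
          using D schur_defect_nonneg[OF disc_map_imp_schur[OF dW] zk] by (intro AE_I2 mult_nonneg_nonneg) auto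
      qed
      then show "(\<integral>\<^sup>+t. ennreal (D * (1 - (norm (W n (of_real (R k) * cis t)))\<^sup>2)) \<partial>circ) = ennreal (D * d n k)"
        by (simp only: integral_mult_right_zero d_def)
    qed
    also have "\<dots> = ennreal (\<Sum>n. D * d n k)"
      using D d0 sumd by (intro suminf_ennreal2) auto
    also have "(\<Sum>n. D * d n k) = D * (\<Sum>n. d n k)" by (rule suminf_mult[OF sumd])
    finally show ?thesis .
  qed
  have AE1: "AE a in seg. liminf (\<lambda>k. F k a) = 0"
  proof -
    have "(\<integral>\<^sup>+a. liminf (\<lambda>k. F k a) \<partial>seg) \<le> liminf (\<lambda>k. \<integral>\<^sup>+a. F k a \<partial>seg)"
      by (rule nn_integral_liminf) measurable
    also have "\<dots> \<le> liminf (\<lambda>k. ennreal (D * (\<Sum>n. d n k)))"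
      by (intro Liminf_mono always_eventually allI Fle)
    also have "\<dots> = 0"
    proof -
      have "(\<lambda>k. ennreal (D * (\<Sum>n. d n k))) \<longlonglongrightarrow> ennreal (D * (\<Sum>n. 0))"
        by (intro tendsto_ennrealI tendsto_mult limd tendsto_const)
      then show ?thesis by (intro lim_imp_Liminf) auto
    qed
    finally have "(\<integral>\<^sup>+a. liminf (\<lambda>k. F k a) \<partial>seg) = 0" by simp
    then show ?thesis by (subst (asm) nn_integral_0_iff_AE) measurable
  qed
  \<comment> \<open>Finiteness at the origin later keeps the limit of the partial products from
    vanishing there.\<close>
  have AE2: "AE a in seg. (\<Sum>n. neglog (norm (mob (of_real a) (W n 0)))) \<noteq> \<infinity>"
  proof (rule nn_integral_PInf_AE)
    have "(\<integral>\<^sup>+a. (\<Sum>n. neglog (norm (mob (of_real a) (W n 0)))) \<partial>seg) = (\<Sum>n. \<integral>\<^sup>+a. neglog (norm (mob (of_real a) (W n 0))) \<partial>seg)"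
      by (rule nn_integral_suminf) measurable
    also have "\<dots> \<le> (\<Sum>n. ennreal (D * (1 - (norm (W n 0))\<^sup>2)))"
      by (intro suminf_le C disc_mapD[OF dW]) auto
    also have "\<dots> = ennreal (\<Sum>n. D * (1 - (norm (W n 0))\<^sup>2))"
      using D schur_defect_nonneg[OF disc_map_imp_schur[OF dW], of 0] sum
      by (intro suminf_ennreal2 summable_mult mult_nonneg_nonneg) auto
    finally show "(\<integral>\<^sup>+a. (\<Sum>n. neglog (norm (mob (of_real a) (W n 0)))) \<partial>seg) \<noteq> \<infinity>"
      by (auto simp: top_unique)
  qed measurable
  have AE3: "AE a in seg. a \<in> {-1/2..1/2}"
    unfolding seg_def by (rule AE_uniform_measureI) auto
  have "\<exists>a. liminf (\<lambda>k. F k a) = 0 \<and> (\<Sum>n. neglog (norm (mob (of_real a) (W n 0)))) \<noteq> \<infinity> \<and> a \<in> {-1/2..1/2}"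
    using eventually_conj[OF AE1 eventually_conj[OF AE2 AE3]] eventually_happens'[OF seg.ae_filter_bot] by blast
  then obtain a where a: "liminf (\<lambda>k. F k a) = 0" "(\<Sum>n. neglog (norm (mob (of_real a) (W n 0)))) \<noteq> \<infinity>" "a \<in> {-1/2..1/2}"
    by blast
  show ?thesis
  proof (intro exI[of _ "complex_of_real a"] conjI allI impI)
    show "norm (complex_of_real a) < 1" using a(3) by auto
    show "(\<Sum>n. neglog (norm (mob (of_real a) (W n 0)))) < \<infinity>" using a(2) by (simp add: less_top)
    fix e :: real assume e: "e > 0"
    have "\<exists>k. F k a < ennreal e"
    proof (rule ccontr)
      assume "\<not> ?thesis"
      then have "ennreal e \<le> F k a" for k by (simp add: not_less)
      then have "ennreal e \<le> liminf (\<lambda>k. F k a)" by (intro Liminf_bounded always_eventually allI)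
      then show False using a(1) e by simp
    qed
    then show "\<exists>r. 0 < r \<and> r < 1 \<and> (\<integral>\<^sup>+t. (\<Sum>n. neglog (norm (mob (of_real a) (W n (of_real r * cis t))))) \<partial>circ) < ennreal e"
      using R unfolding F_def by blast
  qed
qed

section \<open>Blaschke products automorphic under a disc automorphism\<close>

lemma neglog_le_iff:
  assumes "0 \<le> s"
  shows "neglog x \<le> ennreal s \<longleftrightarrow> exp (- s) \<le> x"
proof (cases "x \<le> 0")
  case True
  then have "neglog x = \<infinity>" by (simp add: neglog_def)
  moreover have "\<not> exp (- s) \<le> x" using True exp_gt_zero[of "- s"] by linarith
  ultimately show ?thesis by (simp add: top_unique)
next
  case False
  then have "neglog x \<le> ennreal s \<longleftrightarrow> - ln x \<le> s"
    using assms by (simp add: neglog_def ennreal_le_iff)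
  also have "\<dots> \<longleftrightarrow> - s \<le> ln x" by linarith
  also have "\<dots> \<longleftrightarrow> exp (- s) \<le> x" using False by (simp add: ln_ge_iff)
  finally show ?thesis .
qed

lemma neglog_1 [simp]: "neglog 1 = 0"
  by (simp add: neglog_def)

lemma neglog_prod:
  fixes f :: "nat \<Rightarrow> real"
  assumes "\<And>i. 0 \<le> f i" "\<And>i. f i \<le> 1"
  shows "neglog (\<Prod>i<n. f i) = (\<Sum>i<n. neglog (f i))"
proof (induction n)
  case (Suc n)
  have "neglog (\<Prod>i<Suc n. f i) = neglog ((\<Prod>i<n. f i) * f n)" by simp
  also have "\<dots> = neglog (\<Prod>i<n. f i) + neglog (f n)"
    using assms by (intro neglog_mult prod_nonneg prod_le_1) auto
  finally show ?case using Suc by simp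
qed simp

lemma neglog_lim_le:
  assumes x: "(\<lambda>n. norm (x n :: complex)) \<longlonglongrightarrow> y" and b: "\<And>n. neglog (norm (x n)) \<le> s"
  shows "neglog y \<le> s"
proof (cases s rule: ennreal_cases)
  case (real r)
  have "exp (- r) \<le> norm (x n)" for n using b[of n] real by (simp add: neglog_le_iff)
  then have "exp (- r) \<le> y" using x by (intro LIMSEQ_le_const) auto
  then show ?thesis using real by (simp add: neglog_le_iff)
qed simp

lemma prod_interleave:
  fixes u v :: "nat \<Rightarrow> 'a::comm_monoid_mult"
  shows "(\<Prod>n<2 * M. if even n then u (n div 2) else v (n div 2)) = (\<Prod>j<M. u j) * (\<Prod>j<M. v j)"
  by (induction M) (simp_all add: mult_ac)

lemma funpow_Suc_left_inverse: "h (f x) = x \<Longrightarrow> (h ^^ Suc n) (f x) = (h ^^ n) x"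
  by (induction n) simp_all

lemma norm_tendsto_1_of_defect:
  fixes x :: "nat \<Rightarrow> complex"
  assumes "(\<lambda>n. 1 - (norm (x n))\<^sup>2) \<longlonglongrightarrow> 0"
  shows "(\<lambda>n. norm (x n)) \<longlonglongrightarrow> 1"
proof -
  have "(\<lambda>n. sqrt (1 - (1 - (norm (x n))\<^sup>2))) \<longlonglongrightarrow> sqrt (1 - 0)"
    by (intro tendsto_intros assms)
  then show ?thesis by simp
qed

lemma norm_mob_tendsto_1:
  assumes a: "norm a < 1" and w: "\<And>n::nat. norm (w n) < 1" and lim: "(\<lambda>n. 1 - (norm (w n))\<^sup>2) \<longlonglongrightarrow> 0"
  shows "(\<lambda>n. norm (mob a (w n))) \<longlonglongrightarrow> 1"
proof (rule norm_tendsto_1_of_defect)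
  have "(\<lambda>n. (1 - (norm (w n))\<^sup>2) / (1 - norm a)\<^sup>2) \<longlonglongrightarrow> 0 / (1 - norm a)\<^sup>2"
    using a by (intro tendsto_intros lim) auto
  then have l: "(\<lambda>n. (1 - (norm (w n))\<^sup>2) / (1 - norm a)\<^sup>2) \<longlonglongrightarrow> 0" by simp
  show "(\<lambda>n. 1 - (norm (mob a (w n)))\<^sup>2) \<longlonglongrightarrow> 0"
  proof (rule tendsto_sandwich[OF _ _ tendsto_const l])
    show "eventually (\<lambda>n. 0 \<le> 1 - (norm (mob a (w n)))\<^sup>2) sequentially"
      using norm_mob_less[OF a w] by (intro always_eventually) (simp add: abs_square_le_1 less_imp_le)
    show "eventually (\<lambda>n. 1 - (norm (mob a (w n)))\<^sup>2 \<le> (1 - (norm (w n))\<^sup>2) / (1 - norm a)\<^sup>2) sequentially"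
      using one_minus_norm_mob_le[OF a less_imp_le[OF w]] by (intro always_eventually) auto
  qed
qed

text \<open>Composition with \<open>\<phi>\<close> shifts the two-sided orbit window by one, so a
  finite product changes only by its two end factors. The orbit runs to the circle in both
  directions, so these tend to unimodular constants along a subsequence, whose quotient is the
  eigenvalue.\<close>

lemma blaschke_eigenfunction:
  assumes dphi: "disc_map \<phi>" and g: "inner_mean g" and g0: "g 0 = 0"
    and A: "disc_map A" and Ai: "disc_map Ai"
    and inv: "\<And>z. norm z < 1 \<Longrightarrow> Ai (A z) = z"
    and semi: "\<And>z. norm z < 1 \<Longrightarrow> g (\<phi> z) = A (g z)"
    and Ainner: "\<And>f. inner_mean f \<Longrightarrow> inner_mean (\<lambda>z. A (f z))"
    and Aiinner: "\<And>f. inner_mean f \<Longrightarrow> inner_mean (\<lambda>z. Ai (f z))"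
    and sumA: "summable (\<lambda>n. 1 - (norm ((A ^^ n) 0))\<^sup>2)"
    and sumAi: "summable (\<lambda>n. 1 - (norm ((Ai ^^ n) 0))\<^sup>2)"
  shows "\<exists>B \<tau>. blaschke_product B \<and> \<not> (\<exists>c. \<forall>z\<in>unit_disc. B z = c) \<and>
           norm \<tau> = 1 \<and> (\<forall>z\<in>unit_disc. B (\<phi> z) = \<tau> * B z)"
proof -
  have dg: "disc_map g" using g by (simp add: inner_mean_def)
  have iA: "inner_mean (\<lambda>z. (A ^^ n) (g z))" for n
  proof (induction n)
    case (Suc n) then show ?case using Ainner[OF Suc] by simp
  qed (use g in simp)
  have iAi: "inner_mean (\<lambda>z. (Ai ^^ n) (g z))" for n
  proof (induction n)
    case (Suc n) then show ?case using Aiinner[OF Suc] by simp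
  qed (use g in simp)
  \<comment> \<open>One enumeration of all integer exponents: even indices run through 0, 1, 2, ...
    and odd ones through -1, -2, ...; the \<open>Suc\<close> prevents exponent 0 from occurring
    twice.\<close>
  define W where "W n z = (if even n then (A ^^ (n div 2)) (g z) else (Ai ^^ Suc (n div 2)) (g z))" for n :: nat and z
  have W: "inner_mean (W n)" for n
    using iA[of "n div 2"] iAi[of "Suc (n div 2)"] by (cases "even n") (simp_all add: W_def[abs_def])
  have dW: "disc_map (W n)" for n using W[of n] by (simp add: inner_mean_def)
  define p where "p n = 1 - (norm ((A ^^ n) 0))\<^sup>2" for n
  define q where "q n = 1 - (norm ((Ai ^^ n) 0))\<^sup>2" for n
  have p0: "0 \<le> p n" "0 \<le> q n" for n
    using disc_mapD[OF disc_map_funpow[OF A], of 0 n] disc_mapD[OF disc_map_funpow[OF Ai], of 0 n]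
    by (auto simp: p_def q_def abs_square_le_1 less_imp_le)
  have W0: "1 - (norm (W n 0))\<^sup>2 = (if even n then p (n div 2) else q (Suc (n div 2)))" for n
    by (simp add: W_def p_def q_def g0 del: funpow.simps)
  have sumW: "summable (\<lambda>n. 1 - (norm (W n 0))\<^sup>2)"
  proof (rule summableI_nonneg_bounded[where x="suminf p + suminf (\<lambda>n. q (Suc n))"])
    have sp: "summable p" using sumA by (simp add: p_def[abs_def])
    have sq: "summable (\<lambda>n. q (Suc n))" using sumAi by (subst summable_Suc_iff) (simp add: q_def[abs_def])
    show nn: "0 \<le> 1 - (norm (W n 0))\<^sup>2" for n using p0 by (simp add: W0)
    have sum2: "(\<Sum>n<2 * M. if even n then p (n div 2) else q (Suc (n div 2))) = (\<Sum>j<M. p j) + (\<Sum>j<M. q (Suc j))" for M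
      by (induction M) simp_all
    fix n
    have "(\<Sum>i<n. 1 - (norm (W i 0))\<^sup>2) \<le> (\<Sum>i<2 * n. 1 - (norm (W i 0))\<^sup>2)"
      by (rule sum_mono2) (use nn in auto)
    also have "\<dots> = (\<Sum>j<n. p j) + (\<Sum>j<n. q (Suc j))" unfolding W0 by (rule sum2)
    also have "\<dots> \<le> suminf p + suminf (\<lambda>n. q (Suc n))"
      by (intro add_mono sum_le_suminf sp sq) (use p0 in auto)
    finally show "(\<Sum>i<n. 1 - (norm (W i 0))\<^sup>2) \<le> suminf p + suminf (\<lambda>n. q (Suc n))" .
  qed
  obtain a where a: "norm a < 1" and fin: "(\<Sum>n. neglog (norm (mob a (W n 0)))) < \<infinity>"
    and small: "\<And>e. e > 0 \<Longrightarrow> \<exists>r. 0 < r \<and> r < 1 \<and> (\<integral>\<^sup>+t. (\<Sum>n. neglog (norm (mob a (W n (of_real r * cis t))))) \<partial>circ) < ennreal e"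
    using frostman_selection[OF W sumW] by blast
  define X where "X M z = (\<Prod>j<M. mob a ((A ^^ j) (g z)))" for M z
  define Y where "Y M z = (\<Prod>j<M. mob a ((Ai ^^ Suc j) (g z)))" for M z
  define P where "P M z = X M z * Y M z" for M z
  have PW: "P M z = (\<Prod>n<2 * M. mob a (W n z))" for M z
  proof -
    have "(\<Prod>n<2 * M. mob a (W n z)) = (\<Prod>n<2 * M. if even n then mob a ((A ^^ (n div 2)) (g z)) else mob a ((Ai ^^ Suc (n div 2)) (g z)))"
      by (intro prod.cong) (auto simp: W_def)
    also have "\<dots> = (\<Prod>j<M. mob a ((A ^^ j) (g z))) * (\<Prod>j<M. mob a ((Ai ^^ Suc j) (g z)))"
      by (rule prod_interleave[where u="\<lambda>j. mob a ((A ^^ j) (g z))" and v="\<lambda>j. mob a ((Ai ^^ Suc j) (g z))"])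
    finally show ?thesis by (simp add: P_def X_def Y_def)
  qed
  have sm: "schur (\<lambda>z. mob a (W n z))" for n
    by (rule schur_compose[OF disc_map_imp_schur[OF disc_map_mob[OF a]] dW])
  have sP: "schur (P M)" for M
    using schur_prod[of "{..<2 * M}" "\<lambda>n z. mob a (W n z)"] sm by (simp add: PW[abs_def])
  define T1 where "T1 N z = mob a ((A ^^ Suc N) (g z))" for N z
  define T2 where "T2 N z = mob a ((Ai ^^ Suc N) (g z))" for N z
  have T: "schur (T1 N)" "schur (T2 N)" for N
    unfolding T1_def T2_def
    by (intro schur_compose[OF disc_map_imp_schur[OF disc_map_mob[OF a]]] disc_map_compose[OF disc_map_funpow] A Ai dg)+
  \<comment> \<open>The window of exponents from -(N+1) to N becomes the one from -N to N+1. The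
    relation is cross-multiplied because the factors may vanish.\<close>
  have functional: "P (Suc N) (\<phi> z) * T2 N z = P (Suc N) z * T1 N z" if z: "norm z < 1" for N z
  proof -
    have gz: "norm (g z) < 1" by (rule disc_mapD[OF dg z])
    have X1: "X M (\<phi> z) * mob a (g z) = X M z * mob a ((A ^^ M) (g z))" for M
    proof (induction M)
      case 0 show ?case by (simp add: X_def)
    next
      case (Suc M)
      have "X (Suc M) (\<phi> z) = X M (\<phi> z) * mob a ((A ^^ M) (A (g z)))" by (simp add: X_def semi[OF z])
      also have "(A ^^ M) (A (g z)) = (A ^^ Suc M) (g z)" by (simp add: funpow_swap1)
      finally have "X (Suc M) (\<phi> z) * mob a (g z) = (X M (\<phi> z) * mob a (g z)) * mob a ((A ^^ Suc M) (g z))" by (simp add: mult_ac)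
      then show ?case unfolding Suc by (simp add: X_def)
    qed
    have Y1: "Y (Suc M) (\<phi> z) = mob a (g z) * Y M z" for M
    proof -
      have "Y (Suc M) (\<phi> z) = (\<Prod>j<Suc M. mob a ((Ai ^^ j) (g z)))"
        by (simp only: Y_def semi[OF z] funpow_Suc_left_inverse[where h=Ai and f=A, OF inv[OF gz]])
      also have "\<dots> = mob a (g z) * Y M z"
        unfolding prod.lessThan_Suc_shift Y_def by simp
      finally show ?thesis .
    qed
    have "P (Suc N) (\<phi> z) * T2 N z = (X (Suc N) (\<phi> z) * mob a (g z)) * (Y N z * T2 N z)"
      by (simp add: P_def Y1 mult_ac)
    also have "X (Suc N) (\<phi> z) * mob a (g z) = X (Suc N) z * T1 N z" unfolding X1 T1_def ..
    also have "Y N z * T2 N z = Y (Suc N) z" by (simp add: Y_def T2_def)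
    finally show ?thesis by (simp add: P_def mult_ac)
  qed
  have lim1: "(\<lambda>N. norm (T1 N 0)) \<longlonglongrightarrow> 1"
    unfolding T1_def g0
  proof (rule norm_mob_tendsto_1[OF a])
    show "norm ((A ^^ Suc n) 0) < 1" for n by (rule disc_mapD[OF disc_map_funpow[OF A]]) simp
    show "(\<lambda>n. 1 - (norm ((A ^^ Suc n) 0))\<^sup>2) \<longlonglongrightarrow> 0" by (rule LIMSEQ_Suc[OF summable_LIMSEQ_zero[OF sumA]])
  qed
  have lim2: "(\<lambda>N. norm (T2 N 0)) \<longlonglongrightarrow> 1"
    unfolding T2_def g0
  proof (rule norm_mob_tendsto_1[OF a])
    show "norm ((Ai ^^ Suc n) 0) < 1" for n by (rule disc_mapD[OF disc_map_funpow[OF Ai]]) simp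
    show "(\<lambda>n. 1 - (norm ((Ai ^^ Suc n) 0))\<^sup>2) \<longlonglongrightarrow> 0" by (rule LIMSEQ_Suc[OF summable_LIMSEQ_zero[OF sumAi]])
  qed
  \<comment> \<open>Three successive extractions, so that one common subsequence serves the two end
    factors and the products.\<close>
  obtain c1 r1 where c1: "norm c1 = 1" and r1: "strict_mono r1" and l1: "\<forall>z. norm z < 1 \<longrightarrow> (\<lambda>n. T1 (r1 n) z) \<longlonglongrightarrow> c1"
    using schur_Montel_unimodular[OF T(1) lim1] by blast
  have lim2': "(\<lambda>N. norm (T2 (r1 N) 0)) \<longlonglongrightarrow> 1"
    using LIMSEQ_subseq_LIMSEQ[OF lim2 r1] by (simp add: o_def)
  obtain c2 r2 where c2: "norm c2 = 1" and r2: "strict_mono r2" and l2: "\<forall>z. norm z < 1 \<longrightarrow> (\<lambda>n. T2 (r1 (r2 n)) z) \<longlonglongrightarrow> c2"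
    using schur_Montel_unimodular[of "\<lambda>n. T2 (r1 n)", OF T(2) lim2'] by blast
  obtain f r3 where f: "schur f" and r3: "strict_mono r3" and l3: "\<forall>z. norm z < 1 \<longrightarrow> (\<lambda>n. P (Suc (r1 (r2 (r3 n)))) z) \<longlonglongrightarrow> f z"
    using schur_Montel[of "\<lambda>n. P (Suc (r1 (r2 n)))", OF sP] by blast
  define r where "r n = r1 (r2 (r3 n))" for n
  have L1: "(\<lambda>n. T1 (r n) z) \<longlonglongrightarrow> c1" if "norm z < 1" for z
    using LIMSEQ_subseq_LIMSEQ[of "\<lambda>n. T1 (r1 n) z" c1 "\<lambda>n. r2 (r3 n)"] l1 that strict_mono_o[OF r2 r3] by (simp add: o_def r_def)
  have L2: "(\<lambda>n. T2 (r n) z) \<longlonglongrightarrow> c2" if "norm z < 1" for z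
    using LIMSEQ_subseq_LIMSEQ[of "\<lambda>n. T2 (r1 (r2 n)) z" c2 r3] l2 that r3 by (simp add: o_def r_def)
  have L3: "(\<lambda>n. P (Suc (r n)) z) \<longlonglongrightarrow> f z" if "norm z < 1" for z
    using l3 that by (simp add: r_def)
  have eig: "f (\<phi> z) * c2 = f z * c1" if z: "norm z < 1" for z
  proof (rule LIMSEQ_unique)
    show "(\<lambda>n. P (Suc (r n)) (\<phi> z) * T2 (r n) z) \<longlonglongrightarrow> f (\<phi> z) * c2"
      by (intro tendsto_mult L3 L2 z disc_mapD[OF dphi])
    show "(\<lambda>n. P (Suc (r n)) (\<phi> z) * T2 (r n) z) \<longlonglongrightarrow> f z * c1"
      unfolding functional[OF z] by (intro tendsto_mult L3 L1 z)
  qed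
  \<comment> \<open>Bounding every partial product by the full sum transfers the smallness from
    \<open>frostman_selection\<close> to any limit f, whichever subsequence produced it.\<close>
  have nP: "neglog (norm (P M z)) \<le> (\<Sum>n. neglog (norm (mob a (W n z))))" if z: "norm z < 1" for M z
  proof -
    have "norm (P M z) = (\<Prod>n<2 * M. norm (mob a (W n z)))" by (simp add: PW prod_norm)
    then have "neglog (norm (P M z)) = (\<Sum>n<2 * M. neglog (norm (mob a (W n z))))"
      using schurD[OF sm z] neglog_prod[of "\<lambda>n. norm (mob a (W n z))" "2 * M"] by simp
    also have "\<dots> \<le> (\<Sum>n. neglog (norm (mob a (W n z))))"
      by (rule sum_le_suminf) auto
    finally show ?thesis .
  qed
  have nf: "neglog (norm (f z)) \<le> (\<Sum>n. neglog (norm (mob a (W n z))))" if z: "norm z < 1" for z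
    by (rule neglog_lim_le[OF tendsto_norm[OF L3[OF z]] nP[OF z]])
  have "neglog (norm (f 0)) < \<infinity>" using nf[of 0] fin by (simp add: order_le_less_trans)
  then have f0: "f 0 \<noteq> 0" using neglog_less_top by fastforce
  have smallf: "\<exists>r. 0 < r \<and> r < 1 \<and> (\<integral>\<^sup>+t. neglog (norm (f (of_real r * cis t))) \<partial>circ) < ennreal e" if e: "0 < e" for e
  proof -
    obtain r where r: "0 < r" "r < 1" "(\<integral>\<^sup>+t. (\<Sum>n. neglog (norm (mob a (W n (of_real r * cis t))))) \<partial>circ) < ennreal e"
      using small[OF e] by blast
    have "(\<integral>\<^sup>+t. neglog (norm (f (of_real r * cis t))) \<partial>circ) \<le> (\<integral>\<^sup>+t. (\<Sum>n. neglog (norm (mob a (W n (of_real r * cis t))))) \<partial>circ)"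
      using r by (intro nn_integral_mono nf) (simp add: norm_mult)
    then show ?thesis using r by (meson order_le_less_trans)
  qed
  have bl: "blaschke_product f" by (rule blaschke_criterion[OF f f0 smallf])
  \<comment> \<open>The factor of exponent 0 takes the value a at the origin and the others have
    modulus at most 1. A constant f would have vanishing logarithmic mean, hence modulus 1, against
    |a| < 1.\<close>
  have f0a: "norm (f 0) \<le> norm a"
  proof (rule LIMSEQ_le_const2[OF tendsto_norm[OF L3]])
    have "norm (P (Suc N) 0) \<le> norm a" for N
    proof -
      have "norm (P (Suc N) 0) = norm (mob a (W 0 0)) * (\<Prod>n<Suc (2 * N). norm (mob a (W (Suc n) 0)))"
        unfolding PW prod_norm[symmetric] mult_Suc_right by (simp add: prod.lessThan_Suc_shift del: prod.lessThan_Suc)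
      also have "\<dots> \<le> norm (mob a (W 0 0))"
        using schurD[OF sm, of 0] by (intro mult_left_le prod_le_1) auto
      also have "W 0 0 = 0" by (simp add: W_def g0)
      finally show ?thesis by simp
    qed
    then show "\<exists>N. \<forall>n\<ge>N. norm (P (Suc (r n)) 0) \<le> norm a" by blast
  qed simp
  have nonconst: "\<not> (\<exists>c. \<forall>z\<in>unit_disc. f z = c)"
  proof
    assume "\<exists>c. \<forall>z\<in>unit_disc. f z = c"
    then have fc: "f z = f 0" if "norm z < 1" for z using that by fastforce
    have "neglog (norm (f 0)) \<le> ennreal e" if e: "e > 0" for e
    proof -
      obtain r where r: "0 < r" "r < 1" "(\<integral>\<^sup>+t. neglog (norm (f (of_real r * cis t))) \<partial>circ) < ennreal e"
        using smallf[OF e] by blast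
      have "f (of_real r * cis t) = f 0" for t using r by (intro fc) (simp add: norm_mult)
      then have "(\<integral>\<^sup>+t. neglog (norm (f (of_real r * cis t))) \<partial>circ) = neglog (norm (f 0))"
        using circ.emeasure_space_1 by simp
      then show ?thesis using r(3) by simp
    qed
    then have "exp (- e) \<le> norm a" if "e > 0" for e
      using neglog_le_iff[of e "norm (f 0)"] that f0a by (meson less_imp_le order_trans)
    moreover obtain b where b: "norm a < b" "b < 1" using dense[OF a] by blast
    then have "b > 0" using norm_ge_zero[of a] by linarith
    ultimately have "exp (- (- ln b)) \<le> norm a" using b ln_less_zero[of b] by (metis neg_0_less_iff_less)
    then show False using b \<open>b > 0\<close> by simp
  qed
  have c2n: "c2 \<noteq> 0" using c2 by auto
  have "f (\<phi> z) = c1 / c2 * f z" if "z \<in> unit_disc" for z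
    using eig[of z] that c2n by (simp add: field_simps)
  moreover have "norm (c1 / c2) = 1" using c1 c2 by (simp add: norm_divide)
  ultimately show ?thesis using bl nonconst by blast
qed

section \<open>Orbits of disc automorphisms\<close>

text \<open>Chebyshev polynomials of the second kind with index shifted by one:
  \<open>cheb t n\<close> is U_(n-1)(t). For a matrix M of determinant 1 and trace 2t, the power M^n
  equals \<open>cheb t n\<close> times M minus \<open>cheb t (n - 1)\<close> times the identity, for
  n >= 1.\<close>

fun cheb :: "real \<Rightarrow> nat \<Rightarrow> real" where
  "cheb t 0 = 0"
| "cheb t (Suc 0) = 1"
| "cheb t (Suc (Suc n)) = 2 * t * cheb t (Suc n) - cheb t n"

lemma cheb_growth:
  assumes "\<bar>t\<bar> \<ge> 1"
  shows "\<bar>cheb t n\<bar> + 1 \<le> \<bar>cheb t (Suc n)\<bar>"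
proof (induction n)
  case (Suc n)
  have "2 * \<bar>cheb t (Suc n)\<bar> \<le> 2 * \<bar>t\<bar> * \<bar>cheb t (Suc n)\<bar>"
    using assms mult_right_mono[of 1 "\<bar>t\<bar>" "\<bar>cheb t (Suc n)\<bar>"] by simp
  also have "\<dots> = \<bar>2 * t * cheb t (Suc n)\<bar>" by (simp add: abs_mult)
  also have "\<dots> \<le> \<bar>cheb t (Suc (Suc n))\<bar> + \<bar>cheb t n\<bar>" by simp
  finally show ?case using Suc by linarith
qed simp

text \<open>Linear growth is exactly what the parabolic case |t| = 1 offers, and its square is still
  enough for summability.\<close>

lemma cheb_ge: "\<bar>t\<bar> \<ge> 1 \<Longrightarrow> real n \<le> \<bar>cheb t n\<bar>"
proof (induction n)
  case (Suc n) then show ?case using cheb_growth[of t n] by simp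
qed simp

text \<open>This says that the power M^(n+1) has determinant 1.\<close>

lemma cheb_invariant: "(cheb t (Suc n))\<^sup>2 - 2 * t * cheb t (Suc n) * cheb t n + (cheb t n)\<^sup>2 = 1"
  by (induction n) (simp_all add: power2_eq_square algebra_simps)

text \<open>\<open>SU(1,1)\<close> form of a disc automorphism; \<open>Re \<alpha>\<close> is half the trace, and the Cayley--Hamilton
  theorem turns iteration into the Chebyshev recursion.\<close>
context
  fixes \<alpha> \<beta> :: complex and A :: "complex \<Rightarrow> complex"
  assumes det: "(norm \<alpha>)\<^sup>2 = 1 + (norm \<beta>)\<^sup>2"
    and Aform: "\<And>z. norm z < 1 \<Longrightarrow> A z = (\<alpha> * z + \<beta>) / (cnj \<beta> * z + cnj \<alpha>)"
    and nofix: "\<And>z. norm z < 1 \<Longrightarrow> A z \<noteq> z"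
    and disc: "\<And>z. norm z < 1 \<Longrightarrow> norm (A z) < 1"
begin

lemma su11_denom: "norm z < 1 \<Longrightarrow> cnj \<beta> * z + cnj \<alpha> \<noteq> 0"
proof
  assume z: "norm z < 1" and "cnj \<beta> * z + cnj \<alpha> = 0"
  then have "norm (cnj \<beta> * z) = norm \<alpha>"
    by (metis add_eq_0_iff complex_mod_cnj norm_minus_cancel)
  then have "norm \<alpha> \<le> norm \<beta>" using z mult_left_le[of "norm z" "norm \<beta>"] by (simp add: norm_mult)
  then have "(norm \<alpha>)\<^sup>2 \<le> (norm \<beta>)\<^sup>2" by (intro power_mono) auto
  then show False using det by simp
qed

lemma su11_beta: "\<beta> \<noteq> 0"
  using nofix[of 0] Aform[of 0] by auto

text \<open>An elliptic trace would produce a fixed point in the disc. Substituting cnj \<beta> z =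
  i m turns the fixed point equation into a real quadratic for m with discriminant 4 (1 - (Re
  \<alpha>)^2) > 0 and product of roots |\<beta>|^2, so one root is smaller than |\<beta>| in
  modulus.\<close>

lemma su11_trace: "\<bar>Re \<alpha>\<bar> \<ge> 1"
proof (rule ccontr)
  assume "\<not> ?thesis"
  then have t: "(Re \<alpha>)\<^sup>2 < 1" by (simp add: abs_square_less_1)
  define \<sigma> where "\<sigma> = Im \<alpha>"
  define \<delta> where "\<delta> = sqrt (\<sigma>\<^sup>2 - (norm \<beta>)\<^sup>2)"
  have "\<sigma>\<^sup>2 - (norm \<beta>)\<^sup>2 > 0" using det t by (simp add: \<sigma>_def cmod_power2)
  then have \<delta>: "\<delta> > 0" "\<delta>\<^sup>2 = \<sigma>\<^sup>2 - (norm \<beta>)\<^sup>2" by (auto simp: \<delta>_def)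
  \<comment> \<open>The root of smaller modulus; which sign gives it depends on the sign of the sum
    of the roots.\<close>
  define m where "m = (if \<sigma> \<ge> 0 then \<sigma> - \<delta> else \<sigma> + \<delta>)"
  have meq: "m\<^sup>2 - 2 * \<sigma> * m + (norm \<beta>)\<^sup>2 = 0"
    using \<delta>(2) by (auto simp: m_def power2_eq_square algebra_simps)
  have b2: "(norm \<beta>)\<^sup>2 > 0" using su11_beta by simp
  have \<sigma>\<delta>: "\<delta> < \<bar>\<sigma>\<bar>"
    using \<delta> b2 by (intro power2_less_imp_less[of \<delta> "\<bar>\<sigma>\<bar>"]) auto
  have "\<bar>m\<bar> = \<bar>\<sigma>\<bar> - \<delta>" using \<sigma>\<delta> \<delta>(1) by (auto simp: m_def)
  then have "\<bar>m\<bar> * \<bar>m\<bar> < (\<bar>\<sigma>\<bar> - \<delta>) * (\<bar>\<sigma>\<bar> + \<delta>)" using \<sigma>\<delta> \<delta>(1) by (auto intro!: mult_strict_left_mono)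
  also have "\<dots> = \<sigma>\<^sup>2 - \<delta>\<^sup>2" by (simp add: power2_eq_square algebra_simps)
  also have "\<dots> = (norm \<beta>)\<^sup>2" using \<delta>(2) by simp
  finally have "m\<^sup>2 < (norm \<beta>)\<^sup>2" by (simp add: power2_eq_square)
  then have mb: "\<bar>m\<bar> < norm \<beta>" using power2_less_imp_less[of "\<bar>m\<bar>" "norm \<beta>"] by simp
  define z where "z = \<i> * of_real m / cnj \<beta>"
  have z: "norm z < 1" using mb su11_beta by (simp add: z_def norm_mult norm_divide)
  have bz: "cnj \<beta> * z = \<i> * of_real m" using su11_beta by (simp add: z_def)
  have aa: "\<alpha> - cnj \<alpha> = 2 * \<i> * of_real \<sigma>" by (simp add: complex_eq_iff \<sigma>_def)
  have "cnj \<beta> * (z * (cnj \<beta> * z + cnj \<alpha>) - (\<alpha> * z + \<beta>))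
      = (cnj \<beta> * z) * (cnj \<beta> * z) - (\<alpha> - cnj \<alpha>) * (cnj \<beta> * z) - \<beta> * cnj \<beta>"
    by (simp add: algebra_simps)
  also have "\<dots> = - of_real (m\<^sup>2 - 2 * \<sigma> * m + (norm \<beta>)\<^sup>2)"
    unfolding bz aa of_real_add of_real_diff complex_norm_square[symmetric] by (simp add: power2_eq_square algebra_simps)
  finally have "cnj \<beta> * (z * (cnj \<beta> * z + cnj \<alpha>) - (\<alpha> * z + \<beta>)) = 0" using meq by simp
  then have "\<alpha> * z + \<beta> = z * (cnj \<beta> * z + cnj \<alpha>)" using su11_beta by simp
  then have "A z = z" using Aform[OF z] su11_denom[OF z] by simp
  then show False using nofix[OF z] by simp
qed

text \<open>The power M^(n+1) is again of the form \<open>SU(1,1)\<close>, with off-diagonal entry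
  \<beta> times the Chebyshev value; this is its determinant relation.\<close>

lemma su11_orbit_denom:
  "(norm (cnj \<alpha> * of_real (cheb (Re \<alpha>) (Suc n)) - of_real (cheb (Re \<alpha>) n)))\<^sup>2 = 1 + (norm \<beta>)\<^sup>2 * (cheb (Re \<alpha>) (Suc n))\<^sup>2"
proof -
  define u where "u = cheb (Re \<alpha>) (Suc n)"
  define v where "v = cheb (Re \<alpha>) n"
  have inv: "u\<^sup>2 - 2 * Re \<alpha> * u * v + v\<^sup>2 = 1" unfolding u_def v_def by (rule cheb_invariant)
  have "(norm (cnj \<alpha> * of_real u - of_real v))\<^sup>2 = (norm \<alpha>)\<^sup>2 * u\<^sup>2 - 2 * Re \<alpha> * u * v + v\<^sup>2"
    unfolding cmod_power2 by (simp add: power2_eq_square algebra_simps)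
  also have "\<dots> = 1 + (norm \<beta>)\<^sup>2 * u\<^sup>2" unfolding det using inv by (simp add: algebra_simps)
  finally show ?thesis by (simp add: u_def v_def)
qed

lemma su11_orbit_denom_nz: "cnj \<alpha> * of_real (cheb (Re \<alpha>) (Suc n)) - of_real (cheb (Re \<alpha>) n) \<noteq> 0"
proof
  assume "cnj \<alpha> * of_real (cheb (Re \<alpha>) (Suc n)) - of_real (cheb (Re \<alpha>) n) = 0"
  then have "1 + (norm \<beta>)\<^sup>2 * (cheb (Re \<alpha>) (Suc n))\<^sup>2 = 0" using su11_orbit_denom[of n] by simp
  moreover have "0 \<le> (norm \<beta>)\<^sup>2 * (cheb (Re \<alpha>) (Suc n))\<^sup>2" by simp
  ultimately show False by linarith
qed

lemma su11_orbit:
  "(A ^^ Suc n) 0 = \<beta> * of_real (cheb (Re \<alpha>) (Suc n)) / (cnj \<alpha> * of_real (cheb (Re \<alpha>) (Suc n)) - of_real (cheb (Re \<alpha>) n))"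
proof (induction n)
  case 0
  show ?case using Aform[of 0] by simp
next
  case (Suc n)
  define u where "u = complex_of_real (cheb (Re \<alpha>) (Suc n))"
  define v where "v = complex_of_real (cheb (Re \<alpha>) n)"
  define d where "d = cnj \<alpha> * u - v"
  have d: "d \<noteq> 0" unfolding d_def u_def v_def by (rule su11_orbit_denom_nz)
  have IH: "(A ^^ Suc n) 0 = \<beta> * u / d" using Suc by (simp add: u_def v_def d_def)
  have n1: "norm ((A ^^ k) 0) < 1" for k by (induction k) (use disc in auto)
  have w: "complex_of_real (cheb (Re \<alpha>) (Suc (Suc n))) = (\<alpha> + cnj \<alpha>) * u - v"
    unfolding complex_add_cnj by (simp add: u_def v_def)
  have ab: "\<beta> * cnj \<beta> = \<alpha> * cnj \<alpha> - 1"
    using det by (metis add_diff_cancel_left' complex_norm_square of_real_1 of_real_add)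
  have "(A ^^ Suc (Suc n)) 0 = A (\<beta> * u / d)" using IH by simp
  also have "\<dots> = (\<alpha> * (\<beta> * u / d) + \<beta>) / (cnj \<beta> * (\<beta> * u / d) + cnj \<alpha>)"
    by (rule Aform) (metis IH n1)
  also have "\<dots> = ((\<alpha> * (\<beta> * u / d) + \<beta>) * d) / ((cnj \<beta> * (\<beta> * u / d) + cnj \<alpha>) * d)" using d by simp
  also have "(\<alpha> * (\<beta> * u / d) + \<beta>) * d = \<beta> * (\<alpha> * u + d)" using d by (simp add: field_simps)
  also have "(cnj \<beta> * (\<beta> * u / d) + cnj \<alpha>) * d = (\<beta> * cnj \<beta>) * u + cnj \<alpha> * d" using d by (simp add: field_simps)
  also have "\<beta> * (\<alpha> * u + d) = \<beta> * ((\<alpha> + cnj \<alpha>) * u - v)" by (simp add: d_def algebra_simps)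
  also have "(\<beta> * cnj \<beta>) * u + cnj \<alpha> * d = cnj \<alpha> * ((\<alpha> + cnj \<alpha>) * u - v) - u" unfolding ab d_def by (simp add: algebra_simps)
  finally show ?case by (simp only: w u_def[symmetric])
qed

lemma su11_orbit_summable: "summable (\<lambda>n. 1 - (norm ((A ^^ n) 0))\<^sup>2)"
proof -
  define b where "b = (norm \<beta>)\<^sup>2"
  have b: "b > 0" using su11_beta by (simp add: b_def)
  have bound: "1 - (norm ((A ^^ Suc n) 0))\<^sup>2 \<le> inverse b * inverse ((real (Suc n))\<^sup>2)"
    and nn: "0 \<le> 1 - (norm ((A ^^ Suc n) 0))\<^sup>2" for n
  proof -
    define x where "x = (cheb (Re \<alpha>) (Suc n))\<^sup>2"
    have "(real (Suc n))\<^sup>2 \<le> \<bar>cheb (Re \<alpha>) (Suc n)\<bar>\<^sup>2"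
      by (intro power_mono cheb_ge su11_trace) auto
    then have x: "(real (Suc n))\<^sup>2 \<le> x" by (simp add: x_def)
    have x0: "x > 0" by (rule less_le_trans[OF _ x]) simp
    have "(norm ((A ^^ Suc n) 0))\<^sup>2 = b * x / (1 + b * x)"
      unfolding su11_orbit norm_divide power_divide su11_orbit_denom
      by (simp add: norm_mult power_mult_distrib b_def x_def)
    then have eq: "1 - (norm ((A ^^ Suc n) 0))\<^sup>2 = 1 / (1 + b * x)"
      using add_pos_pos[OF zero_less_one mult_pos_pos[OF b x0]] by (simp add: divide_simps left_diff_distrib)
    also have "\<dots> \<le> 1 / (b * (real (Suc n))\<^sup>2)"
      using b x by (intro frac_le add_increasing mult_left_mono mult_pos_pos) auto
    finally show "1 - (norm ((A ^^ Suc n) 0))\<^sup>2 \<le> inverse b * inverse ((real (Suc n))\<^sup>2)"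
      by (simp add: divide_inverse)
    show "0 \<le> 1 - (norm ((A ^^ Suc n) 0))\<^sup>2" unfolding eq using b x0 by simp
  qed
  have "summable (\<lambda>n. inverse ((real n)\<^sup>2))" by (rule inverse_power_summable) simp
  then have "summable (\<lambda>n. inverse ((real (Suc n))\<^sup>2))" by (subst summable_Suc_iff)
  then have "summable (\<lambda>n. inverse b * inverse ((real (Suc n))\<^sup>2))" by (rule summable_mult)
  then have "summable (\<lambda>n. 1 - (norm ((A ^^ Suc n) 0))\<^sup>2)"
    by (rule summable_comparison_test') (use bound nn in auto)
  then show ?thesis by (subst (asm) summable_Suc_iff)
qed

end

lemma automorphism_orbit_summable:
  assumes c: "norm c < 1" and l: "norm l = 1" and nofix: "\<And>z. norm z < 1 \<Longrightarrow> mob c (l * z) \<noteq> z"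
  shows "summable (\<lambda>n. 1 - (norm (((\<lambda>z. mob c (l * z)) ^^ n) 0))\<^sup>2)"
proof -
  \<comment> \<open>Numerator and denominator of \<open>mob c (l * z)\<close> are multiplied by cnj
    k / s. The choice k^2 = -l makes the diagonal entries conjugate to each other, and s normalises
    the determinant to 1.\<close>
  define k where "k = csqrt (- l)"
  define s where "s = sqrt (1 - (norm c)\<^sup>2)"
  have "1 - (norm c)\<^sup>2 > 0" using c by (simp add: abs_square_less_1)
  then have s: "s > 0" "s\<^sup>2 = 1 - (norm c)\<^sup>2" by (auto simp: s_def)
  have k2: "k * k = - l" by (simp add: k_def flip: power2_eq_square)
  have "norm k * norm k = 1" using arg_cong[OF k2, of norm] l by (simp add: norm_mult)
  then have "(norm k)\<^sup>2 = 1" by (simp add: power2_eq_square)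
  then have nk: "norm k = 1" by (simp add: power2_eq_1_iff) (use norm_ge_zero[of k] in linarith)
  then have kk: "k * cnj k = 1" by (simp add: complex_norm_square[symmetric])
  have lk: "l = - (k * k)" using k2 by simp
  have "cnj k * l = - ((k * cnj k) * k)" unfolding lk by (simp add: mult_ac)
  then have kl: "cnj k * l = - k" by (simp add: kk)
  have k0: "cnj k / of_real s \<noteq> 0" using nk s by auto
  show ?thesis
  proof (rule su11_orbit_summable[where \<alpha>="k / of_real s" and \<beta>="c * cnj k / of_real s"])
    show "(norm (k / of_real s))\<^sup>2 = 1 + (norm (c * cnj k / of_real s))\<^sup>2"
      using s nk by (simp add: norm_divide norm_mult power_divide field_simps)
    fix z :: complex assume z: "norm z < 1"
    have d: "1 - cnj c * (l * z) \<noteq> 0" using mob_denom[OF c, of "l * z"] z l by (simp add: norm_mult)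
    have "mob c (l * z) = ((cnj k / of_real s) * (c - l * z)) / ((cnj k / of_real s) * (1 - cnj c * (l * z)))"
      unfolding mob_def using k0 by simp
    also have "(cnj k / of_real s) * (c - l * z) = k / of_real s * z + c * cnj k / of_real s"
    proof -
      have "cnj k * (c - l * z) = c * cnj k - (cnj k * l) * z" by (simp add: algebra_simps)
      then have "cnj k * (c - l * z) = k * z + c * cnj k" by (simp add: kl)
      then show ?thesis by (simp add: add_divide_distrib[symmetric])
    qed
    also have "(cnj k / of_real s) * (1 - cnj c * (l * z)) = cnj (c * cnj k / of_real s) * z + cnj (k / of_real s)"
    proof -
      have "cnj k * (1 - cnj c * (l * z)) = cnj k - cnj c * ((cnj k * l) * z)" by (simp add: algebra_simps)
      then have "cnj k * (1 - cnj c * (l * z)) = cnj c * k * z + cnj k" by (simp add: kl)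
      then show ?thesis by (simp add: add_divide_distrib[symmetric])
    qed
    finally show "mob c (l * z) = (k / of_real s * z + c * cnj k / of_real s) / (cnj (c * cnj k / of_real s) * z + cnj (k / of_real s))" .
    show "mob c (l * z) \<noteq> z" by (rule nofix[OF z])
    show "norm (mob c (l * z)) < 1" using z l c by (intro norm_mob_less) (simp_all add: norm_mult)
  qed
qed

text \<open>Equality at one pair gives a formula based at x. Evaluating it at 0 gives equality for
  the pair 0, x, so the rigidity part applies again with base point 0.\<close>

lemma schwarz_pick_automorphism:
  assumes A: "disc_map A" and x: "norm x < 1" and y: "norm y < 1" and ne: "y \<noteq> x"
    and eq: "norm (mob (A x) (A y)) = norm (mob x y)"
  shows "\<exists>l. norm l = 1 \<and> (\<forall>z. norm z < 1 \<longrightarrow> A z = mob (A 0) (l * z))"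
proof -
  obtain l0 where l0: "norm l0 = 1" "\<And>z. norm z < 1 \<Longrightarrow> mob (A x) (A z) = l0 * mob x z"
    using schwarz_pick(2)[OF A x y ne eq] by blast
  have "\<exists>l. norm l = 1 \<and> (\<forall>z. norm z < 1 \<longrightarrow> mob (A 0) (A z) = l * mob 0 z)"
  proof (cases "x = 0")
    case True
    then show ?thesis using l0 unfolding True by blast
  next
    case False
    have "norm (mob (A 0) (A x)) = norm (mob 0 x)"
    proof -
      have "norm (mob (A 0) (A x)) = norm (l0 * mob x 0)"
        using norm_mob_commute[of "A 0" "A x"] l0(2)[of 0] by simp
      also have "\<dots> = norm (mob 0 x)" using norm_mob_commute[of 0 x] l0(1) by (simp only: norm_mult mult_1)
      finally show ?thesis .
    qed
    then show ?thesis using x False by (intro schwarz_pick(2)[OF A, of 0 x]) simp_all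
  qed
  then obtain l where l: "norm l = 1" "\<And>z. norm z < 1 \<Longrightarrow> mob (A 0) (A z) = l * mob 0 z" by blast
  have rot: "A z = mob (A 0) (- l * z)" if z: "norm z < 1" for z
  proof -
    have "A z = mob (A 0) (mob (A 0) (A z))"
      using disc_mapD[OF A, of 0] disc_mapD[OF A z] by (simp only: mob_mob norm_zero zero_less_one)
    also have "\<dots> = mob (A 0) (l * mob 0 z)" by (simp only: l(2)[OF z])
    also have "l * mob 0 z = - l * z" by (simp add: mob_def)
    finally show ?thesis .
  qed
  have "norm (- l) = 1" using l(1) by simp
  then show ?thesis using rot by blast
qed

section \<open>The rescaling limit\<close>

lemma inner_mean_rotate:
  assumes f: "inner_mean f" and l: "norm l = 1"
  shows "inner_mean (\<lambda>z. l * f z)"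
  using f l unfolding inner_mean_def disc_map_def by (auto simp: norm_mult intro!: holomorphic_intros)

text \<open>The induction peels off the outermost factor: only it must have boundary values, the
  inner iterate enters through its means.\<close>

lemma inner_mean_funpow:
  assumes "inner_function f"
  shows "inner_mean (f ^^ n)"
proof (induction n)
  case 0 show ?case using inner_mean_id by (simp add: id_def)
next
  case (Suc n) show ?case using inner_function_compose[OF assms Suc] by (simp add: o_def)
qed

text \<open>The moduli decrease to some L. A cluster point y and its image both have modulus L,
  which strict contraction permits only for y = 0.\<close>

lemma schwarz_strict_iterates_tendsto_0:
  assumes f: "disc_map f" and strict: "\<And>x. norm x < 1 \<Longrightarrow> x \<noteq> 0 \<Longrightarrow> norm (f x) < norm x"
    and f0: "f 0 = 0" and x: "norm x < 1"
  shows "(\<lambda>n. (f ^^ n) x) \<longlonglongrightarrow> 0"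
proof -
  define u where "u n = (f ^^ n) x" for n
  have u1: "norm (u n) < 1" for n unfolding u_def by (rule disc_mapD[OF disc_map_funpow[OF f] x])
  have us: "u (Suc n) = f (u n)" for n by (simp add: u_def)
  have le: "norm (f y) \<le> norm y" if "norm y < 1" for y
    using strict[OF that] f0 by (cases "y = 0") (auto simp: less_imp_le)
  have dec: "decseq (\<lambda>n. norm (u n))" using le[OF u1] us by (intro decseq_SucI) simp
  have xl: "norm (u n) \<le> norm x" for n using decseqD[OF dec, of 0 n] by (simp add: u_def)
  obtain L where L: "(\<lambda>n. norm (u n)) \<longlonglongrightarrow> L"
    using decseq_convergent[OF dec, of 0] by auto
  have "\<forall>n. u n \<in> cball 0 (norm x)" using xl by simp
  then obtain y r where y: "y \<in> cball 0 (norm x)" and r: "strict_mono r" and lim: "(u \<circ> r) \<longlonglongrightarrow> y"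
    using compact_cball[of 0 "norm x"] unfolding compact_def by metis
  have y1: "norm y < 1" using y x by simp
  have "(\<lambda>n. norm (u (r n))) \<longlonglongrightarrow> norm y" using tendsto_norm[OF lim] by (simp add: o_def)
  moreover have "(\<lambda>n. norm (u (r n))) \<longlonglongrightarrow> L" using LIMSEQ_subseq_LIMSEQ[OF L r] by (simp add: o_def)
  ultimately have yL: "norm y = L" using LIMSEQ_unique by blast
  have "continuous_on unit_disc f" using f by (auto simp: disc_map_def intro: holomorphic_on_imp_continuous_on)
  then have "isCont f y" using y1 by (simp add: continuous_on_eq_continuous_at)
  then have "(\<lambda>n. f (u (r n))) \<longlonglongrightarrow> f y" using lim by (auto simp: o_def intro: isCont_tendsto_compose)
  then have "(\<lambda>n. norm (u (Suc (r n)))) \<longlonglongrightarrow> norm (f y)" unfolding us by (rule tendsto_norm)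
  moreover have "(\<lambda>n. norm (u (Suc (r n)))) \<longlonglongrightarrow> L"
    using LIMSEQ_subseq_LIMSEQ[OF LIMSEQ_Suc[OF L] r] by (simp add: o_def)
  ultimately have "norm (f y) = L" using LIMSEQ_unique by blast
  then have "y = 0" using strict[OF y1] yL by force
  then have "(\<lambda>n. norm (u n)) \<longlonglongrightarrow> 0" using L yL by simp
  then show ?thesis by (simp add: u_def tendsto_norm_zero_iff)
qed

lemma blaschke_product_single:
  assumes "norm p < 1"
  shows "blaschke_product (blaschke_factor p)"
  unfolding blaschke_product_def
proof (rule exI[of _ 1], rule exI[of _ "\<lambda>_. p"], rule exI[of _ "{0}"], intro conjI ballI)
  show "summable (\<lambda>i::nat. if i \<in> {0} then 1 - norm p else 0)"
    by (rule summable_finite[of "{0}"]) auto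
  fix z :: complex
  show "(\<lambda>i::nat. if i \<in> {0} then blaschke_factor p z else 1) has_prod (blaschke_factor p z / 1)"
    using has_prod_If_finite_set[of "{0::nat}" "\<lambda>_. blaschke_factor p z"] by simp
qed (use assms in auto)

text \<open>After conjugation the fixed point is 0, where the Schwarz lemma leaves a rotation or a
  strict contraction. In the second case all orbits converge to 0 and consecutive points become
  arbitrarily close, against the positive step; in the first, \<open>mob p\<close> is an
  eigenfunction.\<close>

lemma fixed_point_eigenfunction:
  assumes phi: "disc_map \<phi>" and step: "positive_hyperbolic_step \<phi>" and p: "norm p < 1" and fp: "\<phi> p = p"
  shows "\<exists>B \<tau>. blaschke_product B \<and> \<not> (\<exists>c. \<forall>z\<in>unit_disc. B z = c) \<and>
           norm \<tau> = 1 \<and> (\<forall>z\<in>unit_disc. B (\<phi> z) = \<tau> * B z)"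
proof -
  define f where "f z = mob p (\<phi> (mob p z))" for z
  have f: "disc_map f" unfolding f_def
    by (rule disc_map_compose[OF disc_map_mob[OF p] disc_map_compose[OF phi disc_map_mob[OF p]]])
  then have hf: "f holomorphic_on unit_disc" by (simp add: disc_map_def)
  have f0: "f 0 = 0" by (simp add: f_def fp)
  have conj: "f (mob p z) = mob p (\<phi> z)" if "norm z < 1" for z using that p by (simp add: f_def mob_mob)
  have conjn: "(f ^^ n) (mob p z) = mob p ((\<phi> ^^ n) z)" if z: "norm z < 1" for n z
    by (induction n) (simp_all add: conj disc_mapD[OF disc_map_funpow[OF phi] z])
  have ex: "\<exists>x. norm x < 1 \<and> x \<noteq> 0 \<and> norm (f x) = norm x"
  proof (rule ccontr)
    assume no: "\<not> ?thesis"
    have strict: "norm (f x) < norm x" if "norm x < 1" "x \<noteq> 0" for x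
      using Schwarz_Lemma(1)[OF hf f0 disc_mapD[OF f] that(1)] no that by fastforce
    obtain z0 L where z0: "norm z0 < 1" and L: "L > 0"
      and lim: "(\<lambda>n. pseudo_hyp ((\<phi> ^^ n) z0) ((\<phi> ^^ Suc n) z0)) \<longlonglongrightarrow> L"
      using step unfolding positive_hyperbolic_step_def by auto
    define u where "u n = (f ^^ n) (mob p z0)" for n
    have u: "u \<longlonglongrightarrow> 0" unfolding u_def
      by (rule schwarz_strict_iterates_tendsto_0[OF f strict f0 norm_mob_less[OF p z0]])
    have nz: "norm ((\<phi> ^^ n) z0) < 1" for n by (rule disc_mapD[OF disc_map_funpow[OF phi] z0])
    have "pseudo_hyp ((\<phi> ^^ n) z0) ((\<phi> ^^ Suc n) z0) = norm (mob (u (Suc n)) (u n))" for n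
      unfolding u_def conjn[OF z0] norm_mob_mob[OF p nz nz] pseudo_hyp_eq_mob ..
    then have "(\<lambda>n. norm (mob (u (Suc n)) (u n))) \<longlonglongrightarrow> L" using lim by simp
    moreover have "(\<lambda>n. norm (mob (u (Suc n)) (u n))) \<longlonglongrightarrow> norm (mob 0 0)"
      by (intro tendsto_norm tendsto_mob LIMSEQ_Suc u) auto
    ultimately show False using LIMSEQ_unique L by fastforce
  qed
  have "\<exists>\<alpha>. (\<forall>z. norm z < 1 \<longrightarrow> f z = \<alpha> * z) \<and> norm \<alpha> = 1"
    by (rule Schwarz_Lemma(3)[OF hf f0 disc_mapD[OF f], of 0]) (use ex in auto)
  then obtain \<alpha> where \<alpha>: "norm \<alpha> = 1" "\<And>z. norm z < 1 \<Longrightarrow> f z = \<alpha> * z" by blast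
  have eig: "mob p (\<phi> z) = \<alpha> * mob p z" if "norm z < 1" for z
    using \<alpha>(2)[OF norm_mob_less[OF p that]] conj[OF that] by simp
  \<comment> \<open>For p = 0 the Blaschke factor is z while \<open>mob 0 z\<close> is -z, whence
    the constant -1.\<close>
  have "\<exists>k. k \<noteq> 0 \<and> (\<forall>z. blaschke_factor p z = k * mob p z)"
  proof (cases "p = 0")
    case True then show ?thesis by (intro exI[of _ "-1"]) (simp add: blaschke_factor_def mob_def)
  next
    case False then show ?thesis by (intro exI[of _ "of_real (norm p) / p"]) (simp add: blaschke_factor_eq_mob)
  qed
  then obtain k where k: "k \<noteq> 0" "\<And>z. blaschke_factor p z = k * mob p z" by blast
  have nc: "\<not> (\<exists>c. \<forall>z\<in>unit_disc. blaschke_factor p z = c)"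
  proof
    assume "\<exists>c. \<forall>z\<in>unit_disc. blaschke_factor p z = c"
    then have all: "blaschke_factor p z = blaschke_factor p p" if "norm z < 1" for z using that p by force
    obtain z where z: "norm z < 1" "z \<noteq> p"
    proof (cases "p = 0")
      case True then show ?thesis using that[of "1/2"] by simp
    next
      case False then show ?thesis using that[of 0] by simp
    qed
    have "mob p z = 0" using all[OF z(1)] k by simp
    then show False using z mob_eq_0_iff[OF p z(1)] by simp
  qed
  have "blaschke_factor p (\<phi> z) = \<alpha> * blaschke_factor p z" if "z \<in> unit_disc" for z
    using eig[of z] that unfolding k(2) by simp
  then show ?thesis using blaschke_product_single[OF p] nc \<alpha>(1) by blast
qed

lemma funpow_semiconj:
  assumes phi: "disc_map \<phi>" and semi: "\<And>z. norm z < 1 \<Longrightarrow> g (\<phi> z) = A (g z)" and z: "norm z < 1"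
  shows "g ((\<phi> ^^ n) z) = (A ^^ n) (g z)"
  by (induction n) (simp_all add: semi disc_mapD[OF disc_map_funpow[OF phi] z])

text \<open>The positive step is known at z0 while the rescaling is based at 0. The two meet because
  distances between images under g are limits of distances between the corresponding iterates,
  whatever the base point.\<close>

lemma hyperbolic_rescaling:
  assumes phi: "disc_map \<phi>" and step: "positive_hyperbolic_step \<phi>"
  shows "\<exists>g c l r. disc_map g \<and> g 0 = 0 \<and> (\<exists>z. norm z < 1 \<and> g z \<noteq> 0) \<and> norm c < 1 \<and> norm l = 1 \<and> strict_mono (r :: nat \<Rightarrow> nat) \<and>
    (\<forall>z. norm z < 1 \<longrightarrow> g (\<phi> z) = mob c (l * g z)) \<and>
    (\<forall>z. norm z < 1 \<longrightarrow> (\<lambda>n. mob ((\<phi> ^^ r n) 0) ((\<phi> ^^ r n) z)) \<longlonglongrightarrow> g z) \<and>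
    ((\<exists>z. norm z < 1 \<and> mob c (l * z) = z) \<longrightarrow> (\<exists>p. norm p < 1 \<and> \<phi> p = p))"
proof -
  define x where "x n = (\<phi> ^^ n) 0" for n
  have dn: "disc_map (\<phi> ^^ n)" for n by (rule disc_map_funpow[OF phi])
  have x1: "norm (x n) < 1" for n unfolding x_def by (rule disc_mapD[OF dn]) simp
  define \<psi> where "\<psi> n z = mob (x n) (\<phi> (mob (x n) z))" for n z
  define q where "q n z = mob (x n) ((\<phi> ^^ n) z)" for n z
  have d\<psi>: "disc_map (\<psi> n)" for n unfolding \<psi>_def
    by (rule disc_map_compose[OF disc_map_mob[OF x1] disc_map_compose[OF phi disc_map_mob[OF x1]]])
  have dq: "disc_map (q n)" for n unfolding q_def by (rule disc_map_compose[OF disc_map_mob[OF x1] dn])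
  have \<psi>q: "\<psi> n (q n z) = q n (\<phi> z)" if z: "norm z < 1" for n z
    unfolding \<psi>_def q_def mob_mob[OF x1 disc_mapD[OF dn z]] by (simp add: funpow_swap1)
  obtain A r1 where A: "schur A" and r1: "strict_mono r1"
    and A1: "\<forall>z. norm z < 1 \<longrightarrow> (\<lambda>n. \<psi> (r1 n) z) \<longlonglongrightarrow> A z"
    and A2: "\<forall>K. compact K \<and> K \<subseteq> unit_disc \<longrightarrow> uniform_limit K (\<lambda>n. \<psi> (r1 n)) A sequentially"
    using schur_Montel[of \<psi>, OF disc_map_imp_schur[OF d\<psi>]] by blast
  obtain g r2 where g: "schur g" and r2: "strict_mono r2"
    and g1': "\<forall>z. norm z < 1 \<longrightarrow> (\<lambda>n. q (r1 (r2 n)) z) \<longlonglongrightarrow> g z"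
    using schur_Montel[of "\<lambda>n. q (r1 n)", OF disc_map_imp_schur[OF dq]] by blast
  define r where "r n = r1 (r2 n)" for n
  have r: "strict_mono r" using strict_mono_o[OF r1 r2] by (simp add: r_def[abs_def] o_def)
  have gl: "(\<lambda>n. q (r n) z) \<longlonglongrightarrow> g z" if "norm z < 1" for z using g1' that by (simp add: r_def)
  have Aul: "uniform_limit K (\<lambda>n. \<psi> (r n)) A sequentially" if "compact K" "K \<subseteq> unit_disc" for K
    using filterlim_compose[OF A2[rule_format, OF conjI[OF that]] filterlim_subseq[OF r2]]
    by (simp add: r_def)
  have Al: "(\<lambda>n. \<psi> (r n) z) \<longlonglongrightarrow> A z" if "norm z < 1" for z
    using LIMSEQ_subseq_LIMSEQ[OF A1[rule_format, OF that] r2] by (simp add: o_def r_def)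
  have hA: "A holomorphic_on unit_disc" using A by (simp add: schur_def)

  have g0: "g 0 = 0"
  proof -
    have "q n 0 = 0" for n by (simp add: q_def x_def)
    then show ?thesis using gl[of 0] by (simp add: LIMSEQ_const_iff)
  qed
  have dg: "disc_map g" by (rule schur_imp_disc_map[OF g, of 0]) (simp_all add: g0)
  have mono: "norm (mob (x n) (x (Suc n))) \<le> norm (mob (x 0) (x (Suc 0)))" for n
  proof (induction n)
    case (Suc n)
    have "norm (mob (x (Suc n)) (x (Suc (Suc n)))) \<le> norm (mob (x n) (x (Suc n)))"
      using schwarz_pick(1)[OF phi x1[of n] x1[of "Suc n"]] by (simp add: x_def)
    then show ?case using Suc by simp
  qed simp
  \<comment> \<open>The modulus of psi_n(0) is the step along the orbit of 0. By Schwarz-Pick it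
    never exceeds its first value |\<phi> 0|, which keeps A from degenerating to a unimodular
    constant.\<close>
  have dA: "disc_map A"
  proof (rule schur_imp_disc_map[OF A, of 0])
    have b: "norm (\<psi> n 0) \<le> norm (\<phi> 0)" for n
      using mono[of n] by (simp add: \<psi>_def x_def mob_def[of 0])
    have "norm (A 0) \<le> norm (\<phi> 0)"
      by (rule LIMSEQ_le_const2[OF tendsto_norm[OF Al]]) (use b in auto)
    also have "\<dots> < 1" by (rule disc_mapD[OF phi]) simp
    finally show "norm (A 0) < 1" .
  qed simp
  have semi: "g (\<phi> z) = A (g z)" if z: "norm z < 1" for z
  proof (rule LIMSEQ_unique)
    show "(\<lambda>n. q (r n) (\<phi> z)) \<longlonglongrightarrow> g (\<phi> z)" by (rule gl[OF disc_mapD[OF phi z]])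
    have "(\<lambda>n. \<psi> (r n) (q (r n) z)) \<longlonglongrightarrow> A (g z)"
      by (rule tendsto_uniform_compose[OF Aul hA gl[OF z] disc_mapD[OF dg z]])
    then show "(\<lambda>n. q (r n) (\<phi> z)) \<longlonglongrightarrow> A (g z)" by (simp only: \<psi>q[OF z])
  qed
  have isom: "(\<lambda>n. norm (mob ((\<phi> ^^ r n) z) ((\<phi> ^^ r n) w))) \<longlonglongrightarrow> norm (mob (g z) (g w))"
    if z: "norm z < 1" and w: "norm w < 1" for z w
  proof -
    have "(\<lambda>n. norm (mob (q (r n) z) (q (r n) w))) \<longlonglongrightarrow> norm (mob (g z) (g w))"
      by (intro tendsto_norm tendsto_mob gl z w disc_mapD[OF dg])
    then show ?thesis unfolding q_def norm_mob_mob[OF x1 disc_mapD[OF dn z] disc_mapD[OF dn w]] .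
  qed
  obtain z0 L where z0: "norm z0 < 1" and L: "L > 0"
    and lim: "(\<lambda>n. pseudo_hyp ((\<phi> ^^ n) z0) ((\<phi> ^^ Suc n) z0)) \<longlonglongrightarrow> L"
    using step unfolding positive_hyperbolic_step_def by auto
  define z1 where "z1 = \<phi> z0"
  define z2 where "z2 = \<phi> z1"
  have z1: "norm z1 < 1" and z2: "norm z2 < 1"
    unfolding z1_def z2_def using disc_mapD[OF phi] z0 by auto
  have lim': "(\<lambda>n. norm (mob ((\<phi> ^^ Suc n) z0) ((\<phi> ^^ n) z0))) \<longlonglongrightarrow> L"
    using lim by (simp only: pseudo_hyp_eq_mob)
  \<comment> \<open>Shifting the orbit by one does not change the limit L, so A preserves the
    distance between g z0 and g z1, two distinct points since L > 0.\<close>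
  have L1: "norm (mob (g z1) (g z0)) = L"
  proof (rule LIMSEQ_unique[OF isom[OF z1 z0]])
    show "(\<lambda>n. norm (mob ((\<phi> ^^ r n) z1) ((\<phi> ^^ r n) z0))) \<longlonglongrightarrow> L"
      using LIMSEQ_subseq_LIMSEQ[OF lim' r] by (simp add: o_def z1_def funpow_swap1)
  qed
  have L2: "norm (mob (g z2) (g z1)) = L"
  proof (rule LIMSEQ_unique[OF isom[OF z2 z1]])
    show "(\<lambda>n. norm (mob ((\<phi> ^^ r n) z2) ((\<phi> ^^ r n) z1))) \<longlonglongrightarrow> L"
      using LIMSEQ_subseq_LIMSEQ[OF LIMSEQ_Suc[OF lim'] r] by (simp add: o_def z1_def z2_def funpow_swap1)
  qed
  have ne: "g z0 \<noteq> g z1" using L1 L by auto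
  have "norm (mob (A (g z1)) (A (g z0))) = norm (mob (g z1) (g z0))"
    using L1 L2 semi[OF z0] semi[OF z1] by (simp add: z1_def z2_def)
  then obtain l where l: "norm l = 1" and lA: "\<forall>z. norm z < 1 \<longrightarrow> A z = mob (A 0) (l * z)"
    using schwarz_pick_automorphism[OF dA disc_mapD[OF dg z1] disc_mapD[OF dg z0] ne] by blast
  \<comment> \<open>A fixed point of psi_n is carried by \<open>mob (x n)\<close> to one of
    \<open>\<phi>\<close>. If \<open>\<phi>\<close> has none, Hurwitz's theorem for psi_n(w) - w
    excludes fixed points of A, unless A is the identity; but A moves g z0 to g z1.\<close>
  have fixd: "\<exists>p. norm p < 1 \<and> \<phi> p = p" if fx: "\<exists>z. norm z < 1 \<and> mob (A 0) (l * z) = z"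
  proof (rule ccontr)
    assume no: "\<not> ?thesis"
    obtain z where z: "norm z < 1" and fz: "mob (A 0) (l * z) = z" using fx by blast
    have Az: "A z = z" using lA[rule_format, OF z] fz by (rule trans)
    have nofix: "\<psi> n w \<noteq> w" if w: "norm w < 1" for n w
    proof
      assume "\<psi> n w = w"
      then have "mob (x n) (mob (x n) (\<phi> (mob (x n) w))) = mob (x n) w" by (simp add: \<psi>_def)
      then have "\<phi> (mob (x n) w) = mob (x n) w"
        using mob_mob[OF x1 disc_mapD[OF phi norm_mob_less[OF x1 w]]] by simp
      then show False using no norm_mob_less[OF x1 w] by blast
    qed
    have "A z - z \<noteq> 0"
    proof (rule Hurwitz_no_zeros[where S=unit_disc and \<F>="\<lambda>n w. \<psi> (r n) w - w" and g="\<lambda>w. A w - w"])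
      show "(\<lambda>w. \<psi> (r n) w - w) holomorphic_on unit_disc" for n
        using d\<psi>[of "r n"] by (auto simp: disc_map_def intro!: holomorphic_intros)
      show "(\<lambda>w. A w - w) holomorphic_on unit_disc" by (intro holomorphic_intros hA)
      show "uniform_limit K (\<lambda>n w. \<psi> (r n) w - w) (\<lambda>w. A w - w) sequentially" if "compact K" "K \<subseteq> unit_disc" for K
        by (intro uniform_limit_intros Aul that)
      show "\<not> (\<lambda>w. A w - w) constant_on unit_disc"
      proof
        assume "(\<lambda>w. A w - w) constant_on unit_disc"
        then obtain k where k: "\<And>w. norm w < 1 \<Longrightarrow> A w - w = k" by (auto simp: constant_on_def)
        have "A (g z0) = g z0" using k[OF z] Az k[OF disc_mapD[OF dg z0]] by simp
        then show False using semi[OF z0] ne by (simp add: z1_def)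
      qed
      show "\<psi> (r n) w - w \<noteq> 0" if "w \<in> unit_disc" for n w using nofix[of w] that by simp
      show "z \<in> unit_disc" using z by simp
    qed auto
    then show False using Az by simp
  qed
  have "g z0 \<noteq> 0 \<or> g z1 \<noteq> 0" using ne by auto
  then have nz: "\<exists>z. norm z < 1 \<and> g z \<noteq> 0" using z0 z1 by blast
  have semi': "\<forall>z. norm z < 1 \<longrightarrow> g (\<phi> z) = mob (A 0) (l * g z)"
    using semi lA disc_mapD[OF dg] by presburger
  have gl': "\<forall>z. norm z < 1 \<longrightarrow> (\<lambda>n. mob ((\<phi> ^^ r n) 0) ((\<phi> ^^ r n) z)) \<longlonglongrightarrow> g z"
    using gl by (simp add: q_def x_def)
  have A01: "norm (A 0) < 1" by (rule disc_mapD[OF dA]) simp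
  show ?thesis
    by (rule exI[of _ g], rule exI[of _ "A 0"], rule exI[of _ l], rule exI[of _ r])
       (intro conjI dg g0 nz A01 l r semi' gl' impI fixd)
qed

text \<open>Writing E_n(z) = z h_n(z) gives g = q_n times h_n o q_n, where q_n is inner in the mean.
  The mean of |h_n o q_n| is at least |h_n(0)|, which is close to 1 for suitable n, so the means of
  |g| approach 1.\<close>

lemma rescaling_limit_inner:
  assumes phi: "inner_function \<phi>" and g: "disc_map g" "g 0 = 0" and gnz: "norm z1 < 1" "g z1 \<noteq> 0"
    and A: "disc_map A" and Ai: "disc_map Ai" and inv: "\<And>z. norm z < 1 \<Longrightarrow> Ai (A z) = z"
    and semi: "\<And>z. norm z < 1 \<Longrightarrow> g (\<phi> z) = A (g z)"
    and lim: "\<And>z. norm z < 1 \<Longrightarrow> (\<lambda>n. mob ((\<phi> ^^ r n) 0) ((\<phi> ^^ r n) z)) \<longlonglongrightarrow> g z"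
  shows "inner_mean g"
proof -
  have dphi: "disc_map \<phi>" by (rule inner_function_disc_map[OF phi])
  define x where "x n = (\<phi> ^^ n) 0" for n
  have dn: "disc_map (\<phi> ^^ n)" for n by (rule disc_map_funpow[OF dphi])
  have x1: "norm (x n) < 1" for n unfolding x_def by (rule disc_mapD[OF dn]) simp
  define q where "q n z = mob (x n) ((\<phi> ^^ n) z)" for n z
  have iq: "inner_mean (q n)" for n unfolding q_def by (rule inner_mean_mob[OF inner_mean_funpow[OF phi] x1])
  have dq: "disc_map (q n)" for n using iq[of n] by (simp add: inner_mean_def)
  have q0: "q n 0 = 0" for n by (simp add: q_def x_def)
  have ql: "(\<lambda>n. q (r n) z) \<longlonglongrightarrow> g z" if "norm z < 1" for z using lim[OF that] by (simp add: q_def x_def)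
  have AiA: "(Ai ^^ n) ((A ^^ n) z) = z" if "norm z < 1" for n z
    using that
  proof (induction n)
    case (Suc n)
    have "(Ai ^^ Suc n) ((A ^^ Suc n) z) = (Ai ^^ n) (Ai (A ((A ^^ n) z)))" by (simp add: funpow_swap1)
    then show ?case using inv[OF disc_mapD[OF disc_map_funpow[OF A] Suc.prems]] Suc by simp
  qed simp
  \<comment> \<open>The semiconjugacy gives g o \<open>\<phi>\<close>^n = A^n o g; applying A^-n
    undoes the iteration and leaves g = E n o q n for every n.\<close>
  define E where "E n z = (Ai ^^ n) (g (mob (x n) z))" for n z
  have dE: "disc_map (E n)" for n unfolding E_def
    by (rule disc_map_compose[OF disc_map_funpow[OF Ai] disc_map_compose[OF g(1) disc_map_mob[OF x1]]])
  have Eq: "E n (q n z) = g z" if z: "norm z < 1" for n z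
  proof -
    have "g ((\<phi> ^^ n) z) = (A ^^ n) (g z)" by (rule funpow_semiconj[where \<phi>=\<phi> and g=g and A=A, OF dphi semi z])
    then show ?thesis using AiA[OF disc_mapD[OF g(1) z]]
      by (simp add: E_def q_def mob_mob[OF x1 disc_mapD[OF dn z]])
  qed
  have E0: "E n 0 = 0" for n using Eq[of 0 n] q0[of n] g(2) by simp
  have "\<forall>n. \<exists>h. schur h \<and> (\<forall>z. norm z < 1 \<longrightarrow> E n z = z * h z)"
    using schur_divide_zero[OF disc_map_imp_schur[OF dE] E0] by metis
  then obtain h where h: "\<And>n. schur (h n)" and Eh: "\<And>n z. norm z < 1 \<Longrightarrow> E n z = z * h n z" by metis
  have gq: "g z = q n z * h n (q n z)" if z: "norm z < 1" for n z
    using Eq[OF z, of n] Eh[OF disc_mapD[OF dq z], of n n] by simp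
  obtain k s where k: "schur k" and s: "strict_mono s" and k1: "\<forall>z. norm z < 1 \<longrightarrow> (\<lambda>n. h (r (s n)) z) \<longlonglongrightarrow> k z"
    and k2: "\<forall>K. compact K \<and> K \<subseteq> unit_disc \<longrightarrow> uniform_limit K (\<lambda>n. h (r (s n))) k sequentially"
    using schur_Montel[of "\<lambda>n. h (r n)", OF h] by blast
  have qs: "(\<lambda>n. q (r (s n)) z1) \<longlonglongrightarrow> g z1"
    using LIMSEQ_subseq_LIMSEQ[OF ql[OF gnz(1)] s] by (simp add: o_def)
  have "(\<lambda>n. h (r (s n)) (q (r (s n)) z1)) \<longlonglongrightarrow> k (g z1)"
    by (rule tendsto_uniform_compose[OF _ _ qs disc_mapD[OF g(1) gnz(1)]])
       (use k2 k in \<open>auto simp: schur_def\<close>)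
  then have "(\<lambda>n. q (r (s n)) z1 * h (r (s n)) (q (r (s n)) z1)) \<longlonglongrightarrow> g z1 * k (g z1)"
    by (intro tendsto_mult qs)
  then have "(\<lambda>n::nat. g z1) \<longlonglongrightarrow> g z1 * k (g z1)" by (simp only: gq[OF gnz(1), symmetric])
  \<comment> \<open>A point where g does not vanish allows the cancellation. The limit k then has
    modulus 1 inside the disc and is the constant 1.\<close>
  then have kg: "k (g z1) = 1" using gnz(2) by (simp add: LIMSEQ_const_iff)
  have k0: "k 0 = 1" using schur_constant[OF k disc_mapD[OF g(1) gnz(1)], of 0] kg by simp
  have hl: "(\<lambda>n. norm (h (r (s n)) 0)) \<longlonglongrightarrow> 1" using tendsto_norm[OF k1[rule_format, of 0]] k0 by simp
  show ?thesis
  proof (rule inner_mean_from_abs[OF g(1)])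
    fix d :: real assume "d > 0"
    define e where "e = d / 2"
    have e: "e > 0" using \<open>d > 0\<close> by (simp add: e_def)
    have "eventually (\<lambda>n. 1 - e < norm (h (r (s n)) 0)) sequentially"
      using order_tendstoD(1)[OF hl, of "1 - e"] e by simp
    \<comment> \<open>A single index is enough: m is fixed before the radius tends to 1, so only the
      innerness of q m is used.\<close>
    then obtain m where m: "1 - e < norm (h m 0)" by (auto simp: eventually_sequentially)
    have hg: "g holomorphic_on unit_disc" using g(1) by (simp add: disc_map_def)
    have hq: "q m holomorphic_on unit_disc" using dq[of m] by (simp add: disc_map_def)
    have hh: "(\<lambda>z. h m (q m z)) holomorphic_on unit_disc"
      using schur_compose[OF h dq] by (simp add: schur_def)
    from eventually_at_left_1[of 0, OF zero_less_one] inner_meanD[OF iq[of m] e]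
    show "eventually (\<lambda>r. 1 - d \<le> (LINT t|circ. norm (g (of_real r * cis t)))) (at_left 1)"
    proof eventually_elim
      fix r :: real assume r: "0 < r \<and> r < 1" and b: "(LINT t|circ. 1 - (norm (q m (of_real r * cis t)))\<^sup>2) < e"
      let ?z = "\<lambda>t. of_real r * cis t"
      have z: "norm (?z t) < 1" for t using r by (simp add: norm_mult)
      note cg = continuous_on_sphere_disc[OF hg] and cq = continuous_on_sphere_disc[OF hq] and ch = continuous_on_sphere_disc[OF hh]
      have i1: "integrable circ (\<lambda>t. norm (g (?z t)))"
        using r by (intro integrable_circle[of r "\<lambda>z. norm (g z)"] continuous_intros cg) auto
      have i2: "integrable circ (\<lambda>t. 1 - (norm (q m (?z t)))\<^sup>2)"
        using r by (intro integrable_circle[of r "\<lambda>z. 1 - (norm (q m z))\<^sup>2"] continuous_intros cq) auto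
      have i3: "integrable circ (\<lambda>t. h m (q m (?z t)))"
        using r by (intro integrable_circle[of r "\<lambda>z. h m (q m z)"] ch) auto
      \<comment> \<open>Multiplying g = q m * h m (q m) by the conjugate of q m produces |q m|^2 h
        m, so the difference is h m times the defect of q m.\<close>
      have pt: "norm (h m (q m (?z t))  - g (?z t) * cnj (q m (?z t))) \<le> 1 - (norm (q m (?z t)))\<^sup>2" for t
      proof -
        let ?w = "q m (?z t)"
        have w: "norm ?w < 1" by (rule disc_mapD[OF dq z])
        have "h m ?w - g (?z t) * cnj ?w = h m ?w * (1 - ?w * cnj ?w)"
          using gq[OF z[of t], of m] by (simp only:) (simp add: algebra_simps)
        also have "1 - ?w * cnj ?w = of_real (1 - (norm ?w)\<^sup>2)" by (simp add: complex_norm_square del: of_real_power)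
        finally have "norm (h m ?w - g (?z t) * cnj ?w) = norm (h m ?w) * \<bar>1 - (norm ?w)\<^sup>2\<bar>" by (simp only: norm_mult norm_of_real)
        also have "\<bar>1 - (norm ?w)\<^sup>2\<bar> = 1 - (norm ?w)\<^sup>2" using w by (simp add: abs_square_le_1 less_imp_le)
        also have "norm (h m ?w) * (1 - (norm ?w)\<^sup>2) \<le> 1 - (norm ?w)\<^sup>2"
          using schurD[OF h w] w by (intro mult_left_le_one_le) (auto simp: abs_square_le_1 less_imp_le)
        finally show ?thesis .
      qed
      have pt': "norm (h m (q m (?z t))) \<le> norm (g (?z t)) + (1 - (norm (q m (?z t)))\<^sup>2)" for t
      proof -
        have "norm (g (?z t) * cnj (q m (?z t))) \<le> norm (g (?z t))"
          using disc_mapD[OF dq z, of m t] by (simp add: norm_mult mult_left_le less_imp_le)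
        then show ?thesis using pt[of t] norm_triangle_sub[of "h m (q m (?z t))" "g (?z t) * cnj (q m (?z t))"] by linarith
      qed
      have "h m 0 = (LINT t|circ. h m (q m (?z t)))" using circle_mean_disc[OF hh, of r] r q0[of m] by simp
      then have "norm (h m 0) = norm (LINT t|circ. h m (q m (?z t)))" by simp
      also have "\<dots> \<le> (LINT t|circ. norm (g (?z t)) + (1 - (norm (q m (?z t)))\<^sup>2))"
        by (rule Bochner_Integration.integral_norm_bound_integral[OF i3 Bochner_Integration.integrable_add[OF i1 i2] pt'])
      also have "\<dots> = (LINT t|circ. norm (g (?z t))) + (LINT t|circ. 1 - (norm (q m (?z t)))\<^sup>2)"
        by (rule Bochner_Integration.integral_add[OF i1 i2])
      finally show "1 - d \<le> (LINT t|circ. norm (g (?z t)))" using m b unfolding e_def by linarith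
    qed
  qed
qed

theorem theorem3p4:
  fixes \<phi> :: "complex \<Rightarrow> complex"
  assumes "inner_function \<phi>" and "positive_hyperbolic_step \<phi>"
  shows "\<exists>B \<tau>. blaschke_product B \<and> \<not> (\<exists>c. \<forall>z\<in>unit_disc. B z = c) \<and>
           norm \<tau> = 1 \<and> (\<forall>z\<in>unit_disc. B (\<phi> z) = \<tau> * B z)"
proof (cases "\<exists>p. norm p < 1 \<and> \<phi> p = p")
  case True
  then show ?thesis
    using fixed_point_eigenfunction[OF inner_function_disc_map[OF assms(1)] assms(2)] by blast
next
  case nofix: False
  have phi: "disc_map \<phi>" by (rule inner_function_disc_map[OF assms(1)])
  obtain g c l r where H: "disc_map g \<and> g 0 = 0 \<and> (\<exists>z. norm z < 1 \<and> g z \<noteq> 0) \<and> norm c < 1 \<and> norm l = 1 \<and> strict_mono (r :: nat \<Rightarrow> nat) \<and>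
    (\<forall>z. norm z < 1 \<longrightarrow> g (\<phi> z) = mob c (l * g z)) \<and>
    (\<forall>z. norm z < 1 \<longrightarrow> (\<lambda>n. mob ((\<phi> ^^ r n) 0) ((\<phi> ^^ r n) z)) \<longlonglongrightarrow> g z) \<and>
    ((\<exists>z. norm z < 1 \<and> mob c (l * z) = z) \<longrightarrow> (\<exists>p. norm p < 1 \<and> \<phi> p = p))"
    using hyperbolic_rescaling[OF phi assms(2)] by (elim exE)
  have g: "disc_map g" "g 0 = 0" and c: "norm c < 1" and l: "norm l = 1"
    and semi: "\<forall>z. norm z < 1 \<longrightarrow> g (\<phi> z) = mob c (l * g z)"
    and lim: "\<forall>z. norm z < 1 \<longrightarrow> (\<lambda>n. mob ((\<phi> ^^ r n) 0) ((\<phi> ^^ r n) z)) \<longlonglongrightarrow> g z"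
    and Afix: "\<And>z. norm z < 1 \<Longrightarrow> mob c (l * z) \<noteq> z"
    using H nofix by blast+
  obtain z1 where z1: "norm z1 < 1" "g z1 \<noteq> 0" using H by blast
  define A where "A z = mob c (l * z)" for z
  define Ai where "Ai z = cnj l * mob c z" for z
  have ll: "cnj l * l = 1" "l * cnj l = 1" using l by (simp_all add: complex_norm_square[symmetric] mult.commute)
  have rot: "disc_map (\<lambda>z. k * z)" if "norm k = 1" for k
    using that unfolding disc_map_def by (auto simp: norm_mult intro!: holomorphic_intros)
  have A: "disc_map A" unfolding A_def by (rule disc_map_compose[OF disc_map_mob[OF c] rot[OF l]])
  have Ai: "disc_map Ai" unfolding Ai_def by (rule disc_map_compose[OF rot disc_map_mob[OF c]]) (simp add: l)
  have inv: "Ai (A z) = z" if z: "norm z < 1" for z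
  proof -
    have "norm (l * z) < 1" using z l by (simp add: norm_mult)
    then show ?thesis using ll by (simp add: A_def Ai_def mob_mob[OF c] mult.assoc[symmetric])
  qed
  have inv': "A (Ai z) = z" if z: "norm z < 1" for z
    using ll by (simp add: A_def Ai_def mob_mob[OF c z] mult.assoc[symmetric])
  have sumA: "summable (\<lambda>n. 1 - (norm ((A ^^ n) 0))\<^sup>2)"
    using automorphism_orbit_summable[OF c l Afix] by (simp add: A_def[abs_def])
  have Anorm: "norm (mob (A x) (A y)) = norm (mob x y)" if x: "norm x < 1" and y: "norm y < 1" for x y
    using schwarz_pick(1)[OF A x y] schwarz_pick(1)[OF Ai disc_mapD[OF A x] disc_mapD[OF A y]] inv[OF x] inv[OF y] by simp
  have Ain: "norm ((Ai ^^ n) 0) < 1" for n by (rule disc_mapD[OF disc_map_funpow[OF Ai]]) simp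
  have An: "norm ((A ^^ n) x) < 1" if "norm x < 1" for n x by (rule disc_mapD[OF disc_map_funpow[OF A] that])
  have Annorm: "norm (mob ((A ^^ n) x) ((A ^^ n) y)) = norm (mob x y)" if "norm x < 1" "norm y < 1" for n x y
    by (induction n) (simp_all add: Anorm An that)
  have AAi: "(A ^^ n) ((Ai ^^ n) z) = z" if "norm z < 1" for n z
  proof (induction n)
    case (Suc n)
    have "(A ^^ Suc n) ((Ai ^^ Suc n) z) = (A ^^ n) (A (Ai ((Ai ^^ n) z)))" by (simp add: funpow_swap1)
    also have "A (Ai ((Ai ^^ n) z)) = (Ai ^^ n) z"
      by (rule inv'[OF disc_mapD[OF disc_map_funpow[OF Ai] that]])
    finally show ?case using Suc by simp
  qed simp
  \<comment> \<open>A^n is an isometry taking A^-n(0) to 0 and 0 to A^n(0), so the backward orbit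
    inherits the summability of the forward one.\<close>
  have eqn: "norm ((Ai ^^ n) 0) = norm ((A ^^ n) 0)" for n
  proof -
    have "norm (mob ((A ^^ n) ((Ai ^^ n) 0)) ((A ^^ n) 0)) = norm (mob ((Ai ^^ n) 0) 0)"
      by (rule Annorm[OF Ain]) simp
    then show ?thesis using AAi[of 0 n] by (simp add: mob_def[of 0])
  qed
  have sumAi: "summable (\<lambda>n. 1 - (norm ((Ai ^^ n) 0))\<^sup>2)" using sumA by (simp add: eqn)
  have semi': "g (\<phi> z) = A (g z)" if "norm z < 1" for z using semi that by (simp add: A_def)
  have ig: "inner_mean g"
    by (rule rescaling_limit_inner[where A=A and Ai=Ai and r=r, OF assms(1) g z1 A Ai inv semi' lim[rule_format]])
  have iA: "inner_mean (\<lambda>z. A (f z))" if "inner_mean f" for f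
    unfolding A_def by (rule inner_mean_mob[OF inner_mean_rotate[OF that l] c])
  have iAi: "inner_mean (\<lambda>z. Ai (f z))" if "inner_mean f" for f
    unfolding Ai_def by (rule inner_mean_rotate[OF inner_mean_mob[OF that c]]) (simp add: l)
  show ?thesis
    by (rule blaschke_eigenfunction[where A=A and Ai=Ai and g=g and \<phi>=\<phi>, OF phi ig g(2) A Ai inv semi' iA iAi sumA sumAi])
qed

end
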